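(* Assume: (1) $Z$ is independent of $\eta$, the $Z_t$ are i.i.d., and for each $\vartheta\in\Theta$, $t\in\mathbb Z$, $\varphi(Z_t,\vartheta)$ has a density $f(x,\vartheta)$; (2) $\eta$ is a Markov chain and there are $\kappa\ge 1$, $\phi_*>0$ such that $\Pr\{\eta_t=b\mid\eta_s=a\}\ge\phi_*$ for all $a,b\in\mathcal H$ and $s,t\in\mathbb Z$ with $|s-t|\ge\kappa$; (3) for each $z\in\mathcal Z$, $a,b\in\mathcal H$, $0<f(\varphi(z,\theta_a(\varepsilon)),\theta_b(\varepsilon))<\infty$ and this is continuous in $\varepsilon$; (4) there is $q\in\mathbb N$ such that for each $z\in\mathcal Z$, $a,b\in\mathcal H$, $f(\varphi(z,\theta_a(\varepsilon)),\theta_b(\varepsilon))$ as a function of $\varepsilon$ belongs to $C^{(q)}$ and all its partial derivatives of order $\le q$ are continuous in $(z,\varepsilon)$; furthermore, for every $r>0$ there is $c=c(r)>2$ such that $\Pr\{M_q(Z_0,r)\ge u\}=O((\log u)^{-c})$ as $u\to\infty$. Then: 1. Almost surely, $\rho_{t,mn}\in C^{(q)}$ for $t=-m+\kappa,\ldots,n-\kappa$. 2. Almost surely, $\rho_t(\varepsilon)=\lim_{m,n\to\infty}\rho_{t,mn}(\varepsilon)$ is strictly positive for all $t$ and $\varepsilon$. 3. For each $t\in\mathbb Z$ and multi-index $\nu$ with $|\nu|\le q$ there is a deterministic function $r_{t,\nu}(\varepsilon_0)\in(0,1)$ of $\varepsilon_0>0$, such that almost surely, as $m,n\to\infty$, $\rho_{t,mn}^{(\nu)}(\varepsilon)$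 converges, with $$\sup_{|\varepsilon|\le\varepsilon_0}\Bigl|\rho_{t,mn}^{(\nu)}(\varepsilon)-\lim_{m,n\to\infty}\rho_{t,mn}^{(\nu)}(\varepsilon)\Bigr|=o\bigl(r_{t,\nu}(\varepsilon_0)^{m\wedge n}\bigr),$$ for all $t\in\mathbb Z$, $\nu$ with $|\nu|\le q$ and $\varepsilon_0>0$.
   Context: Multi-index notation: for $h:\mathbb R^s\to\mathbb R$ and $\nu=(\nu_1,\ldots,\nu_s)$ with nonnegative integer entries, $|\nu|=\nu_1+\cdots+\nu_s$, $h^{(\nu)}=\partial^{|\nu|}h/\partial x_1^{\nu_1}\cdots\partial x_s^{\nu_s}$, $h^{(0)}=h$; $h\in C^{(q)}$ means $h^{(\nu)}$ exists and is continuous for every $|\nu|\le q$. Derivatives of random functions of $\varepsilon$ are taken in $\varepsilon$ with the realization of $(\eta,Z)$ fixed. Model: $\mathcal H$ is a finite set partitioned into nonempty subsets $\mathcal H_0$ and $\mathcal H_1$; $\eta=(\eta_t)_{t\in\mathbb Z}$ is an $\mathcal H$-valued process; $Z=(Z_t)_{t\in\mathbb Z}$ takes values in a Euclidean space $\mathcal Z$; $\Theta\subset\mathbb R^d$ is open; $\varphi(\cdot,\vartheta):\mathcal Z\to\mathcal X$, $\vartheta\in\Theta$, is a family of maps into a Euclidean space $\mathcal X$; $\theta_a:\mathbb R^p\to\Theta$, $a\in\mathcal H$, are functions. For $\varepsilon\in\mathbb R^p$ the observations are $X_t(\varepsilon)=\varphi(Z_t,\theta_{\eta_t}(\varepsilon))$.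 Write $P_t(a)=\Pr\{\eta_t=a\}$. With $\ell_{z,ab}(\varepsilon)=\ln f(\varphi(z,\theta_a(\varepsilon)),\theta_b(\varepsilon))$: $M_0(z,r)=1$ and, for $k>0$, $M_k(z,r)=\sup\{|\ell_{z,ab}^{(\nu)}(\varepsilon)|: 1\le|\nu|\le k,\ |\varepsilon|\le r,\ a,b\in\mathcal H\}$. Let $\sigma=(\sigma_t)$ be an independent copy of $\eta$, also independent of $Z$; $\mathsf E_\sigma$ is expectation with respect to $\sigma$ ($\eta$, $Z$ held fixed). Let $\psi_t(\varepsilon,c)=f(\varphi(Z_t,\theta_{\eta_t}(\varepsilon)),\theta_c(\varepsilon))$. The likelihood ratio is $$\rho_{t,mn}(\varepsilon)=\frac{\Pr\{\eta_t\in\mathcal H_1\mid X_{-m}(\varepsilon),\ldots,X_n(\varepsilon)\}}{\Pr\{\eta_t\in\mathcal H_0\mid X_{-m}(\varepsilon),\ldots,X_n(\varepsilon)\}}=\frac{\sum_{a\in\mathcal H_1}P_t(a)\,\mathsf E_\sigma[\prod_{s=-m}^n\psi_s(\varepsilon,\sigma_s)\mid\sigma_t=a]}{\sum_{a\in\mathcal H_0}P_t(a)\,\mathsf E_\sigma[\prod_{s=-m}^n\psi_s(\varepsilon,\sigma_s)\mid\sigma_t=a]},\qquad m,n\in\mathbb N,$$ the last expression (Bayes formula) being the version used. *)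

theory Defs
  imports "HOL-Probability.Probability" "HOL-Library.Landau_Symbols"
begin

section \<open>Multi-index derivatives\<close>

text \<open>A multi-index for functions on \<open>real ^ 'p\<close> is a function \<open>\<nu> :: 'p \<Rightarrow> nat\<close>. The index type
  carries a linear order, so that the coordinates are ordered as \<open>x\<^sub>1, \<dots>, x\<^sub>s\<close> and the iterated
  derivative has a definite order of differentiation.\<close>

definition mi_size :: "('p::finite \<Rightarrow> nat) \<Rightarrow> nat" where
  "mi_size \<nu> = (\<Sum>i\<in>UNIV. \<nu> i)"

definition partial_deriv :: "'p::finite \<Rightarrow> (real ^ 'p \<Rightarrow> real) \<Rightarrow> real ^ 'p \<Rightarrow> real" where
  "partial_deriv i h x = deriv (\<lambda>s. h (x + s *\<^sub>R axis i 1)) 0"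

definition has_partial_deriv :: "'p::finite \<Rightarrow> (real ^ 'p \<Rightarrow> real) \<Rightarrow> real ^ 'p \<Rightarrow> bool" where
  "has_partial_deriv i h x \<longleftrightarrow> (\<lambda>s. h (x + s *\<^sub>R axis i 1)) field_differentiable (at 0)"

text \<open>The head of the list is the outermost differentiation. Existence of an iterated derivative
  includes the existence of all the inner ones, at every point.\<close>

fun partial_derivs :: "'p::finite list \<Rightarrow> (real ^ 'p \<Rightarrow> real) \<Rightarrow> real ^ 'p \<Rightarrow> real" where
  "partial_derivs [] h = h"
| "partial_derivs (i # is) h = partial_deriv i (partial_derivs is h)"

fun partial_derivs_exist :: "'p::finite list \<Rightarrow> (real ^ 'p \<Rightarrow> real) \<Rightarrow> bool" where
  "partial_derivs_exist [] h \<longleftrightarrow> True"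
| "partial_derivs_exist (i # is) h \<longleftrightarrow>
     partial_derivs_exist is h \<and> (\<forall>x. has_partial_deriv i (partial_derivs is h) x)"

text \<open>The list \<open>x\<^sub>1, \<dots>, x\<^sub>1, \<dots>, x\<^sub>s, \<dots>, x\<^sub>s\<close> with \<open>x\<^sub>i\<close> occurring \<open>\<nu>\<^sub>i\<close> times.\<close>

definition mi_list :: "('p::{finite,linorder} \<Rightarrow> nat) \<Rightarrow> 'p list" where
  "mi_list \<nu> = concat (map (\<lambda>i. replicate (\<nu> i) i) (sorted_list_of_set UNIV))"

definition mi_deriv ::
    "('p::{finite,linorder} \<Rightarrow> nat)
      \<Rightarrow> (real ^ 'p::{finite,linorder} \<Rightarrow> real) \<Rightarrow> real ^ 'p::{finite,linorder} \<Rightarrow> real" where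
  "mi_deriv \<nu> h = partial_derivs (mi_list \<nu>) h"

definition C_class :: "nat \<Rightarrow> (real ^ 'p::{finite,linorder} \<Rightarrow> real) \<Rightarrow> bool" where
  "C_class q h \<longleftrightarrow> (\<forall>\<nu>. mi_size \<nu> \<le> q \<longrightarrow>
     partial_derivs_exist (mi_list \<nu>) h \<and> continuous_on UNIV (mi_deriv \<nu> h))"


section \<open>Independence of random elements of different types\<close>

text \<open>The library's \<open>indep_var\<close> requires both random elements to have values in the same type.\<close>

definition indep_elements ::
    "'w measure \<Rightarrow> 'a measure \<Rightarrow> ('w \<Rightarrow> 'a) \<Rightarrow> 'b measure \<Rightarrow> ('w \<Rightarrow> 'b) \<Rightarrow> bool" where
  "indep_elements M N X N' Y \<longleftrightarrow>
     X \<in> measurable M N \<and> Y \<in> measurable M N' \<and>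
     prob_space.indep_set M {X -` A \<inter> space M | A. A \<in> sets N}
       {Y -` B \<inter> space M | B. B \<in> sets N'}"


section \<open>Markov chains on the integers\<close>

text \<open>Not necessarily time-homogeneous or stationary.\<close>

definition markov_chain :: "'w measure \<Rightarrow> (int \<Rightarrow> 'w \<Rightarrow> 'h::finite) \<Rightarrow> bool" where
  "markov_chain M \<eta> \<longleftrightarrow>
     (\<forall>t. \<eta> t \<in> measurable M (count_space UNIV)) \<and>
     (\<forall>t (k::nat) g.
        measure M {\<omega> \<in> space M. \<forall>s\<in>{t - int k..t}. \<eta> s \<omega> = g s} > 0 \<longrightarrow>
        \<P>(\<omega> in M. \<eta> (t + 1) \<omega> = g (t + 1) \<bar> \<forall>s\<in>{t - int k..t}. \<eta> s \<omega> = g s)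
          = \<P>(\<omega> in M. \<eta> (t + 1) \<omega> = g (t + 1) \<bar> \<eta> t \<omega> = g t))"


section \<open>The model\<close>

text \<open>Densities \<open>f x v\<close> are \<open>ennreal\<close>-valued, as in the library's \<open>distributed\<close>; the real number
  \<open>lik \<phi> f \<theta> z a b \<epsilon>\<close> is \<open>f(\<phi>(z, \<theta>\<^sub>a(\<epsilon>)), \<theta>\<^sub>b(\<epsilon>))\<close> whenever that value is finite.\<close>

definition lik :: "('z \<Rightarrow> 'd \<Rightarrow> 'x) \<Rightarrow> ('x \<Rightarrow> 'd \<Rightarrow> ennreal) \<Rightarrow> ('h \<Rightarrow> 'e \<Rightarrow> 'd)
    \<Rightarrow> 'z \<Rightarrow> 'h \<Rightarrow> 'h \<Rightarrow> 'e \<Rightarrow> real" where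
  "lik \<phi> f \<theta> z a b \<epsilon> = enn2real (f (\<phi> z (\<theta> a \<epsilon>)) (\<theta> b \<epsilon>))"

definition loglik :: "('z \<Rightarrow> 'd \<Rightarrow> 'x) \<Rightarrow> ('x \<Rightarrow> 'd \<Rightarrow> ennreal) \<Rightarrow> ('h \<Rightarrow> 'e \<Rightarrow> 'd)
    \<Rightarrow> 'z \<Rightarrow> 'h \<Rightarrow> 'h \<Rightarrow> 'e \<Rightarrow> real" where
  "loglik \<phi> f \<theta> z a b \<epsilon> = ln (lik \<phi> f \<theta> z a b \<epsilon>)"

text \<open>\<open>M\<^sub>k(z, r)\<close>. The supremum is that of the reals; it is finite as soon as the likelihoods are
  positive and of class \<open>C\<^sup>k\<close> in \<open>\<epsilon>\<close>, the ball \<open>|\<epsilon>| \<le> r\<close> being compact.\<close>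

definition loglik_deriv_sup :: "('z \<Rightarrow> 'd \<Rightarrow> 'x) \<Rightarrow> ('x \<Rightarrow> 'd \<Rightarrow> ennreal)
    \<Rightarrow> ('h \<Rightarrow> real ^ 'p::{finite,linorder} \<Rightarrow> 'd) \<Rightarrow> nat \<Rightarrow> 'z \<Rightarrow> real \<Rightarrow> real" where
  "loglik_deriv_sup \<phi> f \<theta> k z r =
     (if k = 0 then 1
      else Sup {\<bar>mi_deriv \<nu> (loglik \<phi> f \<theta> z a b) \<epsilon>\<bar> | \<nu> \<epsilon> a b.
                 1 \<le> mi_size \<nu> \<and> mi_size \<nu> \<le> k \<and> norm \<epsilon> \<le> r})"

definition obs :: "('z \<Rightarrow> 'd \<Rightarrow> 'x) \<Rightarrow> ('h \<Rightarrow> 'e \<Rightarrow> 'd) \<Rightarrow> (int \<Rightarrow> 'w \<Rightarrow> 'h) \<Rightarrow> (int \<Rightarrow> 'w \<Rightarrow> 'z)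
    \<Rightarrow> int \<Rightarrow> 'w \<Rightarrow> 'e \<Rightarrow> 'x" where
  "obs \<phi> \<theta> \<eta> Z t \<omega> \<epsilon> = \<phi> (Z t \<omega>) (\<theta> (\<eta> t \<omega>) \<epsilon>)"

definition psi :: "('z \<Rightarrow> 'd \<Rightarrow> 'x) \<Rightarrow> ('x \<Rightarrow> 'd \<Rightarrow> ennreal) \<Rightarrow> ('h \<Rightarrow> 'e \<Rightarrow> 'd)
    \<Rightarrow> (int \<Rightarrow> 'w \<Rightarrow> 'h) \<Rightarrow> (int \<Rightarrow> 'w \<Rightarrow> 'z) \<Rightarrow> int \<Rightarrow> 'w \<Rightarrow> 'e \<Rightarrow> 'h \<Rightarrow> real" where
  "psi \<phi> f \<theta> \<eta> Z t \<omega> \<epsilon> c = enn2real (f (obs \<phi> \<theta> \<eta> Z t \<omega> \<epsilon>) (\<theta> c \<epsilon>))"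

text \<open>Expectation with respect to an independent copy \<open>\<sigma>\<close> of \<open>\<eta>\<close>, with \<open>\<eta>\<close> and \<open>Z\<close> held fixed, is
  integration over paths \<open>\<sigma>\<close> against the law of the process \<open>\<eta>\<close>. Conditioning on the event
  \<open>\<sigma>\<^sub>t = a\<close> is passing to the conditional measure, which is the library's \<open>uniform_measure\<close>.\<close>

definition path_law :: "'w measure \<Rightarrow> (int \<Rightarrow> 'w \<Rightarrow> 'h) \<Rightarrow> (int \<Rightarrow> 'h) measure" where
  "path_law M \<eta> = distr M (PiM UNIV (\<lambda>_. count_space UNIV)) (\<lambda>\<omega> t. \<eta> t \<omega>)"

definition copy_cond_expectation ::
    "'w measure \<Rightarrow> (int \<Rightarrow> 'w \<Rightarrow> 'h) \<Rightarrow> int \<Rightarrow> 'h \<Rightarrow> ((int \<Rightarrow> 'h) \<Rightarrow> real) \<Rightarrow> real" where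
  "copy_cond_expectation M \<eta> t a F =
     (\<integral>\<sigma>. F \<sigma> \<partial>(uniform_measure (path_law M \<eta>) {\<sigma>. \<sigma> t = a}))"

text \<open>\<open>P\<^sub>t(a) E\<^sub>\<sigma>[\<Prod>\<^sub>s \<psi>\<^sub>s(\<epsilon>, \<sigma>\<^sub>s) | \<sigma>\<^sub>t = a]\<close> summed over \<open>a \<in> A\<close>, with \<open>s\<close> running from \<open>-m\<close> to \<open>n\<close>.\<close>

definition class_weight :: "'w measure \<Rightarrow> (int \<Rightarrow> 'w \<Rightarrow> 'h) \<Rightarrow> (int \<Rightarrow> 'w \<Rightarrow> 'z)
    \<Rightarrow> ('z \<Rightarrow> 'd \<Rightarrow> 'x) \<Rightarrow> ('x \<Rightarrow> 'd \<Rightarrow> ennreal) \<Rightarrow> ('h \<Rightarrow> 'e \<Rightarrow> 'd)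
    \<Rightarrow> 'h set \<Rightarrow> int \<Rightarrow> nat \<Rightarrow> nat \<Rightarrow> 'w \<Rightarrow> 'e \<Rightarrow> real" where
  "class_weight M \<eta> Z \<phi> f \<theta> A t m n \<omega> \<epsilon> =
     (\<Sum>a\<in>A. \<P>(\<omega>' in M. \<eta> t \<omega>' = a) *
        copy_cond_expectation M \<eta> t a
          (\<lambda>\<sigma>. \<Prod>s\<in>{- int m..int n}. psi \<phi> f \<theta> \<eta> Z s \<omega> \<epsilon> (\<sigma> s)))"

definition lratio :: "'w measure \<Rightarrow> (int \<Rightarrow> 'w \<Rightarrow> 'h) \<Rightarrow> (int \<Rightarrow> 'w \<Rightarrow> 'z)
    \<Rightarrow> ('z \<Rightarrow> 'd \<Rightarrow> 'x) \<Rightarrow> ('x \<Rightarrow> 'd \<Rightarrow> ennreal) \<Rightarrow> ('h \<Rightarrow> 'e \<Rightarrow> 'd)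
    \<Rightarrow> 'h set \<Rightarrow> 'h set \<Rightarrow> int \<Rightarrow> nat \<Rightarrow> nat \<Rightarrow> 'w \<Rightarrow> 'e \<Rightarrow> real" where
  "lratio M \<eta> Z \<phi> f \<theta> H0 H1 t m n \<omega> \<epsilon> =
     class_weight M \<eta> Z \<phi> f \<theta> H1 t m n \<omega> \<epsilon> / class_weight M \<eta> Z \<phi> f \<theta> H0 t m n \<omega> \<epsilon>"

end

theory Submission
  imports Defs
begin

text \<open>
  Write \<open>G\<^sub>s(c)\<close> for the likelihood of the observation at time \<open>s\<close> under regime \<open>c\<close>. For fixed \<open>\<eta>\<close> and \<open>Z\<close>,
  the Markov property at time \<open>t\<close> factorizes the weight of a set \<open>A\<close> of regimes as
  \<open>\<Sum>a\<in>A. P\<^sub>t(a) G\<^sub>t(a) U(a) V(a)\<close>, where \<open>V(a)\<close> is the total mass of the weighted paths that start in \<open>a\<close>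
  and run through the \<open>n - t\<close> future times, and \<open>U(a)\<close> is the same quantity for the reversed chain and
  the \<open>m + t\<close> past times (\<open>class_weight_eq\<close>). The ratio is unchanged if \<open>U\<close> and \<open>V\<close> are divided by their values at a
  fixed state. It is then a quotient of sums of products of two families, one depending
  only on \<open>m\<close> and the other only on \<open>n\<close>, so everything reduces to one-sided chains: the normalized mass
  after \<open>N\<close> steps, and all its derivatives up to order \<open>q\<close>, should converge at a geometric rate in \<open>N\<close>,
  uniformly on balls. Separating past and future first is essential. The derivatives of a mass are
  controlled by sums of \<open>M\<^sub>q(Z\<^sub>s)\<close> over the whole window, and in a two-sided estimate such a sum over
  the longer side could not be absorbed by a rate in \<open>min m n\<close>.

  Forgetting of the initial state. The cross difference
  \<open>D\<^sub>N(a, b) = V\<^sub>N\<^sub>+\<^sub>1(a) V\<^sub>N(b) - V\<^sub>N\<^sub>+\<^sub>1(b) V\<^sub>N(a)\<close> is antisymmetric in \<open>(a, b)\<close>. If \<open>T\<close> denotes the weights of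
  a block of \<open>\<kappa>\<close> steps, then prefixing the block gives \<open>\<Sum>c d. T(a, c) T(b, d) D\<^sub>N(c, d)\<close>, and by antisymmetry a
  constant may be subtracted from all the weights \<open>T(a, c) T(b, d)\<close>. If the likelihoods in the block lie
  in \<open>[1/C, C]\<close>, the mixing condition makes these weights comparable, so a suitable constant shrinks them by
  a factor \<open>\<lambda> < 1\<close>. Hence \<open>D\<^sub>N\<close> is at most \<open>\<lambda>\<close> to the number of such good blocks, times the corresponding
  sum \<open>V\<^sub>N\<^sub>+\<^sub>1(a) V\<^sub>N(b) + V\<^sub>N\<^sub>+\<^sub>1(b) V\<^sub>N(a)\<close>.

  Derivatives. A function has the jet bound \<open>(B, S)\<close> at a point if its derivatives of order \<open>k \<le> q\<close> are
  at most \<open>B S\<^sup>k\<close> there. Jet bounds multiply as \<open>(B, S)(B', S') = (B B', S + S')\<close>, pass to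
  reciprocals, and a likelihood whose logarithm has derivatives up to order \<open>q\<close> bounded by \<open>M \<ge> 1\<close> has a
  jet bound \<open>(G, 2\<^sup>q M)\<close>, with its own value as first component. So the estimate of \<open>D\<^sub>N\<close> survives
  differentiation: only the second component grows, to a multiple of \<open>\<Sum>s. M\<^sub>q(Z\<^sub>s)\<close>
  (\<open>jet_bound_cross_diff\<close>). Consequently the derivatives of the normalized mass change in step \<open>N\<close> by at
  most a constant times \<open>\<lambda>\<close> to the number of good blocks times the \<open>q\<close>-th power of that sum (\<open>nmass_limit\<close>).

  Randomness. The pairs \<open>(z, \<epsilon>)\<close> in a compact set have likelihoods in some \<open>[1/C, C]\<close>. As the
  \<open>Z\<^sub>s\<close> are independent, almost surely \<open>Z\<^sub>s\<close> lies in a large ball for all but a small proportion of the times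
  (\<open>AE_count_le\<close>), so the number of good blocks grows linearly. The logarithmic tail of
  \<open>M\<^sub>q\<close> and the Borel-Cantelli lemma show that \<open>M\<^sub>q(Z\<^sub>s)\<close> grows more slowly than any exponential
  (\<open>AE_subexponential\<close>). Thus the geometric decay wins.
\<close>

section \<open>Partial derivatives and smoothness along lists of coordinates\<close>

lemma has_partial_deriv_iff:
  "has_partial_deriv i h x \<longleftrightarrow>
     ((\<lambda>s. h (x + s *\<^sub>R axis i 1)) has_field_derivative partial_deriv i h x) (at 0)"
  unfolding has_partial_deriv_def partial_deriv_def by (simp add: DERIV_deriv_iff_field_differentiable)

lemma partial_derivI:
  assumes "((\<lambda>s. h (x + s *\<^sub>R axis i 1)) has_field_derivative D) (at 0)"
  shows "has_partial_deriv i h x" "partial_deriv i h x = D"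
  using assms DERIV_imp_deriv[OF assms]
  by (auto simp: has_partial_deriv_def partial_deriv_def field_differentiable_def)

definition partially_differentiable :: "'p::finite \<Rightarrow> (real ^ 'p \<Rightarrow> real) \<Rightarrow> bool" where
  "partially_differentiable i h \<longleftrightarrow> (\<forall>x. has_partial_deriv i h x)"

lemma partially_differentiableI:
  assumes "\<And>x. ((\<lambda>s. h (x + s *\<^sub>R axis i 1)) has_field_derivative D x) (at 0)"
  shows "partially_differentiable i h" "partial_deriv i h = D"
  using partial_derivI[OF assms] by (auto simp: partially_differentiable_def fun_eq_iff)

lemma partially_differentiableD:
  "partially_differentiable i h \<Longrightarrow>
     ((\<lambda>s. h (x + s *\<^sub>R axis i 1)) has_field_derivative partial_deriv i h x) (at 0)"
  by (simp add: partially_differentiable_def has_partial_deriv_iff)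

lemma partial_deriv_const:
  "partially_differentiable i (\<lambda>_. c)" "partial_deriv i (\<lambda>_. c) = (\<lambda>_. 0)"
  using partially_differentiableI[of "\<lambda>_. c" i "\<lambda>_. 0"] by auto

lemma partial_deriv_add:
  assumes "partially_differentiable i h" "partially_differentiable i k"
  shows "partially_differentiable i (\<lambda>x. h x + k x)"
    "partial_deriv i (\<lambda>x. h x + k x) = (\<lambda>x. partial_deriv i h x + partial_deriv i k x)"
  by (rule partially_differentiableI, rule DERIV_add; rule partially_differentiableD, fact)+

lemma partial_deriv_mult:
  assumes "partially_differentiable i h" "partially_differentiable i k"
  shows "partially_differentiable i (\<lambda>x. h x * k x)"
    "partial_deriv i (\<lambda>x. h x * k x) = (\<lambda>x. partial_deriv i h x * k x + h x * partial_deriv i k x)"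
proof -
  have *: "((\<lambda>s. h (x + s *\<^sub>R axis i 1) * k (x + s *\<^sub>R axis i 1)) has_field_derivative
      partial_deriv i h x * k x + h x * partial_deriv i k x) (at 0)" for x
    using DERIV_mult[OF assms[THEN partially_differentiableD]] by (simp add: mult.commute add.commute)
  show "partially_differentiable i (\<lambda>x. h x * k x)"
    "partial_deriv i (\<lambda>x. h x * k x) = (\<lambda>x. partial_deriv i h x * k x + h x * partial_deriv i k x)"
    by (rule partially_differentiableI[OF *])+
qed

lemma partial_deriv_compose:
  assumes "partially_differentiable i h" "\<And>x. (F has_field_derivative F' x) (at (h x))"
  shows "partially_differentiable i (\<lambda>x. F (h x))"
    "partial_deriv i (\<lambda>x. F (h x)) = (\<lambda>x. F' x * partial_deriv i h x)"
proof -
  have *: "((\<lambda>s. F (h (x + s *\<^sub>R axis i 1))) has_field_derivative F' x * partial_deriv i h x) (at 0)" for x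
    using DERIV_chain2[OF _ partially_differentiableD[OF assms(1), of x], of F] assms(2)[of x] by simp
  show "partially_differentiable i (\<lambda>x. F (h x))"
    "partial_deriv i (\<lambda>x. F (h x)) = (\<lambda>x. F' x * partial_deriv i h x)"
    by (rule partially_differentiableI[OF *])+
qed

lemma partial_deriv_inverse:
  assumes "partially_differentiable i h" "\<And>x. h x \<noteq> 0"
  shows "partially_differentiable i (\<lambda>x. inverse (h x))"
    "partial_deriv i (\<lambda>x. inverse (h x)) =
       (\<lambda>x. (- 1) * (partial_deriv i h x * (inverse (h x) * inverse (h x))))"
  using partial_deriv_compose[OF assms(1) DERIV_inverse, OF assms(2)]
  by (simp_all add: power2_eq_square mult_ac)

lemma partial_deriv_ln:
  assumes "partially_differentiable i h" "\<And>x. h x > 0"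
  shows "partially_differentiable i (\<lambda>x. ln (h x))"
    "partial_deriv i (\<lambda>x. ln (h x)) = (\<lambda>x. partial_deriv i h x * inverse (h x))"
  using partial_deriv_compose[OF assms(1) DERIV_ln, OF assms(2)]
  by (simp_all add: mult_ac)

lemma partial_deriv_exp:
  assumes "partially_differentiable i h"
  shows "partially_differentiable i (\<lambda>x. exp (h x))"
    "partial_deriv i (\<lambda>x. exp (h x)) = (\<lambda>x. exp (h x) * partial_deriv i h x)"
  using partial_deriv_compose[OF assms(1) DERIV_exp] by simp_all

text \<open>
  Coordinates are listed in the order of differentiation, innermost first. This makes \<open>smooth_along\<close> and
  the jet bounds below recursive in the differentiated function, as the closure proofs require; they
  concern the derivatives along all subsequences of the list, which are exactly those that the Leibniz
  rule produces. The parameter \<open>z\<close> is not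
  differentiated; joint continuity in it serves the measurability of suprema of derivatives.
\<close>

fun smooth_along :: "'p::finite list \<Rightarrow> ('z::topological_space \<Rightarrow> real ^ 'p \<Rightarrow> real) \<Rightarrow> bool" where
  "smooth_along [] h \<longleftrightarrow> continuous_on UNIV (\<lambda>(z, x). h z x)"
| "smooth_along (i # L) h \<longleftrightarrow> smooth_along L h \<and> (\<forall>z. partially_differentiable i (h z)) \<and>
     smooth_along L (\<lambda>z. partial_deriv i (h z))"

lemma smooth_along_const: "smooth_along L (\<lambda>_ _. c)"
proof (induction L arbitrary: c)
  case (Cons i L)
  then show ?case using Cons by (simp add: partial_deriv_const)
qed (simp add: case_prod_unfold)

lemma smooth_along_add:
  "smooth_along L h \<Longrightarrow> smooth_along L k \<Longrightarrow> smooth_along L (\<lambda>z x. h z x + k z x)"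
proof (induction L arbitrary: h k)
  case (Cons i L)
  have "partial_deriv i (\<lambda>x. h z x + k z x) = (\<lambda>x. partial_deriv i (h z) x + partial_deriv i (k z) x)" for z
    using Cons.prems by (simp add: partial_deriv_add)
  then show ?case using Cons by (simp add: partial_deriv_add)
qed (auto simp: case_prod_unfold intro!: continuous_intros)

lemma smooth_along_mult:
  "smooth_along L h \<Longrightarrow> smooth_along L k \<Longrightarrow> smooth_along L (\<lambda>z x. h z x * k z x)"
proof (induction L arbitrary: h k)
  case (Cons i L)
  have "partial_deriv i (\<lambda>x. h z x * k z x) =
      (\<lambda>x. partial_deriv i (h z) x * k z x + h z x * partial_deriv i (k z) x)" for z
    using Cons.prems by (simp add: partial_deriv_mult)
  then show ?case using Cons by (simp add: partial_deriv_mult smooth_along_add)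
qed (auto simp: case_prod_unfold intro!: continuous_intros)

lemma smooth_along_inverse:
  "smooth_along L h \<Longrightarrow> (\<And>z x. h z x \<noteq> 0) \<Longrightarrow> smooth_along L (\<lambda>z x. inverse (h z x))"
proof (induction L arbitrary: h)
  case (Cons i L)
  have eq: "partial_deriv i (\<lambda>x. inverse (h z x)) =
      (\<lambda>x. (- 1) * (partial_deriv i (h z) x * (inverse (h z x) * inverse (h z x))))" for z
    using Cons.prems by (simp add: partial_deriv_inverse)
  show ?case using Cons unfolding smooth_along.simps eq
    by (intro conjI smooth_along_mult smooth_along_const allI partial_deriv_inverse(1)) auto
qed (auto simp: case_prod_unfold intro!: continuous_intros)

lemma smooth_along_ln:
  "smooth_along L h \<Longrightarrow> (\<And>z x. h z x > 0) \<Longrightarrow> smooth_along L (\<lambda>z x. ln (h z x))"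
proof (induction L arbitrary: h)
  case (Cons i L)
  have ne: "h z x \<noteq> 0" for z x using Cons.prems(2)[of z x] by simp
  have eq: "partial_deriv i (\<lambda>x. ln (h z x)) = (\<lambda>x. partial_deriv i (h z) x * inverse (h z x))" for z
    using Cons.prems by (simp add: partial_deriv_ln)
  show ?case using Cons ne unfolding smooth_along.simps eq
    by (intro conjI smooth_along_mult smooth_along_inverse allI partial_deriv_ln(1)) auto
next
  case Nil
  then show ?case
    by (auto simp: case_prod_unfold less_imp_neq[THEN not_sym] intro!: continuous_on_ln)
qed

lemma smooth_along_sum:
  "(\<And>a. a \<in> A \<Longrightarrow> smooth_along L (h a)) \<Longrightarrow> smooth_along L (\<lambda>z x. \<Sum>a\<in>A. h a z x)"
  by (induction A rule: infinite_finite_induct) (simp_all add: smooth_along_const smooth_along_add)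

lemma smooth_along_slice: "smooth_along L h \<Longrightarrow> smooth_along L (\<lambda>_ :: 'z::topological_space. h z)"
proof (induction L arbitrary: h)
  case Nil
  have "continuous_on UNIV ((\<lambda>(z, x). h z x) \<circ> (\<lambda>p :: 'z \<times> _. (z, snd p)))"
    using Nil by (intro continuous_on_compose continuous_intros) (auto elim: continuous_on_subset)
  then show ?case by (simp add: o_def case_prod_unfold)
qed auto

lemma partial_derivs_append: "partial_derivs (L @ L') h = partial_derivs L (partial_derivs L' h)"
  by (induction L) auto

lemma partial_derivs_exist_append:
  "partial_derivs_exist (L @ L') h \<longleftrightarrow> partial_derivs_exist L' h \<and> partial_derivs_exist L (partial_derivs L' h)"
  by (induction L) (auto simp: partial_derivs_append)

lemma smooth_alongD:
  assumes "smooth_along L h"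
  shows "partial_derivs_exist (rev L) (h z)"
    and "continuous_on UNIV (\<lambda>(z, x). partial_derivs (rev L) (h z) x)"
proof -
  have "partial_derivs_exist (rev L) (h z) \<and> continuous_on UNIV (\<lambda>(z, x). partial_derivs (rev L) (h z) x)"
    using assms
    by (induction L arbitrary: h) (auto simp: partial_derivs_append partial_derivs_exist_append partially_differentiable_def)
  then show "partial_derivs_exist (rev L) (h z)"
    "continuous_on UNIV (\<lambda>(z, x). partial_derivs (rev L) (h z) x)" by auto
qed

lemma smooth_alongI:
  assumes "\<And>L' z. subseq L' L \<Longrightarrow> partial_derivs_exist (rev L') (h z)"
    and "\<And>L'. subseq L' L \<Longrightarrow> continuous_on UNIV (\<lambda>(z, x). partial_derivs (rev L') (h z) x)"
  shows "smooth_along L h"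
  using assms
proof (induction L arbitrary: h)
  case Nil
  from Nil(2)[of "[]"] show ?case by simp
next
  case (Cons i L)
  have "smooth_along L h" by (rule Cons.IH; rule Cons.prems; rule list_emb_Cons)
  moreover have "partially_differentiable i (h z)" for z
    using Cons.prems(1)[of "[i]" z] by (simp add: subseq_singleton_left partially_differentiable_def)
  moreover have "smooth_along L (\<lambda>z. partial_deriv i (h z))"
  proof (rule Cons.IH)
    fix L' assume L': "subseq L' L"
    then show "partial_derivs_exist (rev L') (partial_deriv i (h z))" for z
      using Cons.prems(1)[of "i # L'" z] by (simp add: partial_derivs_exist_append)
    show "continuous_on UNIV (\<lambda>(z, x). partial_derivs (rev L') (partial_deriv i (h z)) x)"
      using L' Cons.prems(2)[of "i # L'"] by (simp add: partial_derivs_append)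
  qed
  ultimately show ?case by simp
qed

section \<open>Jet bounds\<close>

text \<open>
  For \<open>S \<ge> 0\<close> this bounds the derivative at \<open>x\<close> along every subsequence \<open>L'\<close> of \<open>L\<close> by \<open>B * S ^ length L'\<close>, see
  \<open>jet_boundI\<close> and \<open>jet_boundD\<close>.
\<close>

fun jet_bound :: "real ^ 'p::finite \<Rightarrow> 'p list \<Rightarrow> (real ^ 'p \<Rightarrow> real) \<Rightarrow> real \<Rightarrow> real \<Rightarrow> bool" where
  "jet_bound x [] h B S \<longleftrightarrow> \<bar>h x\<bar> \<le> B"
| "jet_bound x (i # L) h B S \<longleftrightarrow> jet_bound x L h B S \<and> partially_differentiable i h \<and>
     jet_bound x L (partial_deriv i h) (B * S) S"

lemma jet_bound_value: "jet_bound x L h B S \<Longrightarrow> \<bar>h x\<bar> \<le> B"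
  by (induction L) auto

lemma jet_bound_mono:
  "jet_bound x L h B S \<Longrightarrow> B \<le> B' \<Longrightarrow> 0 \<le> S \<Longrightarrow> S \<le> S' \<Longrightarrow> jet_bound x L h B' S'"
proof (induction L arbitrary: h B B')
  case (Cons i L)
  from Cons.prems have "0 \<le> B" using jet_bound_value by fastforce
  then have "B * S \<le> B' * S'" using Cons.prems by (intro mult_mono) auto
  then show ?case using Cons by auto
qed auto

lemma jet_bound_rescale:
  "jet_bound x L h B (K * S) \<Longrightarrow> K \<ge> 1 \<Longrightarrow> 0 \<le> S \<Longrightarrow> jet_bound x L h (B * K ^ length L) S"
proof (induction L arbitrary: h B)
  case (Cons i L)
  note K = Cons.prems(2) and S = Cons.prems(3)
  have L: "jet_bound x L h B (K * S)" "partially_differentiable i h"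
    "jet_bound x L (partial_deriv i h) (B * (K * S)) (K * S)"
    using Cons.prems(1) by auto
  have "0 \<le> B" using jet_bound_value[OF L(1)] by linarith
  moreover have "K ^ length L \<le> K ^ length (i # L)" using K by (intro power_increasing) auto
  ultimately have "B * K ^ length L \<le> B * K ^ length (i # L)"
    by (intro mult_left_mono) auto
  then have "jet_bound x L h (B * K ^ length (i # L)) S"
    using jet_bound_mono[OF Cons.IH[OF L(1) K S] _ S order.refl] by blast
  moreover have "B * (K * S) * K ^ length L = B * K ^ length (i # L) * S" by simp
  then have "jet_bound x L (partial_deriv i h) (B * K ^ length (i # L) * S) S"
    using Cons.IH[OF L(3) K S] by metis
  ultimately show ?case using L(2) by simp
qed auto

text \<open>
  A loss in the first component costs nothing if the value itself obeys the sharper bound: every derivative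
  carries at least one factor \<open>S\<close>, which can absorb the constant. This is how a contraction of values
  becomes a contraction of jets.
\<close>

lemma jet_bound_sharpen:
  "jet_bound x L h B S \<Longrightarrow> \<bar>h x\<bar> \<le> B' \<Longrightarrow> B \<le> K * B' \<Longrightarrow> K \<ge> 1 \<Longrightarrow> 0 \<le> S
    \<Longrightarrow> jet_bound x L h B' (K * S)"
proof (induction L arbitrary: h)
  case (Cons i L)
  have "S \<le> K * S" using Cons.prems by (simp add: mult_le_cancel_right1)
  moreover have "B * S \<le> B' * (K * S)"
    using mult_right_mono[OF Cons.prems(3,5)] by (simp add: mult_ac)
  ultimately have "jet_bound x L (partial_deriv i h) (B' * (K * S)) (K * S)"
    using Cons.prems by (auto intro: jet_bound_mono)
  then show ?case using Cons by auto
qed auto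

lemma jet_bound_const: "0 \<le> S \<Longrightarrow> \<bar>c\<bar> \<le> B \<Longrightarrow> jet_bound x L (\<lambda>_. c) B S"
proof (induction L arbitrary: c B)
  case (Cons i L)
  then show ?case using Cons by (auto simp: partial_deriv_const)
qed auto

lemma jet_bound_add:
  "jet_bound x L h B S \<Longrightarrow> jet_bound x L k B' S \<Longrightarrow> jet_bound x L (\<lambda>x. h x + k x) (B + B') S"
proof (induction L arbitrary: h k B B')
  case (Cons i L)
  have "partial_deriv i (\<lambda>x. h x + k x) = (\<lambda>x. partial_deriv i h x + partial_deriv i k x)"
    using Cons.prems by (simp add: partial_deriv_add)
  then show ?case using Cons by (auto simp: partial_deriv_add distrib_right)
qed auto

text \<open>
  This is the Leibniz rule: summing over the distributions of the \<open>k\<close> differentiations over the two factors gives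
  the binomial expansion of \<open>(S + S') ^ k\<close>.
\<close>

lemma jet_bound_mult:
  "jet_bound x L h B S \<Longrightarrow> jet_bound x L k B' S' \<Longrightarrow> 0 \<le> S \<Longrightarrow> 0 \<le> S'
    \<Longrightarrow> jet_bound x L (\<lambda>x. h x * k x) (B * B') (S + S')"
proof (induction L arbitrary: h k B B')
  case Nil then show ?case by (simp add: abs_mult mult_mono')
next
  case (Cons i L)
  have eq: "partial_deriv i (\<lambda>x. h x * k x) = (\<lambda>x. partial_deriv i h x * k x + h x * partial_deriv i k x)"
    using Cons.prems by (simp add: partial_deriv_mult)
  have "jet_bound x L (\<lambda>x. partial_deriv i h x * k x + h x * partial_deriv i k x)
     (B * S * B' + B * (B' * S')) (S + S')"
    using Cons by (intro jet_bound_add Cons.IH) auto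
  moreover have "B * S * B' + B * (B' * S') = B * B' * (S + S')" by (simp add: algebra_simps)
  ultimately show ?case using Cons by (auto simp: partial_deriv_mult eq)
qed

lemma jet_bound_cmult:
  "jet_bound x L h B S \<Longrightarrow> 0 \<le> S \<Longrightarrow> jet_bound x L (\<lambda>x. c * h x) (\<bar>c\<bar> * B) S"
  using jet_bound_mult[OF jet_bound_const[of 0 c "\<bar>c\<bar>"], of x L h B S] by simp

lemma jet_bound_diff:
  "jet_bound x L h B S \<Longrightarrow> jet_bound x L k B' S \<Longrightarrow> 0 \<le> S \<Longrightarrow> jet_bound x L (\<lambda>x. h x - k x) (B + B') S"
  using jet_bound_add[OF _ jet_bound_cmult[of x L k B' S "-1"], of h B] by simp

lemma jet_bound_sum:
  "(\<And>a. a \<in> A \<Longrightarrow> jet_bound x L (h a) (B a) S) \<Longrightarrow> 0 \<le> S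
    \<Longrightarrow> jet_bound x L (\<lambda>x. \<Sum>a\<in>A. h a x) (\<Sum>a\<in>A. B a) S"
  by (induction A rule: infinite_finite_induct) (simp_all add: jet_bound_const jet_bound_add)

text \<open>
  The derivative of \<open>1/h\<close> is \<open>- h' (1/h)\<^sup>2\<close>, whose jet bound by induction is \<open>(S/h, (1 + 2c) S)\<close>; since
  \<open>1 + 2c \<le> 3c\<close>, rescaling by 3 for each remaining differentiation leads back to \<open>c S\<close> as soon as
  \<open>c \<ge> 3 ^ length L\<close>.
\<close>

lemma jet_bound_inverse:
  assumes "jet_bound x L h (h x) S" "\<And>y. h y > 0" "0 \<le> S" "3 ^ length L \<le> c"
  shows "jet_bound x L (\<lambda>x. inverse (h x)) (inverse (h x)) (c * S)"
  using assms(1,4)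
proof (induction L)
  case Nil
  then show ?case using assms(2)[of x] by simp
next
  case (Cons i L)
  have c: "3 ^ length L \<le> c" "1 \<le> c"
    using Cons.prems(2) one_le_power[of "3::real" "length L"] by (simp, linarith)+
  have ne: "h y \<noteq> 0" for y using assms(2)[of y] by simp
  have IH: "jet_bound x L (\<lambda>x. inverse (h x)) (inverse (h x)) (c * S)"
    using Cons c by auto
  have eq: "partial_deriv i (\<lambda>x. inverse (h x)) =
      (\<lambda>x. (- 1) * (partial_deriv i h x * (inverse (h x) * inverse (h x))))"
    using Cons.prems ne by (simp add: partial_deriv_inverse)
  have "jet_bound x L (\<lambda>x. (- 1) * (partial_deriv i h x * (inverse (h x) * inverse (h x))))
     (\<bar>- 1\<bar> * (h x * S * (inverse (h x) * inverse (h x)))) (S + (c * S + c * S))"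
    using Cons.prems IH assms(3) c by (intro jet_bound_cmult jet_bound_mult) auto
  moreover have "\<bar>- 1\<bar> * (h x * S * (inverse (h x) * inverse (h x))) = inverse (h x) * S"
    using ne[of x] by (simp add: field_simps)
  ultimately have "jet_bound x L (partial_deriv i (\<lambda>x. inverse (h x)))
     (inverse (h x) * S) (S + (c * S + c * S))"
    by (simp only: eq)
  note jb = this
  have "S + (c * S + c * S) \<le> 3 * (c * S)"
    using mult_right_mono[OF c(2) assms(3)] by linarith
  then have "jet_bound x L (partial_deriv i (\<lambda>x. inverse (h x))) (inverse (h x) * S) (3 * (c * S))"
    by (rule jet_bound_mono[OF jb order.refl, rotated]) (use assms(3) c in auto)
  then have "jet_bound x L (partial_deriv i (\<lambda>x. inverse (h x))) (inverse (h x) * S * 3 ^ length L) (c * S)"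
    using assms(3) c by (intro jet_bound_rescale) auto
  note jb' = this
  have "inverse (h x) * S * 3 ^ length L \<le> inverse (h x) * S * c"
    using assms(2)[of x] assms(3) c(1) by (intro mult_left_mono) auto
  then have "inverse (h x) * S * 3 ^ length L \<le> inverse (h x) * (c * S)"
    by (simp only: mult_ac)
  then have "jet_bound x L (partial_deriv i (\<lambda>x. inverse (h x))) (inverse (h x) * (c * S)) (c * S)"
    by (rule jet_bound_mono[OF jb']) (use assms(3) c in auto)
  then show ?case using IH Cons.prems ne by (auto simp: partial_deriv_inverse)
qed

text \<open>
  Only the derivatives of positive order are bounded, as in the definition of \<open>M\<^sub>k\<close>: the values of a
  log-likelihood are unrestricted.
\<close>

fun deriv_bound :: "real ^ 'p::finite \<Rightarrow> 'p list \<Rightarrow> (real ^ 'p \<Rightarrow> real) \<Rightarrow> real \<Rightarrow> bool" where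
  "deriv_bound x [] h m \<longleftrightarrow> True"
| "deriv_bound x (i # L) h m \<longleftrightarrow> deriv_bound x L h m \<and> partially_differentiable i h \<and>
     jet_bound x L (partial_deriv i h) m 1"

lemma jet_bound_exp:
  assumes "deriv_bound x L h m" "1 \<le> m" "2 ^ length L * m \<le> c"
  shows "jet_bound x L (\<lambda>x. exp (h x)) (exp (h x)) c"
  using assms(1,3)
proof (induction L)
  case (Cons i L)
  have c: "2 ^ length L * m \<le> c" "1 \<le> c" 
    using Cons.prems(2) assms(2) one_le_power[of "2::real" "length L"] mult_mono[of 1 "2 ^ length L" 1 m]
    by auto
  have IH: "jet_bound x L (\<lambda>x. exp (h x)) (exp (h x)) c" using Cons c by auto
  have eq: "partial_deriv i (\<lambda>x. exp (h x)) = (\<lambda>x. exp (h x) * partial_deriv i h x)"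
    using Cons.prems by (simp add: partial_deriv_exp)
  have "jet_bound x L (\<lambda>x. exp (h x) * partial_deriv i h x) (exp (h x) * m) (c + 1)"
    using Cons.prems IH c by (intro jet_bound_mult) auto
  then have "jet_bound x L (\<lambda>x. exp (h x) * partial_deriv i h x) (exp (h x) * m) (2 * c)"
    by (rule jet_bound_mono) (use c in auto)
  then have "jet_bound x L (\<lambda>x. exp (h x) * partial_deriv i h x) (exp (h x) * m * 2 ^ length L) c"
    using c by (intro jet_bound_rescale) auto
  moreover have "exp (h x) * m * 2 ^ length L \<le> exp (h x) * c" using c by (simp add: mult_ac)
  ultimately have "jet_bound x L (partial_deriv i (\<lambda>x. exp (h x))) (exp (h x) * c) c"
    unfolding eq by (rule jet_bound_mono) (use c in auto)
  then show ?case using IH Cons.prems by (auto simp: partial_deriv_exp)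
qed auto

lemma jet_boundD:
  assumes "jet_bound x L h B S"
  shows "\<bar>partial_derivs (rev L) h x\<bar> \<le> B * S ^ length L" "partial_derivs_exist (rev L) h"
proof -
  have "\<bar>partial_derivs (rev L) h x\<bar> \<le> B * S ^ length L \<and> partial_derivs_exist (rev L) h"
    using assms
  proof (induction L arbitrary: h B)
    case (Cons i L)
    then have "\<bar>partial_derivs (rev L) (partial_deriv i h) x\<bar> \<le> (B * S) * S ^ length L \<and>
        partial_derivs_exist (rev L) (partial_deriv i h)"
      by auto
    with Cons.prems show ?case
      by (auto simp: partial_derivs_append partial_derivs_exist_append partially_differentiable_def mult.assoc)
  qed simp
  then show "\<bar>partial_derivs (rev L) h x\<bar> \<le> B * S ^ length L" "partial_derivs_exist (rev L) h" by auto
qed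

lemma jet_boundI:
  assumes "\<And>L'. subseq L' L \<Longrightarrow> partial_derivs_exist (rev L') h"
    and "\<And>L'. subseq L' L \<Longrightarrow> \<bar>partial_derivs (rev L') h x\<bar> \<le> B * S ^ length L'"
  shows "jet_bound x L h B S"
  using assms
proof (induction L arbitrary: h B)
  case Nil
  from Nil(2)[of "[]"] show ?case by simp
next
  case (Cons i L)
  have "jet_bound x L h B S" by (rule Cons.IH; rule Cons.prems; rule list_emb_Cons)
  moreover have "partially_differentiable i h"
    using Cons.prems(1)[of "[i]"] by (simp add: subseq_singleton_left partially_differentiable_def)
  moreover have "jet_bound x L (partial_deriv i h) (B * S) S"
  proof (rule Cons.IH)
    fix L' assume L': "subseq L' L"
    then show "partial_derivs_exist (rev L') (partial_deriv i h)"
      using Cons.prems(1)[of "i # L'"] by (simp add: partial_derivs_exist_append)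
    show "\<bar>partial_derivs (rev L') (partial_deriv i h) x\<bar> \<le> B * S * S ^ length L'"
      using L' Cons.prems(2)[of "i # L'"] by (simp add: partial_derivs_append mult_ac)
  qed
  ultimately show ?case by simp
qed

lemma deriv_boundI:
  assumes "\<And>L'. subseq L' L \<Longrightarrow> partial_derivs_exist (rev L') h"
    and "\<And>L'. subseq L' L \<Longrightarrow> L' \<noteq> [] \<Longrightarrow> \<bar>partial_derivs (rev L') h x\<bar> \<le> m"
  shows "deriv_bound x L h m"
  using assms
proof (induction L)
  case (Cons i L)
  have "deriv_bound x L h m" by (rule Cons.IH; (rule Cons.prems)?; (rule list_emb_Cons)?)
  moreover have "partially_differentiable i h"
    using Cons.prems(1)[of "[i]"] by (simp add: subseq_singleton_left partially_differentiable_def)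
  moreover have "jet_bound x L (partial_deriv i h) m 1"
  proof (rule jet_boundI)
    fix L' assume L': "subseq L' L"
    then show "partial_derivs_exist (rev L') (partial_deriv i h)"
      using Cons.prems(1)[of "i # L'"] by (simp add: partial_derivs_exist_append)
    show "\<bar>partial_derivs (rev L') (partial_deriv i h) x\<bar> \<le> m * 1 ^ length L'"
      using L' Cons.prems(2)[of "i # L'"] by (simp add: partial_derivs_append mult_ac)
  qed
  ultimately show ?case by simp
qed simp

lemma partial_derivs_diff:
  assumes "partial_derivs_exist L h" "partial_derivs_exist L k"
  shows "partial_derivs L (\<lambda>x. h x - k x) = (\<lambda>x. partial_derivs L h x - partial_derivs L k x)"
  using assms
proof (induction L)
  case (Cons i L)
  have d: "partially_differentiable i (partial_derivs L h)" "partially_differentiable i (partial_derivs L k)"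
    using Cons.prems by (auto simp: partially_differentiable_def)
  have "partial_deriv i (\<lambda>x. partial_derivs L h x - partial_derivs L k x) =
        (\<lambda>x. partial_deriv i (partial_derivs L h) x - partial_deriv i (partial_derivs L k) x)"
    by (rule partially_differentiableI(2), rule DERIV_diff; rule partially_differentiableD, fact d)
  then show ?case using Cons by simp
qed simp

section \<open>Weighted paths and forgetting of the initial state\<close>

text \<open>
  The sum over all paths of \<open>N\<close> steps that start at time \<open>i\<close> in state \<open>a\<close> of the transition weights \<open>K\<close>, the
  factors \<open>g\<close> of all the states visited after time \<open>i\<close>, and the terminal factor \<open>h\<close>. The kernel \<open>K i\<close> leads from
  time \<open>i\<close> to time \<open>i + 1\<close>.
\<close>

fun path_sum :: "(nat \<Rightarrow> 'h::finite \<Rightarrow> 'h \<Rightarrow> real) \<Rightarrow> (nat \<Rightarrow> 'h \<Rightarrow> 'e \<Rightarrow> real) \<Rightarrow> ('h \<Rightarrow> 'e \<Rightarrow> real)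
    \<Rightarrow> nat \<Rightarrow> nat \<Rightarrow> 'h \<Rightarrow> 'e \<Rightarrow> real" where
  "path_sum K g h i 0 a x = h a x"
| "path_sum K g h i (Suc N) a x = (\<Sum>b\<in>UNIV. K i a b * (g (Suc i) b x * path_sum K g h (Suc i) N b x))"

definition transit :: "(nat \<Rightarrow> 'h::finite \<Rightarrow> 'h \<Rightarrow> real) \<Rightarrow> (nat \<Rightarrow> 'h \<Rightarrow> 'e \<Rightarrow> real)
    \<Rightarrow> nat \<Rightarrow> nat \<Rightarrow> 'h \<Rightarrow> 'h \<Rightarrow> 'e \<Rightarrow> real" where
  "transit K g i N a c x = path_sum K g (\<lambda>b _. of_bool (b = c)) i N a x"

definition mass :: "(nat \<Rightarrow> 'h::finite \<Rightarrow> 'h \<Rightarrow> real) \<Rightarrow> (nat \<Rightarrow> 'h \<Rightarrow> 'e \<Rightarrow> real)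
    \<Rightarrow> nat \<Rightarrow> nat \<Rightarrow> 'h \<Rightarrow> 'e \<Rightarrow> real" where
  "mass K g i N a x = path_sum K g (\<lambda>_ _. 1) i N a x"

lemma path_sum_add: "path_sum K g h i (N + N') a x = path_sum K g (path_sum K g h (i + N) N') i N a x"
proof (induction N arbitrary: i a)
  case (Suc N)
  show ?case unfolding add_Suc path_sum.simps(2) by (subst Suc.IH) simp
qed simp

lemma transit_simps:
  "transit K g i 0 a c x = of_bool (a = c)"
  "transit K g i (Suc N) a c x = (\<Sum>b\<in>UNIV. K i a b * (g (Suc i) b x * transit K g (Suc i) N b c x))"
  by (simp_all add: transit_def)

lemma path_sum_terminal: "path_sum K g h i N a x = (\<Sum>c\<in>UNIV. transit K g i N a c x * h c x)"
proof (induction N arbitrary: i a)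
  case 0
  have "(\<Sum>c\<in>UNIV. of_bool (a = c) * h c x) = (\<Sum>c\<in>UNIV. if c = a then h c x else 0)"
    by (rule sum.cong) auto
  then show ?case by (simp add: transit_simps)
next
  case (Suc N)
  have "K i a b * (g (Suc i) b x * path_sum K g h (Suc i) N b x) =
      (\<Sum>c\<in>UNIV. K i a b * (g (Suc i) b x * transit K g (Suc i) N b c x) * h c x)" for b
    unfolding Suc.IH[of "Suc i" b] sum_distrib_left mult.assoc ..
  then have "path_sum K g h i (Suc N) a x =
      (\<Sum>b\<in>UNIV. \<Sum>c\<in>UNIV. K i a b * (g (Suc i) b x * transit K g (Suc i) N b c x) * h c x)"
    by simp
  also have "\<dots> = (\<Sum>c\<in>UNIV. \<Sum>b\<in>UNIV. K i a b * (g (Suc i) b x * transit K g (Suc i) N b c x) * h c x)"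
    by (rule sum.swap)
  finally show ?case unfolding transit_simps sum_distrib_right .
qed

lemma mass_add: "mass K g i (N + N') a x = (\<Sum>c\<in>UNIV. transit K g i N a c x * mass K g (i + N) N' c x)"
proof -
  have "mass K g i (N + N') a x = path_sum K g (path_sum K g (\<lambda>_ _. 1) (i + N) N') i N a x"
    unfolding mass_def by (rule path_sum_add)
  also have "\<dots> = (\<Sum>c\<in>UNIV. transit K g i N a c x * path_sum K g (\<lambda>_ _. 1) (i + N) N' c x)"
    by (rule path_sum_terminal)
  finally show ?thesis by (subst (2) mass_def)
qed

text \<open>
  Likelihoods are positive but not bounded, so mixing is assumed of the kernels alone, that is, for the factors \<open>1\<close>.
\<close>

locale weighted_chain =
  fixes K :: "nat \<Rightarrow> 'h::finite \<Rightarrow> 'h \<Rightarrow> real" and g :: "nat \<Rightarrow> 'h \<Rightarrow> real ^ 'p::finite \<Rightarrow> real"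
    and \<kappa> :: nat and \<phi> :: real
  assumes K_nonneg: "K i a b \<ge> 0"
    and K_sum: "(\<Sum>b\<in>UNIV. K i a b) = 1"
    and g_pos: "g i a x > 0"
    and \<phi>_pos: "\<phi> > 0"
    and \<kappa>_pos: "\<kappa> \<ge> 1"
    and mixing: "transit K (\<lambda>_ _ _. 1) i \<kappa> a b (x :: real ^ 'p) \<ge> \<phi>"
begin

lemma path_sum_nonneg: "(\<And>c. h c x \<ge> 0) \<Longrightarrow> path_sum K g h i N a x \<ge> 0"
proof (induction N arbitrary: i a)
  case (Suc N)
  show ?case unfolding path_sum.simps
    by (intro sum_nonneg mult_nonneg_nonneg K_nonneg less_imp_le[OF g_pos] Suc.IH Suc.prems)
qed simp

lemma mass_pos: "mass K g i N a x > 0"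
proof (induction N arbitrary: i a)
  case (Suc N)
  have "\<exists>b. K i a b \<noteq> 0"
  proof (rule ccontr)
    assume "\<not> ?thesis"
    then show False using K_sum[of i a] by simp
  qed
  then obtain b where b: "K i a b \<noteq> 0" ..
  have "0 < K i a b * (g (Suc i) b x * mass K g (Suc i) N b x)"
    using b K_nonneg[of i a b] g_pos Suc by simp
  also have "\<dots> \<le> (\<Sum>b\<in>UNIV. K i a b * (g (Suc i) b x * mass K g (Suc i) N b x))"
    by (rule member_le_sum)
      (simp_all add: K_nonneg less_imp_le[OF g_pos] less_imp_le[OF Suc])
  finally show ?case by (simp add: mass_def)
qed (simp add: mass_def)

lemma transit_nonneg: "transit K g i N a c x \<ge> 0"
  unfolding transit_def by (rule path_sum_nonneg) simp

lemma transit_one_le: "transit K (\<lambda>_ _ _. 1) i N a b x \<le> 1"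
proof (induction N arbitrary: i a)
  case (Suc N)
  have "transit K (\<lambda>_ _ _. 1) i (Suc N) a b x = (\<Sum>c\<in>UNIV. K i a c * transit K (\<lambda>_ _ _. 1) (Suc i) N c b x)"
    by (simp add: transit_def)
  also have "\<dots> \<le> (\<Sum>c\<in>UNIV. K i a c * 1)"
    by (intro sum_mono mult_left_mono Suc K_nonneg)
  finally show ?case by (simp add: K_sum)
qed (simp add: transit_def)

lemma \<phi>_le: "\<phi> \<le> 1"
  by (rule order_trans[OF mixing[of 0 undefined undefined undefined] transit_one_le])

lemma transit_one_nonneg: "transit K (\<lambda>_ _ _. 1) i N a b x \<ge> 0"
proof (induction N arbitrary: i a)
  case (Suc N)
  then show ?case unfolding transit_def path_sum.simps
    by (intro sum_nonneg mult_nonneg_nonneg K_nonneg) auto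
qed (simp add: transit_def)

lemma transit_bounds:
  assumes "\<And>j c. j \<in> {i<..i + N} \<Longrightarrow> 1 / C \<le> g j c x \<and> g j c x \<le> C" "C \<ge> 1"
  shows "(1 / C) ^ N * transit K (\<lambda>_ _ _. 1) i N a b x \<le> transit K g i N a b x"
    and "transit K g i N a b x \<le> C ^ N * transit K (\<lambda>_ _ _. 1) i N a b x"
proof -
  have "(1 / C) ^ N * transit K (\<lambda>_ _ _. 1) i N a b x \<le> transit K g i N a b x \<and>
    transit K g i N a b x \<le> C ^ N * transit K (\<lambda>_ _ _. 1) i N a b x"
    using assms
  proof (induction N arbitrary: i a)
    case (Suc N)
    let ?u = "\<lambda>c. transit K (\<lambda>_ _ _. 1) (Suc i) N c b x" and ?t = "\<lambda>c. transit K g (Suc i) N c b x"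
    have IH: "(1 / C) ^ N * ?u c \<le> ?t c" "?t c \<le> C ^ N * ?u c" for c
      using Suc.prems by (auto intro!: Suc.IH[THEN conjunct1] Suc.IH[THEN conjunct2])
    have g: "1 / C \<le> g (Suc i) c x" "g (Suc i) c x \<le> C" for c
      using Suc.prems by auto
    have u: "?u c \<ge> 0" for c by (rule transit_one_nonneg)
    have lo: "1 / C * ((1 / C) ^ N * ?u c) \<le> g (Suc i) c x * ?t c" for c
      using g IH u[of c] Suc.prems(2) g_pos[of "Suc i" c x]
      by (intro mult_mono) (auto intro!: mult_nonneg_nonneg)
    have hi: "g (Suc i) c x * ?t c \<le> C * (C ^ N * ?u c)" for c
      using g IH u[of c] Suc.prems(2) g_pos[of "Suc i" c x] transit_nonneg
      by (intro mult_mono) (auto intro!: mult_nonneg_nonneg)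
    have "(\<Sum>c\<in>UNIV. K i a c * (1 / C * ((1 / C) ^ N * ?u c))) \<le> (\<Sum>c\<in>UNIV. K i a c * (g (Suc i) c x * ?t c))"
      by (intro sum_mono mult_left_mono lo K_nonneg)
    moreover have "(\<Sum>c\<in>UNIV. K i a c * (g (Suc i) c x * ?t c)) \<le> (\<Sum>c\<in>UNIV. K i a c * (C * (C ^ N * ?u c)))"
      by (intro sum_mono mult_left_mono hi K_nonneg)
    ultimately show ?case
      by (simp add: transit_def sum_distrib_left mult_ac)
  qed (simp add: transit_def)
  then show "(1 / C) ^ N * transit K (\<lambda>_ _ _. 1) i N a b x \<le> transit K g i N a b x"
    and "transit K g i N a b x \<le> C ^ N * transit K (\<lambda>_ _ _. 1) i N a b x" by auto
qed

lemma block_bounds: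
  assumes "\<And>j c. j \<in> {i<..i + \<kappa>} \<Longrightarrow> 1 / C \<le> g j c x \<and> g j c x \<le> C" "C \<ge> 1"
  shows "\<phi> / C ^ \<kappa> \<le> transit K g i \<kappa> a b x" and "transit K g i \<kappa> a b x \<le> C ^ \<kappa>"
proof -
  have "\<phi> / C ^ \<kappa> \<le> (1 / C) ^ \<kappa> * transit K (\<lambda>_ _ _. 1) i \<kappa> a b x"
    using mult_left_mono[OF mixing[of i a b x], of "(1 / C) ^ \<kappa>"] assms(2) by (simp add: power_one_over)
  then show "\<phi> / C ^ \<kappa> \<le> transit K g i \<kappa> a b x" using transit_bounds(1)[OF assms] by (meson order_trans)
  have "C ^ \<kappa> * transit K (\<lambda>_ _ _. 1) i \<kappa> a b x \<le> C ^ \<kappa> * 1"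
    using assms(2) by (intro mult_left_mono transit_one_le) auto
  with transit_bounds(2)[where i = i and N = \<kappa> and x = x and C = C and a = a and b = b, OF assms]
  show "transit K g i \<kappa> a b x \<le> C ^ \<kappa>" by simp
qed

text \<open>
  The numerator of the increment of the normalized mass in one step, and the sum of its two terms, which will
  dominate it.
\<close>

definition cross_diff :: "nat \<Rightarrow> nat \<Rightarrow> 'h \<Rightarrow> 'h \<Rightarrow> real ^ 'p \<Rightarrow> real" where
  "cross_diff i N a b x = mass K g i (Suc N) a x * mass K g i N b x - mass K g i (Suc N) b x * mass K g i N a x"

definition cross_sum :: "nat \<Rightarrow> nat \<Rightarrow> 'h \<Rightarrow> 'h \<Rightarrow> real ^ 'p \<Rightarrow> real" where
  "cross_sum i N a b x = mass K g i (Suc N) a x * mass K g i N b x + mass K g i (Suc N) b x * mass K g i N a x"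

lemma pair_expand:
  "mass K g i (\<kappa>' + N) a x * mass K g i (\<kappa>' + N') b x =
     (\<Sum>c\<in>UNIV. \<Sum>d\<in>UNIV. transit K g i \<kappa>' a c x * transit K g i \<kappa>' b d x *
        (mass K g (i + \<kappa>') N c x * mass K g (i + \<kappa>') N' d x))"
  unfolding mass_add sum_product by (simp add: mult_ac)

lemma cross_diff_step:
  "cross_diff i (n + N) a b x =
     (\<Sum>c\<in>UNIV. \<Sum>d\<in>UNIV. transit K g i n a c x * transit K g i n b d x * cross_diff (i + n) N c d x)"
proof -
  have "mass K g i (n + Suc N) b x * mass K g i (n + N) a x =
     (\<Sum>c\<in>UNIV. \<Sum>d\<in>UNIV. transit K g i n a c x * transit K g i n b d x *
        (mass K g (i + n) (Suc N) d x * mass K g (i + n) N c x))"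
    using pair_expand[of i n N a x "Suc N" b] by (simp add: mult_ac)
  then show ?thesis
    using pair_expand[of i n "Suc N" a x N b]
    by (simp add: cross_diff_def sum_subtractf right_diff_distrib)
qed

lemma cross_sum_step:
  "cross_sum i (n + N) a b x =
     (\<Sum>c\<in>UNIV. \<Sum>d\<in>UNIV. transit K g i n a c x * transit K g i n b d x * cross_sum (i + n) N c d x)"
proof -
  have "mass K g i (n + Suc N) b x * mass K g i (n + N) a x =
     (\<Sum>c\<in>UNIV. \<Sum>d\<in>UNIV. transit K g i n a c x * transit K g i n b d x *
        (mass K g (i + n) (Suc N) d x * mass K g (i + n) N c x))"
    using pair_expand[of i n N a x "Suc N" b] by (simp add: mult_ac)
  then show ?thesis
    using pair_expand[of i n "Suc N" a x N b]
    by (simp add: cross_sum_def sum.distrib distrib_left)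
qed

lemma cross_diff_antisym_sum: "(\<Sum>c\<in>UNIV. \<Sum>d\<in>UNIV. cross_diff i N c d x) = 0"
proof -
  have "(\<Sum>c\<in>UNIV. \<Sum>d\<in>UNIV. cross_diff i N c d x) = (\<Sum>c\<in>UNIV. \<Sum>d\<in>UNIV. cross_diff i N d c x)"
    by (rule sum.swap)
  also have "\<dots> = - (\<Sum>c\<in>UNIV. \<Sum>d\<in>UNIV. cross_diff i N c d x)"
    by (simp add: cross_diff_def sum_negf[symmetric])
  finally show ?thesis by simp
qed

text \<open>
  Against an antisymmetric function a constant integrates to zero, so it may be subtracted from the pair weights.
\<close>

lemma cross_diff_step_reduced:
  "cross_diff i (n + N) a b x =
     (\<Sum>c\<in>UNIV. \<Sum>d\<in>UNIV. (transit K g i n a c x * transit K g i n b d x - y) * cross_diff (i + n) N c d x)"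
  unfolding cross_diff_step left_diff_distrib sum_subtractf sum_distrib_left[symmetric]
  by (simp add: cross_diff_antisym_sum)

text \<open>
  Every path weight is a product of likelihoods, so its jet bound has the weight itself as first component and
  the sum of the \<open>s j\<close> along the path as second component; the latter does not depend on the path.
\<close>

lemma jet_bound_path_sum:
  assumes g: "\<And>j c. jet_bound x L (g j c) (g j c x) (s j)" and s: "\<And>j. s j \<ge> 0"
    and h: "\<And>c. jet_bound x L (h c) (h c x) 0"
  shows "jet_bound x L (path_sum K g h i N a) (path_sum K g h i N a x) (\<Sum>j\<in>{i<..i + N}. s j)"
proof (induction N arbitrary: i a)
  case 0
  have "path_sum K g h i 0 a = h a" by (simp add: fun_eq_iff)
  then show ?case using h by simp
next
  case (Suc N)
  have eq: "path_sum K g h i (Suc N) a =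
      (\<lambda>x. \<Sum>b\<in>UNIV. K i a b * (g (Suc i) b x * path_sum K g h (Suc i) N b x))" by (simp add: fun_eq_iff)
  have "{i<..i + Suc N} = insert (Suc i) {Suc i<..Suc i + N}" by auto
  then have S: "(\<Sum>j\<in>{i<..i + Suc N}. s j) = s (Suc i) + (\<Sum>j\<in>{Suc i<..Suc i + N}. s j)"
    by simp
  have "jet_bound x L (\<lambda>x. \<Sum>b\<in>UNIV. K i a b * (g (Suc i) b x * path_sum K g h (Suc i) N b x))
     (\<Sum>b\<in>UNIV. \<bar>K i a b\<bar> * (g (Suc i) b x * path_sum K g h (Suc i) N b x))
     (s (Suc i) + (\<Sum>j\<in>{Suc i<..Suc i + N}. s j))"
    by (intro jet_bound_sum jet_bound_cmult jet_bound_mult g Suc.IH s add_nonneg_nonneg sum_nonneg)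
  then show ?case using K_nonneg unfolding S eq by simp
qed

lemma jet_bound_mass:
  assumes "\<And>j c. jet_bound x L (g j c) (g j c x) (s j)" "\<And>j. s j \<ge> 0"
  shows "jet_bound x L (mass K g i N a) (mass K g i N a x) (\<Sum>j\<in>{i<..i + N}. s j)"
proof -
  have "mass K g i N a = path_sum K g (\<lambda>_ _. 1) i N a" by (simp add: fun_eq_iff mass_def)
  then show ?thesis using jet_bound_path_sum[OF assms, of "\<lambda>_ _. 1"] by (simp add: jet_bound_const)
qed

lemma jet_bound_transit:
  assumes "\<And>j c. jet_bound x L (g j c) (g j c x) (s j)" "\<And>j. s j \<ge> 0"
  shows "jet_bound x L (transit K g i N a b) (transit K g i N a b x) (\<Sum>j\<in>{i<..i + N}. s j)"
proof -
  have "transit K g i N a b = path_sum K g (\<lambda>c _. of_bool (c = b)) i N a" by (simp add: fun_eq_iff transit_def)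
  then show ?thesis using jet_bound_path_sum[OF assms, of "\<lambda>c _. of_bool (c = b)"] by (simp add: jet_bound_const)
qed

text \<open>
  In a block with likelihoods in \<open>[1/C, C]\<close> all pair weights lie between \<open>\<phi>\<^sup>2/C\<^sup>2\<^sup>\<kappa>\<close> and \<open>C\<^sup>2\<^sup>\<kappa>\<close>. The constant subtracted is half
  the lower bound: it is at most half of every pair weight and at least the fraction \<open>1 - \<lambda>\<close> of it. For the
  derivatives the subtraction may double the bound, which \<open>jet_bound_sharpen\<close> moves to the second component.
\<close>

lemma jet_bound_pair_reduced:
  assumes g: "\<And>j c. jet_bound x L (g j c) (g j c x) (s j)" and s: "\<And>j. s j \<ge> 0"
    and C: "C \<ge> 1" and lam: "lam = 1 - \<phi>\<^sup>2 / (2 * C ^ (4 * \<kappa>))"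
    and good: "\<And>j c. j \<in> {i<..i + \<kappa>} \<Longrightarrow> 1 / C \<le> g j c x \<and> g j c x \<le> C"
  shows "jet_bound x L (\<lambda>x. transit K g i \<kappa> a c x * transit K g i \<kappa> b d x - \<phi>\<^sup>2 / (2 * C ^ (2 * \<kappa>)))
     (lam * (transit K g i \<kappa> a c x * transit K g i \<kappa> b d x)) (8 * (\<Sum>j\<in>{i<..i + \<kappa>}. s j))"
proof -
  define S where "S = (\<Sum>j\<in>{i<..i + \<kappa>}. s j)"
  have S: "S \<ge> 0" unfolding S_def by (intro sum_nonneg s)
  define T where "T = transit K g i \<kappa> a c x * transit K g i \<kappa> b d x"
  define y where "y = \<phi>\<^sup>2 / (2 * C ^ (2 * \<kappa>))"
  have c1: "C ^ \<kappa> \<ge> 1" using C by simp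
  have c2: "C ^ (2 * \<kappa>) = C ^ \<kappa> * C ^ \<kappa>" by (simp only: mult_2 power_add)
  have "4 * \<kappa> = 2 * \<kappa> + 2 * \<kappa>" by simp
  then have c4: "C ^ (4 * \<kappa>) = C ^ (2 * \<kappa>) * C ^ (2 * \<kappa>)" by (simp only: power_add)
  have "\<phi> / C ^ \<kappa> * (\<phi> / C ^ \<kappa>) \<le> T" unfolding T_def
    using block_bounds(1)[OF good C] \<phi>_pos c1 transit_nonneg by (intro mult_mono) auto
  then have T1: "2 * y \<le> T" by (simp add: y_def power2_eq_square c2)
  have "T \<le> C ^ \<kappa> * C ^ \<kappa>" unfolding T_def
    using block_bounds(2)[OF good C] c1 transit_nonneg by (intro mult_mono) auto
  then have T2: "T \<le> C ^ (2 * \<kappa>)" by (simp only: c2)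
  have y0: "y > 0" using \<phi>_pos C by (simp add: y_def)
  have "(1 - lam) * T \<le> (1 - lam) * C ^ (2 * \<kappa>)"
    using T2 lam \<phi>_pos C by (intro mult_left_mono) auto
  also have "\<dots> = y"
    using C by (simp add: lam y_def c4)
  finally have yT: "(1 - lam) * T \<le> y" .
  have "\<phi>\<^sup>2 \<le> 1" using \<phi>_le \<phi>_pos by (simp add: power_le_one)
  moreover have "C ^ (4 * \<kappa>) \<ge> 1" using C by simp
  ultimately have "\<phi>\<^sup>2 / (2 * C ^ (4 * \<kappa>)) \<le> 1 / 2" by (simp add: field_simps)
  then have lam2: "lam \<ge> 1 / 2" unfolding lam by simp
  have "jet_bound x L (\<lambda>x. transit K g i \<kappa> a c x * transit K g i \<kappa> b d x - y) (T + y) (S + S)"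
    unfolding T_def using S y0 s
    by (intro jet_bound_diff jet_bound_mult jet_bound_const)
      (auto simp: S_def intro!: jet_bound_transit g s)
  then have "jet_bound x L (\<lambda>x. transit K g i \<kappa> a c x * transit K g i \<kappa> b d x - y) (lam * T) (4 * (S + S))"
  proof (rule jet_bound_sharpen)
    show "\<bar>transit K g i \<kappa> a c x * transit K g i \<kappa> b d x - y\<bar> \<le> lam * T"
      using yT T1 y0 by (simp add: T_def algebra_simps)
    show "T + y \<le> 4 * (lam * T)"
      using mult_right_mono[OF lam2, of T] T1 y0 by linarith
  qed (use S in auto)
  then show ?thesis by (simp add: S_def T_def y_def)
qed

text \<open>
  Blocks of length \<open>\<kappa>\<close> are peeled off from the left. A block without bad times contributes the factor \<open>lam\<close>. A
  block with bad times contributes the factor 1, which is at most \<open>lam\<close> times one factor \<open>1/lam\<close> for each of its bad times. So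
  only the number of bad times matters and not how they are distributed over the blocks.
\<close>

lemma jet_bound_cross_diff:
  assumes g: "\<And>j c. jet_bound x L (g j c) (g j c x) (s j)" and s: "\<And>j. s j \<ge> 0"
    and C: "C \<ge> 1" and lam: "lam = 1 - \<phi>\<^sup>2 / (2 * C ^ (4 * \<kappa>))"
    and good: "\<And>j c. j \<notin> Bad \<Longrightarrow> 1 / C \<le> g j c x \<and> g j c x \<le> C"
  shows "jet_bound x L (cross_diff i (m * \<kappa> + N) a b)
     (lam ^ m * (1 / lam) ^ card (Bad \<inter> {i<..i + m * \<kappa>}) * cross_sum i (m * \<kappa> + N) a b x)
     (8 * (\<Sum>j\<in>{i<..i + m * \<kappa> + Suc N}. s j))"
proof (induction m arbitrary: i a b)
  case 0
  define S where "S = (\<Sum>j\<in>{i<..i + Suc N}. s j)"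
  have S: "S \<ge> 0" unfolding S_def by (intro sum_nonneg s)
  have NS: "(\<Sum>j\<in>{i<..i + N}. s j) \<le> S" unfolding S_def using s by (intro sum_mono2) auto
  have "jet_bound x L (mass K g i N a) (mass K g i N a x) S" for a
    by (rule jet_bound_mono[OF jet_bound_mass[OF g s] order.refl _ NS]) (intro sum_nonneg s)
  moreover have "jet_bound x L (mass K g i (Suc N) a) (mass K g i (Suc N) a x) S" for a
    unfolding S_def by (rule jet_bound_mass[OF g s])
  ultimately have "jet_bound x L (cross_diff i N a b) (cross_sum i N a b x) (S + S)"
    unfolding cross_diff_def[abs_def] cross_sum_def using S
    by (intro jet_bound_diff jet_bound_mult) auto
  then have "jet_bound x L (cross_diff i N a b) (cross_sum i N a b x) (8 * S)"
    by (rule jet_bound_mono) (use S in auto)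
  then show ?case by (simp add: S_def)
next
  case (Suc m)
  let ?N = "m * \<kappa> + N" and ?i = "i + \<kappa>"
  define S where "S = (\<Sum>j\<in>{i<..i + \<kappa>}. s j)"
  define S' where "S' = (\<Sum>j\<in>{?i<..?i + m * \<kappa> + Suc N}. s j)"
  have S: "S \<ge> 0" unfolding S_def by (intro sum_nonneg s)
  have S': "S' \<ge> 0" unfolding S'_def by (intro sum_nonneg s)
  define B where "B = Bad \<inter> {i<..i + \<kappa>}"
  define B' where "B' = Bad \<inter> {?i<..?i + m * \<kappa>}"
  have lam1: "lam \<le> 1" using C \<phi>_pos unfolding lam by simp
  have "\<phi>\<^sup>2 \<le> 1" using \<phi>_le \<phi>_pos by (simp add: power_le_one)
  moreover have "C ^ (4 * \<kappa>) \<ge> 1" using C by simp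
  ultimately have lam2: "lam > 0" unfolding lam by (simp add: field_simps)
  have "Bad \<inter> {i<..i + Suc m * \<kappa>} = B \<union> B'" unfolding B_def B'_def by auto
  moreover have "B \<inter> B' = {}" unfolding B_def B'_def by auto
  ultimately have card: "card (Bad \<inter> {i<..i + Suc m * \<kappa>}) = card B + card B'"
    unfolding B_def B'_def by (simp add: card_Un_disjoint)
  have "{i<..i + Suc m * \<kappa> + Suc N} = {i<..i + \<kappa>} \<union> {?i<..?i + m * \<kappa> + Suc N}"
    by auto
  then have sum: "(\<Sum>j\<in>{i<..i + Suc m * \<kappa> + Suc N}. s j) = S + S'"
    unfolding S_def S'_def by (subst sum.union_disjoint[symmetric]) auto
  let ?T = "\<lambda>c d x. transit K g i \<kappa> a c x * transit K g i \<kappa> b d x"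
  have T0: "?T c d x \<ge> 0" for c d by (intro mult_nonneg_nonneg transit_nonneg)
  obtain y where y: "\<And>c d. jet_bound x L (\<lambda>x. ?T c d x - y) (lam * (1 / lam) ^ card B * ?T c d x) (8 * S)"
  proof (cases "B = {}")
    case True
    have good': "1 / C \<le> g j c x \<and> g j c x \<le> C" if "j \<in> {i<..i + \<kappa>}" for j c
      by (rule good) (use True that in \<open>auto simp: B_def\<close>)
    have "jet_bound x L (\<lambda>x. ?T c d x - \<phi>\<^sup>2 / (2 * C ^ (2 * \<kappa>))) (lam * (1 / lam) ^ card B * ?T c d x) (8 * S)" for c d
      using jet_bound_pair_reduced[OF g s C lam good', where a = a and c = c and b = b and d = d] by (simp add: S_def True)
    then show ?thesis by (rule that)
  next
    case False
    then have "card B > 0" by (auto simp: B_def card_gt_0_iff)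
    then obtain k where k: "card B = Suc k" by (cases "card B") auto
    have "1 \<le> (1 / lam) ^ k" using lam1 lam2 by (intro one_le_power) auto
    then have "1 \<le> lam * (1 / lam) ^ card B" using lam2 by (simp add: k)
    then have le: "?T c d x \<le> lam * (1 / lam) ^ card B * ?T c d x" for c d
      using mult_right_mono[of 1 _ "?T c d x"] T0 by simp
    have "jet_bound x L (\<lambda>x. ?T c d x - 0) (?T c d x) (S + S)" for c d
      unfolding diff_zero using S
      by (intro jet_bound_mult) (auto simp: S_def intro!: jet_bound_transit g s)
    then have "jet_bound x L (\<lambda>x. ?T c d x - 0) (lam * (1 / lam) ^ card B * ?T c d x) (8 * S)" for c d
      by (rule jet_bound_mono[OF _ le]) (use S in auto)
    then show ?thesis by (rule that)
  qed
  let ?E = "\<lambda>c d. lam ^ m * (1 / lam) ^ card B' * cross_sum ?i ?N c d x"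
  have IH: "jet_bound x L (cross_diff ?i ?N c d) (?E c d) (8 * S')" for c d
    unfolding S'_def B'_def by (rule Suc.IH)
  have "jet_bound x L (\<lambda>x. \<Sum>c\<in>UNIV. \<Sum>d\<in>UNIV. (?T c d x - y) * cross_diff ?i ?N c d x)
     (\<Sum>c\<in>UNIV. \<Sum>d\<in>UNIV. (lam * (1 / lam) ^ card B * ?T c d x) * ?E c d) (8 * S + 8 * S')"
    using S S' by (intro jet_bound_sum jet_bound_mult y IH) auto
  moreover have "(\<lambda>x. \<Sum>c\<in>UNIV. \<Sum>d\<in>UNIV. (?T c d x - y) * cross_diff ?i ?N c d x) = cross_diff i (\<kappa> + ?N) a b"
    by (simp add: fun_eq_iff cross_diff_step_reduced[where y = y])
  moreover have "(\<Sum>c\<in>UNIV. \<Sum>d\<in>UNIV. (lam * (1 / lam) ^ card B * ?T c d x) * ?E c d) =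
      lam ^ Suc m * (1 / lam) ^ (card B + card B') * cross_sum i (\<kappa> + ?N) a b x"
    unfolding cross_sum_step sum_distrib_left by (simp add: power_add mult_ac)
  ultimately show ?case unfolding card sum by (simp add: add.assoc)
qed

end

section \<open>Geometric convergence of normalized masses\<close>

context weighted_chain
begin

definition nmass :: "'h \<Rightarrow> nat \<Rightarrow> 'h \<Rightarrow> real ^ 'p \<Rightarrow> real" where
  "nmass a0 N a x = mass K g 0 N a x * inverse (mass K g 0 N a0 x)"

lemma nmass_pos: "nmass a0 N a x > 0"
  unfolding nmass_def using mass_pos[of 0 N a x] mass_pos[of 0 N a0 x] by simp

text \<open>
  The first \<open>\<kappa>\<close> steps already make the masses from any two initial states comparable, and the remaining steps
  do not affect the comparison.
\<close>

lemma nmass_le: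
  assumes "\<And>j c. j \<in> {0<..\<kappa>} \<Longrightarrow> 1 / C \<le> g j c x \<and> g j c x \<le> C" "C \<ge> 1" "N \<ge> \<kappa>"
  shows "nmass a0 N a x \<le> C ^ \<kappa> * C ^ \<kappa> / \<phi>"
proof -
  have g: "1 / C \<le> g j c x \<and> g j c x \<le> C" if "j \<in> {0<..0 + \<kappa>}" for j c
    using assms(1) that by simp
  have C: "C ^ \<kappa> > 0" using assms(2) by simp
  have le: "transit K g 0 \<kappa> a c x \<le> C ^ \<kappa> * C ^ \<kappa> / \<phi> * transit K g 0 \<kappa> a0 c x" for c
  proof -
    have "transit K g 0 \<kappa> a c x \<le> C ^ \<kappa>" by (rule block_bounds(2)[OF g assms(2)])
    also have "C ^ \<kappa> = C ^ \<kappa> * C ^ \<kappa> / \<phi> * (\<phi> / C ^ \<kappa>)" using \<phi>_pos C by simp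
    also have "\<dots> \<le> C ^ \<kappa> * C ^ \<kappa> / \<phi> * transit K g 0 \<kappa> a0 c x"
      using block_bounds(1)[OF g assms(2)] \<phi>_pos C by (intro mult_left_mono) auto
    finally show ?thesis .
  qed
  obtain N' where N: "N = \<kappa> + N'" using assms(3) le_Suc_ex by blast
  have "mass K g 0 N a x \<le> C ^ \<kappa> * C ^ \<kappa> / \<phi> * mass K g 0 N a0 x"
    unfolding N mass_add sum_distrib_left mult.assoc[symmetric]
    by (intro sum_mono mult_right_mono le less_imp_le[OF mass_pos])
  then show ?thesis using mass_pos[of 0 N a0 x] by (simp add: nmass_def field_simps)
qed

lemma nmass_diff:
  "nmass a0 (Suc N) a x - nmass a0 N a x =
     cross_diff 0 N a a0 x * (inverse (mass K g 0 (Suc N) a0 x) * inverse (mass K g 0 N a0 x))"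
  using mass_pos[of 0 "Suc N" a0 x] mass_pos[of 0 N a0 x]
  by (simp add: nmass_def cross_diff_def field_simps)

lemma nmass_sum:
  "nmass a0 (Suc N) a x + nmass a0 N a x =
     cross_sum 0 N a a0 x * (inverse (mass K g 0 (Suc N) a0 x) * inverse (mass K g 0 N a0 x))"
  using mass_pos[of 0 "Suc N" a0 x] mass_pos[of 0 N a0 x]
  by (simp add: nmass_def cross_sum_def field_simps)

text \<open>
  With at most \<open>N/(2\<kappa>)\<close> bad times, the \<open>N div \<kappa>\<close> blocks leave a factor \<open>lam\<close> raised to a power of at least
  \<open>N/(2\<kappa>) - 1\<close>. The derivatives cost at most the \<open>q\<close>-th power of \<open>\<Sum>j\<le>N. s j\<close>, which is of order \<open>b\<^sup>q\<^sup>N\<close>. The hypothesis on \<open>r\<close> says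
  that the product of the two effects decays like \<open>r\<^sup>N\<close>; summing the increments gives the claim. All constants
  are uniform over \<open>X\<close>.
\<close>

lemma nmass_limit:
  assumes g: "\<And>x j c. x \<in> X \<Longrightarrow> jet_bound x L (g j c) (g j c x) (s j)"
    and s: "\<And>j. s j \<ge> 1" "\<And>j. s j \<le> A * b ^ j"
    and C: "C \<ge> 1" and lam: "lam = 1 - \<phi>\<^sup>2 / (2 * C ^ (4 * \<kappa>))"
    and good: "\<And>x j c. x \<in> X \<Longrightarrow> j \<notin> Bad \<Longrightarrow> 1 / C \<le> g j c x \<and> g j c x \<le> C"
    and bad: "\<And>N. N \<ge> n0 \<Longrightarrow> card (Bad \<inter> {0<..N}) * (2 * \<kappa>) \<le> N"
    and init: "C0 \<ge> 1" "\<And>x j c. x \<in> X \<Longrightarrow> j \<in> {0<..\<kappa>} \<Longrightarrow> 1 / C0 \<le> g j c x \<and> g j c x \<le> C0"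
    and L: "length L \<le> q"
    and b: "b > 1" and r: "b ^ q * lam powr (1 / (2 * \<kappa>)) \<le> r" "r < 1"
  shows "\<exists>D N0. \<exists>\<rho>>0. 0 < D \<and>
    (\<forall>x\<in>X. \<forall>a. \<forall>N\<ge>N0. \<rho> \<le> nmass a0 N a x \<and> jet_bound x L (nmass a0 N a) D 1 \<and>
       (\<forall>N'\<ge>N. jet_bound x L (\<lambda>x. nmass a0 N' a x - nmass a0 N a x) (D * r ^ N) 1))"
proof -
  have s0: "s j \<ge> 0" for j using s(1)[of j] by linarith
  have lam1: "lam \<le> 1" using C \<phi>_pos unfolding lam by simp
  have "\<phi>\<^sup>2 \<le> 1" using \<phi>_le \<phi>_pos by (simp add: power_le_one)
  moreover have "C ^ (4 * \<kappa>) \<ge> 1" using C by simp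
  ultimately have lam2: "lam > 0" unfolding lam by (simp add: field_simps)
  have A: "A \<ge> 1" using s(1)[of 0] s(2)[of 0] by simp
  have r0: "r > 0" using b lam2 r(1) by (smt (verit) mult_pos_pos powr_gt_zero zero_less_power)
  define R where "R = C0 ^ \<kappa> * C0 ^ \<kappa> / \<phi>"
  have "C0 ^ \<kappa> \<ge> 1" using init(1) by simp
  then have R: "R > 0" unfolding R_def using \<phi>_pos by simp
  have nle: "nmass a0 N a x \<le> R" if "x \<in> X" "N \<ge> \<kappa>" for N a a0 x
    unfolding R_def using init(2)[OF that(1)] init(1) that(2) by (rule nmass_le)
  define S where "S N = (\<Sum>j\<in>{0<..N}. s j)" for N
  have S0: "S N \<ge> 0" for N unfolding S_def by (intro sum_nonneg s0)
  have S_mono: "S N \<le> S (Suc N)" for N unfolding S_def by (intro sum_mono2) (auto simp: s0)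
  define c where "c = (3::real) ^ q"
  have c: "3 ^ length L \<le> c" "1 \<le> c" unfolding c_def using L by (auto intro: power_increasing)
  have jm: "jet_bound x L (mass K g 0 N a) (mass K g 0 N a x) (S N)" if "x \<in> X" for N a x
    using jet_bound_mass[OF g s0, OF that, of 0 N a] by (simp add: S_def)
  have ji: "jet_bound x L (\<lambda>x. inverse (mass K g 0 N a x)) (inverse (mass K g 0 N a x)) (c * S N)"
    if "x \<in> X" for N a x
    by (rule jet_bound_inverse[OF jm mass_pos S0 c(1)]) (rule that)
  define G where "G = A * b * b / (b - 1)"
  have "G \<ge> 0" unfolding G_def using A b by simp
  \<comment> \<open>8 comes from the cross difference and \<open>c\<close> from each of the two reciprocals; adding 1 makes \<open>W\<close> at least 1.\<close>
  define W where "W = (8 + 2 * c) * G + 1"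
  have W1: "W \<ge> 1" unfolding W_def using c \<open>G \<ge> 0\<close> by simp
  have SW: "(8 + 2 * c) * S (Suc N) \<le> W * b ^ N" for N
  proof -
    have "S (Suc N) \<le> (\<Sum>j\<in>{0<..Suc N}. A * b ^ j)" unfolding S_def by (intro sum_mono s)
    also have "\<dots> \<le> (\<Sum>j<Suc (Suc N). A * b ^ j)"
      using A b by (intro sum_mono2) auto
    also have "\<dots> = A * ((b ^ Suc (Suc N) - 1) / (b - 1))"
      unfolding sum_distrib_left[symmetric] using b by (subst geometric_sum) auto
    also have "\<dots> \<le> A * (b ^ Suc (Suc N) / (b - 1))"
      using A b by (intro mult_left_mono divide_right_mono) auto
    also have "\<dots> = G * b ^ N" by (simp add: G_def)
    finally have "(8 + 2 * c) * S (Suc N) \<le> (8 + 2 * c) * (G * b ^ N)"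
      using c by (intro mult_left_mono) auto
    also have "\<dots> \<le> W * b ^ N" unfolding W_def using b by (simp add: algebra_simps)
    finally show ?thesis .
  qed
  define D1 where "D1 = 2 * R / lam * W ^ q"
  have D1: "D1 > 0" unfolding D1_def using R lam2 W1 by simp
  define N0 where "N0 = max n0 \<kappa>"
  have step: "jet_bound x L (\<lambda>x. nmass a0 (Suc N) a x - nmass a0 N a x) (D1 * r ^ N) 1"
    if x: "x \<in> X" and N: "N \<ge> N0" for x N a
  proof -
    define m where "m = N div \<kappa>"
    define N' where "N' = N mod \<kappa>"
    have mN: "N = m * \<kappa> + N'" unfolding m_def N'_def by simp
    define F where "F = lam ^ m * (1 / lam) ^ card (Bad \<inter> {0<..0 + m * \<kappa>})"
    have F0: "F > 0" unfolding F_def using lam2 by simp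
    have "jet_bound x L (cross_diff 0 (m * \<kappa> + N') a a0)
       (lam ^ m * (1 / lam) ^ card (Bad \<inter> {0<..0 + m * \<kappa>}) * cross_sum 0 (m * \<kappa> + N') a a0 x)
       (8 * (\<Sum>j\<in>{0<..0 + m * \<kappa> + Suc N'}. s j))"
      by (rule jet_bound_cross_diff[OF g[OF x] s0 C lam good[OF x]])
    then have cd: "jet_bound x L (cross_diff 0 N a a0) (F * cross_sum 0 N a a0 x) (8 * S (Suc N))"
      unfolding F_def S_def mN by simp
    have "jet_bound x L (\<lambda>x. cross_diff 0 N a a0 x *
        (inverse (mass K g 0 (Suc N) a0 x) * inverse (mass K g 0 N a0 x)))
        (F * cross_sum 0 N a a0 x * (inverse (mass K g 0 (Suc N) a0 x) * inverse (mass K g 0 N a0 x)))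
        (8 * S (Suc N) + (c * S (Suc N) + c * S N))"
      using S0 c x by (intro jet_bound_mult cd ji) auto
    then have "jet_bound x L (\<lambda>x. nmass a0 (Suc N) a x - nmass a0 N a x)
        (F * (nmass a0 (Suc N) a x + nmass a0 N a x)) (8 * S (Suc N) + (c * S (Suc N) + c * S N))"
      unfolding nmass_diff nmass_sum by (simp add: mult.assoc)
    then have "jet_bound x L (\<lambda>x. nmass a0 (Suc N) a x - nmass a0 N a x)
        (F * (2 * R)) (W * b ^ N * 1)"
    proof (rule jet_bound_mono)
      have "nmass a0 (Suc N) a x \<le> R" "nmass a0 N a x \<le> R" using nle x N by (auto simp: N0_def)
      then show "F * (nmass a0 (Suc N) a x + nmass a0 N a x) \<le> F * (2 * R)"
        using F0 by (intro mult_left_mono) auto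
      show "0 \<le> 8 * S (Suc N) + (c * S (Suc N) + c * S N)" using S0 c by auto
      have "c * S N \<le> c * S (Suc N)" using c S_mono by (intro mult_left_mono) auto
      then show "8 * S (Suc N) + (c * S (Suc N) + c * S N) \<le> W * b ^ N * 1"
        using SW[of N] by (simp add: algebra_simps)
    qed
    moreover have Wb: "1 \<le> W * b ^ N"
      using W1 b mult_mono[of 1 W 1 "b ^ N"] by simp
    ultimately have J: "jet_bound x L (\<lambda>x. nmass a0 (Suc N) a x - nmass a0 N a x)
        (F * (2 * R) * (W * b ^ N) ^ length L) 1"
      by (intro jet_bound_rescale) auto
    have F: "F \<le> 1 / lam * (lam powr (1 / (2 * \<kappa>))) ^ N"
    proof -
      define k where "k = card (Bad \<inter> {0<..0 + m * \<kappa>})"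
      have "k \<le> card (Bad \<inter> {0<..N})" unfolding k_def mN by (intro card_mono) auto
      moreover have "card (Bad \<inter> {0<..N}) * (2 * \<kappa>) \<le> N" using N by (intro bad) (simp add: N0_def)
      ultimately have "k * (2 * \<kappa>) \<le> N" by (meson le_trans mult_le_mono1)
      then have "real (k * (2 * \<kappa>)) \<le> real N" by (simp only: of_nat_le_iff)
      then have k: "real k \<le> real N / (2 * \<kappa>)" using \<kappa>_pos by (simp add: field_simps)
      have "N < (m + 1) * \<kappa>" unfolding m_def using \<kappa>_pos
        by (simp add: dividend_less_div_times)
      then have "real N < real ((m + 1) * \<kappa>)" by (simp only: of_nat_less_iff)
      then have m: "real m \<ge> real N / \<kappa> - 1" using \<kappa>_pos by (simp add: field_simps)
      have "F = lam powr (real m - real k)"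
        unfolding F_def k_def[symmetric] using lam2
        by (simp add: powr_diff powr_realpow power_one_over)
      also have "\<dots> \<le> lam powr (real N / (2 * \<kappa>) - 1)"
      proof -
        have "real N / \<kappa> = real N / (2 * \<kappa>) + real N / (2 * \<kappa>)" by simp
        then have "real N / (2 * \<kappa>) - 1 \<le> real m - real k" using k m by linarith
        then show ?thesis using lam1 lam2 by (intro powr_mono') auto
      qed
      also have "\<dots> = 1 / lam * (lam powr (1 / (2 * \<kappa>))) ^ N"
        using lam2 by (simp add: powr_diff powr_power)
      finally show ?thesis .
    qed
    have "(W * b ^ N) ^ length L \<le> (W * b ^ N) ^ q" using Wb L by (intro power_increasing) auto
    then have "F * (2 * R) * (W * b ^ N) ^ length L \<le>
        1 / lam * (lam powr (1 / (2 * \<kappa>))) ^ N * (2 * R) * (W * b ^ N) ^ q"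
      using F F0 R lam2 Wb by (intro mult_mono) auto
    also have "\<dots> = D1 * (b ^ q * lam powr (1 / (2 * \<kappa>))) ^ N"
      unfolding D1_def by (simp add: power_mult_distrib power_mult[symmetric] mult_ac)
    also have "\<dots> \<le> D1 * r ^ N"
      using D1 r(1) b lam2 by (intro mult_left_mono power_mono) auto
    finally show ?thesis by (rule jet_bound_mono[OF J]) auto
  qed
  define D2 where "D2 = D1 / (1 - r)"
  have D2: "D2 > 0" unfolding D2_def using D1 r(2) by simp
  have tele: "jet_bound x L (\<lambda>x. nmass a0 (N + k) a x - nmass a0 N a x) (D2 * r ^ N) 1"
    if x: "x \<in> X" and N: "N \<ge> N0" for x N k a
  proof -
    have "jet_bound x L (\<lambda>x. nmass a0 (N + k) a x - nmass a0 N a x) (D1 * (\<Sum>j<k. r ^ (N + j))) 1"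
    proof (induction k)
      case 0
      show ?case by (simp add: jet_bound_const)
    next
      case (Suc k)
      have "jet_bound x L (\<lambda>x. (nmass a0 (N + k) a x - nmass a0 N a x) +
          (nmass a0 (Suc (N + k)) a x - nmass a0 (N + k) a x))
         (D1 * (\<Sum>j<k. r ^ (N + j)) + D1 * r ^ (N + k)) 1"
        using x N by (intro jet_bound_add Suc.IH step) auto
      then show ?case by (simp add: distrib_left)
    qed
    moreover have "D1 * (\<Sum>j<k. r ^ (N + j)) \<le> D2 * r ^ N"
    proof -
      have "(\<Sum>j<k. r ^ j) = (1 - r ^ k) / (1 - r)" using r(2) by (subst sum_gp_strict) auto
      also have "\<dots> \<le> 1 / (1 - r)" using r r0 by (intro divide_right_mono) auto
      finally have "D1 * r ^ N * (\<Sum>j<k. r ^ j) \<le> D1 * r ^ N * (1 / (1 - r))"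
        using D1 r0 by (intro mult_left_mono) auto
      then show ?thesis by (simp add: D2_def power_add sum_distrib_left mult_ac)
    qed
    ultimately show ?thesis by (rule jet_bound_mono) auto
  qed
  define D3 where "D3 = R * (max 1 (S N0 + c * S N0)) ^ length L"
  have D3: "D3 > 0" unfolding D3_def using R by simp
  have start: "jet_bound x L (nmass a0 N0 a) D3 1" if x: "x \<in> X" for x a
  proof -
    have "jet_bound x L (\<lambda>x. mass K g 0 N0 a x * inverse (mass K g 0 N0 a0 x))
       (mass K g 0 N0 a x * inverse (mass K g 0 N0 a0 x)) (S N0 + c * S N0)"
      using S0 c x by (intro jet_bound_mult jm ji) auto
    then have "jet_bound x L (nmass a0 N0 a) (nmass a0 N0 a x) (S N0 + c * S N0)"
      by (simp add: nmass_def[abs_def])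
    then have "jet_bound x L (nmass a0 N0 a) R (max 1 (S N0 + c * S N0) * 1)"
      by (rule jet_bound_mono) (use nle[OF x, of N0] S0 c in \<open>auto simp: N0_def\<close>)
    then show ?thesis unfolding D3_def by (intro jet_bound_rescale) auto
  qed
  define D where "D = D3 + D2"
  have "1 / R \<le> nmass a0 N a x" if "x \<in> X" "N \<ge> N0" for x a N
  proof -
    have "nmass a N a0 x \<le> R" using nle that by (auto simp: N0_def)
    moreover have "nmass a N a0 x = inverse (nmass a0 N a x)" by (simp add: nmass_def)
    ultimately show ?thesis using nmass_pos[of a0 N a x] R by (simp add: field_simps)
  qed
  moreover have "jet_bound x L (nmass a0 N a) D 1" if x: "x \<in> X" and N: "N \<ge> N0" for x a N
  proof -
    obtain k where k: "N = N0 + k" using N le_Suc_ex by blast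
    have "jet_bound x L (\<lambda>x. nmass a0 N0 a x + (nmass a0 (N0 + k) a x - nmass a0 N0 a x)) (D3 + D2 * r ^ N0) 1"
      using x by (intro jet_bound_add start tele) auto
    then have "jet_bound x L (nmass a0 N a) (D3 + D2 * r ^ N0) 1"
      by (simp add: k)
    then show ?thesis
      by (rule jet_bound_mono) (use D2 r r0 in \<open>auto simp: D_def intro!: mult_left_le power_le_one\<close>)
  qed
  moreover have "jet_bound x L (\<lambda>x. nmass a0 N' a x - nmass a0 N a x) (D * r ^ N) 1"
    if x: "x \<in> X" and N: "N \<ge> N0" "N' \<ge> N" for x a N N'
  proof -
    obtain k where k: "N' = N + k" using N le_Suc_ex by blast
    show ?thesis unfolding k
      by (rule jet_bound_mono[OF tele[OF x N(1)]]) (use D3 r0 in \<open>auto simp: D_def\<close>)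
  qed
  moreover have "D > 0" "1 / R > 0" using D2 D3 R by (auto simp: D_def)
  ultimately show ?thesis by blast
qed

end

section \<open>Path expectations of a Markov chain\<close>

lemma path_sum_shift: "path_sum K g h (Suc i) N a x = path_sum (\<lambda>j. K (Suc j)) (\<lambda>j. g (Suc j)) h i N a x"
proof (induction N arbitrary: i a)
  case (Suc N)
  show ?case unfolding path_sum.simps by (subst Suc.IH) simp
qed simp

lemma path_sum_cong:
  assumes "\<And>j c. j \<in> {i<..i + N} \<Longrightarrow> g j c x = g' j c x"
  shows "path_sum K g h i N a x = path_sum K g' h i N a x"
  using assms
proof (induction N arbitrary: i a)
  case (Suc N)
  have "path_sum K g h (Suc i) N b x = path_sum K g' h (Suc i) N b x" for b
    using Suc.prems by (intro Suc.IH) auto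
  then show ?case using Suc.prems by simp
qed simp

text \<open>
  A terminal factor can be regarded as the factor of the last state. This turns two-point probabilities of the
  chain into total masses.
\<close>

lemma path_sum_last_factor:
  "N \<ge> 1 \<Longrightarrow> path_sum K (\<lambda>j c x. if j = i + N then h c x else 1) (\<lambda>_ _. 1) i N a x = path_sum K (\<lambda>_ _ _. 1) h i N a x"
proof (induction N arbitrary: i a)
  case (Suc N)
  show ?case
  proof (cases N)
    case (Suc k)
    have "path_sum K (\<lambda>j c x. if j = i + Suc N then h c x else 1) (\<lambda>_ _. 1) (Suc i) N b x
        = path_sum K (\<lambda>_ _ _. 1) h (Suc i) N b x" for b
      using Suc.IH[of "Suc i" b] \<open>N = Suc k\<close> by simp
    then show ?thesis using Suc by simp
  qed simp
qed simp

lemma expectation_finite_valued: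
  fixes F :: "'a \<Rightarrow> real"
  assumes "prob_space M" "finite I" "\<And>y. y \<in> I \<Longrightarrow> {\<omega> \<in> space M. Y \<omega> = y} \<in> sets M"
    "\<And>\<omega>. \<omega> \<in> space M \<Longrightarrow> Y \<omega> \<in> I"
  shows "(\<integral>\<omega>. F (Y \<omega>) \<partial>M) = (\<Sum>y\<in>I. F y * measure M {\<omega> \<in> space M. Y \<omega> = y})"
proof -
  interpret prob_space M by fact
  have int: "integrable M (indicat_real {\<omega> \<in> space M. Y \<omega> = y})" if "y \<in> I" for y
    using assms(3)[OF that] by (intro integrable_real_indicator) (auto simp: emeasure_eq_measure)
  have "(\<integral>\<omega>. F (Y \<omega>) \<partial>M) = (\<integral>\<omega>. (\<Sum>y\<in>I. F y * indicator {\<omega> \<in> space M. Y \<omega> = y} \<omega>) \<partial>M)"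
  proof (intro Bochner_Integration.integral_cong refl)
    fix \<omega> assume w: "\<omega> \<in> space M"
    have "(\<Sum>y\<in>I. F y * indicator {\<omega> \<in> space M. Y \<omega> = y} \<omega>) = (\<Sum>y\<in>I. if y = Y \<omega> then F y else 0)"
      using w by (intro sum.cong) (auto simp: indicator_def)
    then show "F (Y \<omega>) = (\<Sum>y\<in>I. F y * indicator {\<omega> \<in> space M. Y \<omega> = y} \<omega>)"
      using assms(2) assms(4)[OF w] by simp
  qed
  also have "\<dots> = (\<Sum>y\<in>I. F y * measure M {\<omega> \<in> space M. Y \<omega> = y})"
    using int assms(3) by (subst Bochner_Integration.integral_sum) auto
  finally show ?thesis .
qed

locale positive_markov_chain = prob_space M for M :: "'w measure" +
  fixes \<eta> :: "int \<Rightarrow> 'w \<Rightarrow> 'h::finite"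
  assumes markov: "markov_chain M \<eta>"
    and state_pos: "prob {\<omega> \<in> space M. \<eta> t \<omega> = a} > 0"
begin

lemma rv[measurable]: "\<eta> t \<in> M \<rightarrow>\<^sub>M count_space UNIV"
  using markov unfolding markov_chain_def by blast

text \<open>
  The one-step transition probabilities seen from time \<open>t\<close>, forwards for \<open>e = 1\<close> and backwards for \<open>e = - 1\<close>.
\<close>

definition kernel :: "int \<Rightarrow> int \<Rightarrow> nat \<Rightarrow> 'h \<Rightarrow> 'h \<Rightarrow> real" where
  "kernel e t j a b = \<P>(\<omega> in M. \<eta> (t + e * int (Suc j)) \<omega> = b \<bar> \<eta> (t + e * int j) \<omega> = a)"

lemma kernel_Suc: "kernel e t (Suc j) = kernel e (t + e) j"
  by (simp add: fun_eq_iff kernel_def algebra_simps)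

lemma expectation_pair:
  "expectation (\<lambda>\<omega>. F (\<eta> s \<omega>) (\<eta> t \<omega>)) =
     (\<Sum>a\<in>UNIV. \<Sum>b\<in>UNIV. F a b * prob {\<omega> \<in> space M. \<eta> s \<omega> = a \<and> \<eta> t \<omega> = b})"
proof -
  have "expectation (\<lambda>\<omega>. (\<lambda>(a, b). F a b) (\<eta> s \<omega>, \<eta> t \<omega>)) =
     (\<Sum>p\<in>UNIV. (\<lambda>(a, b). F a b) p * prob {\<omega> \<in> space M. (\<eta> s \<omega>, \<eta> t \<omega>) = p})"
    by (intro expectation_finite_valued prob_space_axioms) auto
  then show ?thesis
    by (simp add: UNIV_Times_UNIV[symmetric] sum.cartesian_product case_prod_unfold prod_eq_iff del: UNIV_Times_UNIV)
qed

lemma expectation_single: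
  "expectation (\<lambda>\<omega>. F (\<eta> s \<omega>)) = (\<Sum>a\<in>UNIV. F a * prob {\<omega> \<in> space M. \<eta> s \<omega> = a})"
  by (intro expectation_finite_valued prob_space_axioms) auto

definition paths :: "int \<Rightarrow> int \<Rightarrow> (int \<Rightarrow> 'h) set" where
  "paths u v = PiE {u..v} (\<lambda>_. UNIV)"

lemma finite_paths: "finite (paths u v)"
  unfolding paths_def by (intro finite_PiE) auto

lemma restrict_in_paths: "restrict f {u..v} \<in> paths u v"
  unfolding paths_def by (rule restrict_PiE_iff[THEN iffD2]) simp

definition cylinder :: "int \<Rightarrow> int \<Rightarrow> (int \<Rightarrow> 'h) \<Rightarrow> 'w set" where
  "cylinder u v x = {\<omega> \<in> space M. \<forall>s\<in>{u..v}. \<eta> s \<omega> = x s}"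

lemma restrict_eq_iff:
  "x \<in> paths u v \<Longrightarrow> (restrict (\<lambda>s. \<eta> s \<omega>) {u..v} = x) \<longleftrightarrow> (\<forall>s\<in>{u..v}. \<eta> s \<omega> = x s)"
  unfolding paths_def by (auto simp: fun_eq_iff PiE_def extensional_def)

text \<open>
  The Markov property for one more step. If the cylinder is a null set, both sides vanish.
\<close>

lemma cylinder_step:
  assumes "u \<le> v"
  shows "prob {\<omega> \<in> space M. (\<forall>s\<in>{u..v}. \<eta> s \<omega> = x s) \<and> \<eta> (v + 1) \<omega> = b} =
     prob (cylinder u v x) * kernel 1 v 0 (x v) b"
proof (cases "prob (cylinder u v x) > 0")
  case True
  define k where "k = nat (v - u)"
  have u: "v - int k = u" using assms by (simp add: k_def)
  define y where "y = x(v + 1 := b)"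
  have xy: "(\<forall>s\<in>{u..v}. \<eta> s \<omega> = y s) \<longleftrightarrow> (\<forall>s\<in>{u..v}. \<eta> s \<omega> = x s)" for \<omega>
    by (auto simp: y_def)
  have pos: "0 < prob {\<omega> \<in> space M. \<forall>s\<in>{v - int k..v}. \<eta> s \<omega> = y s}"
    using True unfolding u xy by (simp add: cylinder_def)
  have "\<P>(\<omega> in M. \<eta> (v + 1) \<omega> = y (v + 1) \<bar> \<forall>s\<in>{v - int k..v}. \<eta> s \<omega> = y s)
          = \<P>(\<omega> in M. \<eta> (v + 1) \<omega> = y (v + 1) \<bar> \<eta> v \<omega> = y v)"
    using markov pos unfolding markov_chain_def by blast
  then have "\<P>(\<omega> in M. \<eta> (v + 1) \<omega> = b \<bar> \<forall>s\<in>{u..v}. \<eta> s \<omega> = x s) = kernel 1 v 0 (x v) b"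
    unfolding u xy by (simp add: kernel_def y_def)
  then show ?thesis using True
    by (simp add: cond_prob_def cylinder_def field_simps conj_commute)
next
  case False
  then have 0: "prob (cylinder u v x) = 0" using zero_less_measure_iff by auto
  have "{\<omega> \<in> space M. \<forall>s\<in>{u..v}. \<eta> s \<omega> = x s} \<in> sets M" by measurable
  then have "prob {\<omega> \<in> space M. (\<forall>s\<in>{u..v}. \<eta> s \<omega> = x s) \<and> \<eta> (v + 1) \<omega> = b} \<le> prob (cylinder u v x)"
    unfolding cylinder_def by (intro finite_measure_mono) auto
  then show ?thesis using 0 by (simp add: measure_le_0_iff)
qed

lemma expectation_path:
  "expectation (\<lambda>\<omega>. \<Phi> (restrict (\<lambda>s. \<eta> s \<omega>) {u..v})) = (\<Sum>x\<in>paths u v. \<Phi> x * prob (cylinder u v x))"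
proof -
  have "expectation (\<lambda>\<omega>. \<Phi> (restrict (\<lambda>s. \<eta> s \<omega>) {u..v})) =
     (\<Sum>x\<in>paths u v. \<Phi> x * prob {\<omega> \<in> space M. restrict (\<lambda>s. \<eta> s \<omega>) {u..v} = x})"
  proof (rule expectation_finite_valued[OF prob_space_axioms finite_paths])
    fix x assume "x \<in> paths u v"
    then show "{\<omega> \<in> space M. restrict (\<lambda>s. \<eta> s \<omega>) {u..v} = x} \<in> events"
      by (subst restrict_eq_iff) measurable
  qed (rule restrict_in_paths)
  then show ?thesis by (simp add: cylinder_def restrict_eq_iff cong: sum.cong)
qed

lemma expectation_path_step:
  assumes "u \<le> v"
  shows "expectation (\<lambda>\<omega>. \<Phi> (restrict (\<lambda>s. \<eta> s \<omega>) {u..v}) * h (\<eta> (v + 1) \<omega>)) =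
     expectation (\<lambda>\<omega>. \<Phi> (restrict (\<lambda>s. \<eta> s \<omega>) {u..v}) * (\<Sum>b\<in>UNIV. kernel 1 v 0 (\<eta> v \<omega>) b * h b))"
proof -
  let ?Y = "\<lambda>\<omega>. (restrict (\<lambda>s. \<eta> s \<omega>) {u..v}, \<eta> (v + 1) \<omega>)"
  have "expectation (\<lambda>\<omega>. (\<lambda>(x, b). \<Phi> x * h b) (?Y \<omega>)) =
     (\<Sum>p\<in>paths u v \<times> UNIV. (\<lambda>(x, b). \<Phi> x * h b) p * prob {\<omega> \<in> space M. ?Y \<omega> = p})"
    by (intro expectation_finite_valued finite_cartesian_product finite_paths finite_UNIV prob_space_axioms)
      (auto simp: restrict_eq_iff restrict_in_paths)
  also have "\<dots> = (\<Sum>x\<in>paths u v. \<Sum>b\<in>UNIV. \<Phi> x * h b * prob {\<omega> \<in> space M. ?Y \<omega> = (x, b)})"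
    by (simp add: sum.cartesian_product case_prod_unfold prod_eq_iff)
  also have "\<dots> = (\<Sum>x\<in>paths u v. \<Phi> x * (\<Sum>b\<in>UNIV. kernel 1 v 0 (x v) b * h b) * prob (cylinder u v x))"
    using cylinder_step[OF assms] by (simp add: restrict_eq_iff sum_distrib_left sum_distrib_right mult_ac cong: sum.cong)
  also have "\<dots> = expectation (\<lambda>\<omega>. (\<lambda>x. \<Phi> x * (\<Sum>b\<in>UNIV. kernel 1 v 0 (x v) b * h b)) (restrict (\<lambda>s. \<eta> s \<omega>) {u..v}))"
    by (rule expectation_path[symmetric])
  finally show ?thesis using assms by simp
qed


definition path_mean :: "int \<Rightarrow> int \<Rightarrow> (int \<Rightarrow> 'h \<Rightarrow> real) \<Rightarrow> real" where
  "path_mean u v G = expectation (\<lambda>\<omega>. \<Prod>s\<in>{u..v}. G s (\<eta> s \<omega>))"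

lemma path_mean_cong: "(\<And>s c. s \<in> {u..v} \<Longrightarrow> G s c = G' s c) \<Longrightarrow> path_mean u v G = path_mean u v G'"
  unfolding path_mean_def by (intro Bochner_Integration.integral_cong prod.cong refl) auto

text \<open>
  The last time is integrated out by the Markov property; its factor becomes a factor of the last but one state.
\<close>

lemma path_mean_step:
  assumes "u \<le> v"
  shows "path_mean u (v + 1) G = path_mean u v (G(v := \<lambda>c. G v c * (\<Sum>b\<in>UNIV. kernel 1 v 0 c b * G (v + 1) b)))"
proof -
  let ?r = "\<lambda>\<omega>. restrict (\<lambda>s. \<eta> s \<omega>) {u..v}"
  have "{u..v + 1} = insert (v + 1) {u..v}" using assms by auto
  then have "(\<Prod>s\<in>{u..v + 1}. G s (\<eta> s \<omega>)) = (\<Prod>s\<in>{u..v}. G s (?r \<omega> s)) * G (v + 1) (\<eta> (v + 1) \<omega>)" for \<omega>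
    by (simp add: mult.commute)
  then have "path_mean u (v + 1) G =
      expectation (\<lambda>\<omega>. (\<Prod>s\<in>{u..v}. G s (?r \<omega> s)) * (\<Sum>b\<in>UNIV. kernel 1 v 0 (\<eta> v \<omega>) b * G (v + 1) b))"
    unfolding path_mean_def using expectation_path_step[OF assms, of "\<lambda>x. \<Prod>s\<in>{u..v}. G s (x s)"] by simp
  also have "\<dots> = path_mean u v (G(v := \<lambda>c. G v c * (\<Sum>b\<in>UNIV. kernel 1 v 0 c b * G (v + 1) b)))"
    unfolding path_mean_def
  proof (intro Bochner_Integration.integral_cong refl)
    fix \<omega>
    let ?G' = "G(v := \<lambda>c. G v c * (\<Sum>b\<in>UNIV. kernel 1 v 0 c b * G (v + 1) b))"
    have v: "{u..v} = insert v {u..<v}" using assms by auto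
    have "(\<Prod>s\<in>{u..<v}. ?G' s (\<eta> s \<omega>)) = (\<Prod>s\<in>{u..<v}. G s (\<eta> s \<omega>))"
      by (intro prod.cong) auto
    moreover have "(\<Prod>s\<in>{u..v}. G s (?r \<omega> s)) = (\<Prod>s\<in>{u..v}. G s (\<eta> s \<omega>))"
      by (intro prod.cong) auto
    ultimately show "(\<Prod>s\<in>{u..v}. G s (?r \<omega> s)) * (\<Sum>b\<in>UNIV. kernel 1 v 0 (\<eta> v \<omega>) b * G (v + 1) b) =
      (\<Prod>s\<in>{u..v}. ?G' s (\<eta> s \<omega>))"
      by (simp add: v mult_ac)
  qed
  finally show ?thesis .
qed

lemma path_mean_future:
  assumes "u \<le> v"
  shows "path_mean u (v + int N) G =
    path_mean u v (G(v := \<lambda>c. G v c * path_sum (kernel 1 v) (\<lambda>j c x. G (v + int j) c) (\<lambda>_ _. 1) 0 N c ()))"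
  using assms
proof (induction N arbitrary: v G)
  case 0
  show ?case by simp
next
  case (Suc N)
  let ?V = "\<lambda>c. path_sum (kernel 1 (v + 1)) (\<lambda>j c x. G (v + 1 + int j) c) (\<lambda>_ _. 1) 0 N c ()"
  let ?G = "G(v + 1 := \<lambda>c. G (v + 1) c * ?V c)"
  have "path_mean u (v + int (Suc N)) G = path_mean u ((v + 1) + int N) G"
    by (simp add: algebra_simps)
  also have "\<dots> = path_mean u (v + 1) ?G"
    using Suc.prems by (intro Suc.IH) auto
  also have "\<dots> = path_mean u v (?G(v := \<lambda>c. ?G v c * (\<Sum>b\<in>UNIV. kernel 1 v 0 c b * ?G (v + 1) b)))"
    by (rule path_mean_step[OF Suc.prems])
  also have "\<dots> = path_mean u v (G(v := \<lambda>c. G v c * path_sum (kernel 1 v) (\<lambda>j c x. G (v + int j) c) (\<lambda>_ _. 1) 0 (Suc N) c ()))"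
    by (intro path_mean_cong) (auto simp: path_sum_shift kernel_Suc algebra_simps)
  finally show ?case .
qed

lemma path_mean_single: "path_mean u u G = (\<Sum>a\<in>UNIV. G u a * prob {\<omega> \<in> space M. \<eta> u \<omega> = a})"
  unfolding path_mean_def by (simp add: expectation_single)

lemma path_mean_pair:
  "path_mean (u - 1) u G =
     (\<Sum>a\<in>UNIV. \<Sum>b\<in>UNIV. G u a * G (u - 1) b * prob {\<omega> \<in> space M. \<eta> u \<omega> = a \<and> \<eta> (u - 1) \<omega> = b})"
proof -
  have "{u - 1..u} = {u - 1, u}" by auto
  then show ?thesis unfolding path_mean_def
    using expectation_pair[of "\<lambda>a b. G u a * G (u - 1) b" u "u - 1"] by (simp add: mult.commute)
qed

text \<open>
  All later times are first integrated out. This leaves a two-point expectation, and a joint law of two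
  variables disintegrates in either order.
\<close>

lemma path_mean_step_left:
  assumes "u \<le> v"
  shows "path_mean (u - 1) v G = path_mean u v (G(u := \<lambda>c. G u c * (\<Sum>b\<in>UNIV. kernel (- 1) u 0 c b * G (u - 1) b)))"
proof -
  define N where "N = nat (v - u)"
  have v: "v = u + int N" using assms by (simp add: N_def)
  let ?V = "\<lambda>G c. path_sum (kernel 1 u) (\<lambda>j c x. G (u + int j) c) (\<lambda>_ _. 1) 0 N c ()"
  let ?G = "G(u := \<lambda>c. G u c * (\<Sum>b\<in>UNIV. kernel (- 1) u 0 c b * G (u - 1) b))"
  have V: "?V ?G c = ?V G c" for c by (intro path_sum_cong) auto
  have p: "prob {\<omega> \<in> space M. \<eta> u \<omega> = a \<and> \<eta> (u - 1) \<omega> = b} =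
     kernel (- 1) u 0 a b * prob {\<omega> \<in> space M. \<eta> u \<omega> = a}" for a b
    using state_pos[of u a] by (simp add: kernel_def cond_prob_def conj_commute)
  have "path_mean (u - 1) v G = path_mean (u - 1) u (G(u := \<lambda>c. G u c * ?V G c))"
    unfolding v by (rule path_mean_future) simp
  also have "\<dots> = (\<Sum>a\<in>UNIV. ?G u a * ?V ?G a * prob {\<omega> \<in> space M. \<eta> u \<omega> = a})"
    unfolding path_mean_pair V p by (simp add: sum_distrib_left sum_distrib_right mult_ac)
  also have "\<dots> = path_mean u u (?G(u := \<lambda>c. ?G u c * ?V ?G c))"
    by (simp add: path_mean_single)
  also have "\<dots> = path_mean u v ?G"
    unfolding v by (rule path_mean_future[symmetric]) simp
  finally show ?thesis .
qed

lemma path_mean_past: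
  assumes "u \<le> v"
  shows "path_mean (u - int N) v G =
    path_mean u v (G(u := \<lambda>c. G u c * path_sum (kernel (- 1) u) (\<lambda>j c x. G (u - int j) c) (\<lambda>_ _. 1) 0 N c ()))"
  using assms
proof (induction N arbitrary: u G)
  case 0
  show ?case by simp
next
  case (Suc N)
  let ?V = "\<lambda>c. path_sum (kernel (- 1) (u - 1)) (\<lambda>j c x. G (u - 1 - int j) c) (\<lambda>_ _. 1) 0 N c ()"
  let ?G = "G(u - 1 := \<lambda>c. G (u - 1) c * ?V c)"
  have "path_mean (u - int (Suc N)) v G = path_mean ((u - 1) - int N) v G"
    by (simp add: algebra_simps)
  also have "\<dots> = path_mean (u - 1) v ?G"
    using Suc.prems by (intro Suc.IH) auto
  also have "\<dots> = path_mean u v (?G(u := \<lambda>c. ?G u c * (\<Sum>b\<in>UNIV. kernel (- 1) u 0 c b * ?G (u - 1) b)))"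
    by (rule path_mean_step_left[OF Suc.prems])
  also have "\<dots> = path_mean u v (G(u := \<lambda>c. G u c * path_sum (kernel (- 1) u) (\<lambda>j c x. G (u - int j) c) (\<lambda>_ _. 1) 0 (Suc N) c ()))"
    by (intro path_mean_cong) (auto simp: path_sum_shift kernel_Suc algebra_simps)
  finally show ?case .
qed

text \<open>
  Both sides of \<open>t\<close> are integrated out. This is the factorization of the weight of a regime at time \<open>t\<close> into
  past, present and future.
\<close>

lemma path_mean_split:
  assumes "u = t - int Nl" "v = t + int Nr"
  shows "path_mean u v (G(t := \<lambda>c. of_bool (c = a) * G t c)) =
     prob {\<omega> \<in> space M. \<eta> t \<omega> = a} * G t a
       * path_sum (kernel (- 1) t) (\<lambda>j c x. G (t - int j) c) (\<lambda>_ _. 1) 0 Nl a ()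
       * path_sum (kernel 1 t) (\<lambda>j c x. G (t + int j) c) (\<lambda>_ _. 1) 0 Nr a ()"
proof -
  let ?V = "\<lambda>G c. path_sum (kernel 1 t) (\<lambda>j c x. G (t + int j) c) (\<lambda>_ _. 1) 0 Nr c ()"
  let ?U = "\<lambda>G c. path_sum (kernel (- 1) t) (\<lambda>j c x. G (t - int j) c) (\<lambda>_ _. 1) 0 Nl c ()"
  let ?G = "G(t := \<lambda>c. of_bool (c = a) * G t c)"
  let ?G' = "?G(t := \<lambda>c. ?G t c * ?V ?G c)"
  have V: "?V ?G c = ?V G c" for c by (intro path_sum_cong) auto
  have U: "?U ?G' c = ?U G c" for c by (intro path_sum_cong) auto
  have "path_mean u v ?G = path_mean u t ?G'"
    unfolding assms(2) by (rule path_mean_future) (simp add: assms(1))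
  also have "\<dots> = path_mean t t (?G'(t := \<lambda>c. ?G' t c * ?U ?G' c))"
    unfolding assms(1) by (rule path_mean_past) simp
  also have "\<dots> = (\<Sum>c\<in>UNIV. if c = a then prob {\<omega> \<in> space M. \<eta> t \<omega> = c} * G t c * ?U G c * ?V G c else 0)"
    unfolding path_mean_single unfolding U unfolding V by (intro sum.cong) auto
  finally show ?thesis by simp
qed

text \<open>
  The Chapman-Kolmogorov equation in both directions of time; it transfers the mixing condition to the products of
  one-step kernels.
\<close>

lemma kernel_transit:
  assumes "e = 1 \<or> e = - 1" "N \<ge> 1"
  shows "transit (kernel e t) (\<lambda>_ _ _. 1) 0 N a b x = \<P>(\<omega> in M. \<eta> (t + e * int N) \<omega> = b \<bar> \<eta> t \<omega> = a)"
proof -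
  define s where "s = t + e * int N"
  define G :: "int \<Rightarrow> 'h \<Rightarrow> real" where
    "G = (\<lambda>i c. if i = t then of_bool (c = a) else if i = s then of_bool (c = b) else 1)"
  have ne: "s \<noteq> t" using assms by (auto simp: s_def)
  let ?V = "\<lambda>c. path_sum (kernel e t) (\<lambda>j c x. G (t + e * int j) c) (\<lambda>_ _. 1) 0 N c ()"
  have "?V c = path_sum (kernel e t) (\<lambda>j c x. if j = 0 + N then of_bool (c = b) else 1) (\<lambda>_ _. 1) 0 N c ()" for c
    using assms by (intro path_sum_cong) (auto simp: G_def s_def)
  also have "\<dots> c = transit (kernel e t) (\<lambda>_ _ _. 1) 0 N c b ()" for c
    unfolding transit_def using assms(2) by (subst path_sum_last_factor) auto
  finally have V: "?V c = transit (kernel e t) (\<lambda>_ _ _. 1) 0 N c b ()" for c .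
  have "path_mean (min s t) (max s t) G = path_mean t t (G(t := \<lambda>c. G t c * ?V c))"
    using assms(1)
  proof
    assume e: "e = 1"
    then have "min s t = t" "max s t = t + int N" by (auto simp: s_def)
    then show ?thesis using path_mean_future[of t t N G] e by simp
  next
    assume e: "e = - 1"
    then have "max s t = t" "min s t = t - int N" by (auto simp: s_def)
    then show ?thesis using path_mean_past[of t t N G] e by simp
  qed
  also have "\<dots> = (\<Sum>c\<in>UNIV. if c = a then prob {\<omega> \<in> space M. \<eta> t \<omega> = c} * ?V c else 0)"
    unfolding path_mean_single by (intro sum.cong) (auto simp: G_def)
  finally have 1: "path_mean (min s t) (max s t) G = prob {\<omega> \<in> space M. \<eta> t \<omega> = a} * ?V a" by simp
  have "path_mean (min s t) (max s t) G = expectation (\<lambda>\<omega>. (\<lambda>c d. of_bool (c = a) * of_bool (d = b)) (\<eta> t \<omega>) (\<eta> s \<omega>))"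
    unfolding path_mean_def
  proof (intro Bochner_Integration.integral_cong refl)
    fix \<omega>
    have "(\<Prod>i\<in>{min s t..max s t}. G i (\<eta> i \<omega>)) = (\<Prod>i\<in>{s, t}. G i (\<eta> i \<omega>))"
      by (intro prod.mono_neutral_right) (auto simp: G_def)
    then show "(\<Prod>i\<in>{min s t..max s t}. G i (\<eta> i \<omega>)) = of_bool (\<eta> t \<omega> = a) * of_bool (\<eta> s \<omega> = b)"
      using ne by (simp add: G_def)
  qed
  also have "\<dots> = (\<Sum>c\<in>UNIV. \<Sum>d\<in>UNIV. of_bool (c = a) * of_bool (d = b) * prob {\<omega> \<in> space M. \<eta> t \<omega> = c \<and> \<eta> s \<omega> = d})"
    by (rule expectation_pair)
  also have "\<dots> = (\<Sum>c\<in>UNIV. if c = a then \<Sum>d\<in>UNIV. if d = b then prob {\<omega> \<in> space M. \<eta> t \<omega> = c \<and> \<eta> s \<omega> = d} else 0 else 0)"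
    by (intro sum.cong) (auto intro!: sum.cong)
  finally have "prob {\<omega> \<in> space M. \<eta> t \<omega> = a \<and> \<eta> s \<omega> = b} = prob {\<omega> \<in> space M. \<eta> t \<omega> = a} * ?V a"
    using 1 by simp
  then have "?V a = \<P>(\<omega> in M. \<eta> s \<omega> = b \<bar> \<eta> t \<omega> = a)"
    using state_pos[of t a] by (simp add: cond_prob_def field_simps conj_commute)
  moreover have "transit (kernel e t) (\<lambda>_ _ _. 1) 0 N a b () = transit (kernel e t) (\<lambda>_ _ _. 1) 0 N a b x"
    unfolding transit_def
    by (induction N arbitrary: a t) (simp_all add: path_sum_shift kernel_Suc)
  ultimately show ?thesis using V[of a] by (simp add: s_def)
qed

lemma kernel_nonneg: "kernel e t j a b \<ge> 0"
  by (simp add: kernel_def cond_prob_def)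

lemma kernel_sum: "(\<Sum>b\<in>UNIV. kernel e t j a b) = 1"
proof -
  let ?s = "t + e * int (Suc j)" and ?t = "t + e * int j"
  have "(\<Sum>b\<in>UNIV. prob {\<omega> \<in> space M. \<eta> ?s \<omega> = b \<and> \<eta> ?t \<omega> = a}) =
     prob (\<Union>b\<in>UNIV. {\<omega> \<in> space M. \<eta> ?s \<omega> = b \<and> \<eta> ?t \<omega> = a})"
    by (intro finite_measure_finite_Union[symmetric]) (auto simp: disjoint_family_on_def)
  also have "(\<Union>b\<in>UNIV. {\<omega> \<in> space M. \<eta> ?s \<omega> = b \<and> \<eta> ?t \<omega> = a}) = {\<omega> \<in> space M. \<eta> ?t \<omega> = a}"
    by auto
  finally show ?thesis using state_pos[of ?t a]
    by (simp add: kernel_def cond_prob_def sum_divide_distrib[symmetric])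
qed

text \<open>
  Multiplying by \<open>P\<^sub>t(a)\<close> turns the conditional expectation over an independent copy into an expectation
  restricted to the event that the state at time \<open>t\<close> is \<open>a\<close>.
\<close>

lemma copy_expectation_eq:
  assumes "t \<in> {u..v}"
  shows "prob {\<omega> \<in> space M. \<eta> t \<omega> = a} *
      copy_cond_expectation M \<eta> t a (\<lambda>\<sigma>. \<Prod>s\<in>{u..v}. G s (\<sigma> s)) =
    path_mean u v (G(t := \<lambda>c. of_bool (c = a) * G t c))"
proof -
  let ?N = "PiM UNIV (\<lambda>_ :: int. count_space (UNIV :: 'h set))"
  let ?p = "prob {\<omega> \<in> space M. \<eta> t \<omega> = a}"
  let ?A = "{\<sigma>. \<sigma> t = a} :: (int \<Rightarrow> 'h) set"
  have Y[measurable]: "(\<lambda>\<omega> t. \<eta> t \<omega>) \<in> M \<rightarrow>\<^sub>M ?N"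
    by (rule measurable_PiM_single') (auto simp: space_PiM)
  have G[measurable]: "(\<lambda>\<sigma>. G s (\<sigma> s)) \<in> borel_measurable ?N" for s
    by (rule measurable_compose[OF measurable_component_singleton[of s]]) auto
  have "{\<sigma> \<in> space ?N. \<sigma> t \<in> {a}} \<in> sets ?N" by measurable
  then have A[measurable]: "?A \<in> sets ?N" by (simp add: space_PiM)
  have eA: "emeasure (path_law M \<eta>) ?A = ennreal ?p"
    unfolding path_law_def
    by (subst emeasure_distr) (auto simp: emeasure_eq_measure vimage_def Int_def conj_commute)
  have um: "uniform_measure (path_law M \<eta>) ?A = density (path_law M \<eta>) (\<lambda>\<sigma>. ennreal (indicator ?A \<sigma> / ?p))"
    unfolding uniform_measure_def eA using state_pos[of t a]
    by (intro arg_cong[where f = "density _"] ext) (simp add: divide_ennreal[symmetric] ennreal_indicator)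
  have s: "sets (path_law M \<eta>) = sets ?N" by (simp add: path_law_def)
  note [measurable_cong] = s
  have "copy_cond_expectation M \<eta> t a (\<lambda>\<sigma>. \<Prod>s\<in>{u..v}. G s (\<sigma> s)) =
     (\<integral>\<sigma>. (indicator ?A \<sigma> / ?p) *\<^sub>R (\<Prod>s\<in>{u..v}. G s (\<sigma> s)) \<partial>(path_law M \<eta>))"
    unfolding copy_cond_expectation_def um by (subst integral_density) auto
  also have "\<dots> = (\<integral>\<omega>. (indicator ?A (\<lambda>t. \<eta> t \<omega>) / ?p) *\<^sub>R (\<Prod>s\<in>{u..v}. G s (\<eta> s \<omega>)) \<partial>M)"
    unfolding path_law_def by (subst integral_distr) auto
  also have "\<dots> = (\<integral>\<omega>. (1 / ?p) * (\<Prod>s\<in>{u..v}. (G(t := \<lambda>c. of_bool (c = a) * G t c)) s (\<eta> s \<omega>)) \<partial>M)"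
  proof (intro Bochner_Integration.integral_cong refl)
    fix \<omega>
    have uv: "{u..v} = insert t ({u..v} - {t})" using assms by auto
    have "(\<Prod>s\<in>{u..v} - {t}. (G(t := \<lambda>c. of_bool (c = a) * G t c)) s (\<eta> s \<omega>)) = (\<Prod>s\<in>{u..v} - {t}. G s (\<eta> s \<omega>))"
      by (intro prod.cong) auto
    moreover have "(\<Prod>s\<in>{u..v}. F s) = F t * (\<Prod>s\<in>{u..v} - {t}. F s)" for F :: "int \<Rightarrow> real"
      by (subst uv, subst prod.insert) auto
    ultimately show "(indicator ?A (\<lambda>t. \<eta> t \<omega>) / ?p) *\<^sub>R (\<Prod>s\<in>{u..v}. G s (\<eta> s \<omega>)) =
      (1 / ?p) * (\<Prod>s\<in>{u..v}. (G(t := \<lambda>c. of_bool (c = a) * G t c)) s (\<eta> s \<omega>))"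
      by (simp add: indicator_def)
  qed
  also have "\<dots> = (1 / ?p) * path_mean u v (G(t := \<lambda>c. of_bool (c = a) * G t c))"
    by (simp add: path_mean_def)
  finally show ?thesis using state_pos[of t a] by simp
qed

end

section \<open>Multi-indices as sorted lists\<close>

lemma sorted_rev_subseq:
  assumes "subseq L' L" "sorted (rev L)"
  shows "sorted (rev L')"
proof -
  have "sorted_wrt (\<ge>) L" using assms(2) by (simp add: sorted_wrt_rev)
  with assms(1) have "sorted_wrt (\<ge>) L'"
  proof (induction rule: list_emb.induct)
    case (list_emb_Cons2 x y xs ys)
    then have "set xs \<subseteq> set ys" by (auto dest: list_emb_set)
    then show ?case using list_emb_Cons2 by auto
  qed auto
  then show ?thesis by (simp add: sorted_wrt_rev)
qed

lemma mi_list_properties: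
  fixes \<nu> :: "'p::{finite,linorder} \<Rightarrow> nat"
  shows "sorted (mi_list \<nu>)" "length (mi_list \<nu>) = mi_size \<nu>" "mset (mi_list \<nu>) = (\<Sum>i\<in>UNIV. replicate_mset (\<nu> i) i)"
proof -
  have *: "sorted (concat (map (\<lambda>i. replicate (\<nu> i) i) xs)) \<and>
      length (concat (map (\<lambda>i. replicate (\<nu> i) i) xs)) = sum \<nu> (set xs) \<and>
      mset (concat (map (\<lambda>i. replicate (\<nu> i) i) xs)) = (\<Sum>i\<in>set xs. replicate_mset (\<nu> i) i)"
    if "sorted xs" "distinct xs" for xs :: "'p list"
    using that by (induction xs) (auto simp: sorted_append)
  show "sorted (mi_list \<nu>)" "length (mi_list \<nu>) = mi_size \<nu>"
    "mset (mi_list \<nu>) = (\<Sum>i\<in>UNIV. replicate_mset (\<nu> i) i)"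
    using *[of "sorted_list_of_set UNIV"] unfolding mi_list_def mi_size_def by auto
qed

text \<open>
  Multi-indices and sorted lists correspond to each other. A subsequence of a sorted list is sorted, so the
  derivatives along subsequences are again derivatives with respect to multi-indices.
\<close>

lemma sorted_eq_mi_list:
  fixes l :: "'p::{finite,linorder} list"
  assumes "sorted l"
  shows "l = mi_list (count (mset l))"
proof -
  have "mset (mi_list (count (mset l))) = mset l"
    by (rule multiset_eqI) (simp add: mi_list_properties(3) count_sum)
  then have "sort l = mi_list (count (mset l))"
    by (rule properties_for_sort) (rule mi_list_properties(1))
  then show ?thesis using sorted_sort_id[OF assms] by simp
qed

lemma smooth_along_if_C_class:
  fixes h :: "'z::topological_space \<Rightarrow> real ^ 'p::{finite,linorder} \<Rightarrow> real"
  assumes C: "\<And>z. C_class q (h z)"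
    and cont: "\<And>\<nu>. mi_size \<nu> \<le> q \<Longrightarrow> continuous_on UNIV (\<lambda>(z, x). mi_deriv \<nu> (h z) x)"
    and L: "sorted (rev L)" "length L \<le> q"
  shows "smooth_along L h"
proof (rule smooth_alongI)
  fix L' assume sub: "subseq L' L"
  define \<nu> where "\<nu> = count (mset (rev L'))"
  have eq: "rev L' = mi_list \<nu>" unfolding \<nu>_def
    by (rule sorted_eq_mi_list[OF sorted_rev_subseq[OF sub L(1)]])
  have "mi_size \<nu> = length L'" using mi_list_properties(2)[of \<nu>] unfolding eq[symmetric] by simp
  then have \<nu>: "mi_size \<nu> \<le> q" using list_emb_length[OF sub] L(2) by simp
  show "partial_derivs_exist (rev L') (h z)" for z
    using C[of z] \<nu> unfolding C_class_def eq by blast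
  show "continuous_on UNIV (\<lambda>(z, x). partial_derivs (rev L') (h z) x)"
    using cont[OF \<nu>] unfolding mi_deriv_def eq .
qed

lemma C_class_if_smooth_along:
  fixes h :: "real ^ 'p::{finite,linorder} \<Rightarrow> real"
  assumes "\<And>L. sorted (rev L) \<Longrightarrow> length L \<le> q \<Longrightarrow> smooth_along L (\<lambda>_ :: real. h)"
  shows "C_class q h"
  unfolding C_class_def
proof (intro allI impI conjI)
  fix \<nu> :: "'p \<Rightarrow> nat" assume \<nu>: "mi_size \<nu> \<le> q"
  have sm: "smooth_along (rev (mi_list \<nu>)) (\<lambda>_ :: real. h)"
    using \<nu> by (intro assms) (auto simp: mi_list_properties)
  show "partial_derivs_exist (mi_list \<nu>) h" using smooth_alongD(1)[OF sm] by simp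
  have "continuous_on UNIV ((\<lambda>(_ :: real, x). mi_deriv \<nu> h x) \<circ> (\<lambda>x. (0, x)))"
    using smooth_alongD(2)[OF sm]
    by (intro continuous_on_compose continuous_intros) (auto simp: mi_deriv_def elim: continuous_on_subset)
  then show "continuous_on UNIV (mi_deriv \<nu> h)" by (simp add: o_def)
qed

lemma finite_mi_size_le: "finite {\<nu> :: 'p::finite \<Rightarrow> nat. mi_size \<nu> \<le> q}"
proof (rule finite_subset)
  show "{\<nu> :: 'p \<Rightarrow> nat. mi_size \<nu> \<le> q} \<subseteq> PiE UNIV (\<lambda>_. {..q})"
  proof
    fix \<nu> :: "'p \<Rightarrow> nat" assume "\<nu> \<in> {\<nu>. mi_size \<nu> \<le> q}"
    moreover have "\<nu> i \<le> mi_size \<nu>" for i unfolding mi_size_def by (intro member_le_sum) auto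
    ultimately show "\<nu> \<in> PiE UNIV (\<lambda>_. {..q})" by (auto intro: order_trans)
  qed
qed (intro finite_PiE; simp)

section \<open>Likelihoods and the derivatives of their logarithms\<close>

lemma compact_bound:
  fixes F :: "'a::metric_space \<Rightarrow> real"
  assumes "continuous_on UNIV F" "compact K"
  shows "\<exists>C. \<forall>p\<in>K. \<bar>F p\<bar> \<le> C"
proof -
  have "compact (F ` K)" using assms by (intro compact_continuous_image) (auto elim: continuous_on_subset)
  then have "bounded (F ` K)" by (rule compact_imp_bounded)
  then show ?thesis by (auto simp: bounded_iff)
qed

locale smooth_likelihood =
  fixes \<phi> :: "'z::euclidean_space \<Rightarrow> real ^ 'd \<Rightarrow> 'x"
    and f :: "'x \<Rightarrow> real ^ 'd \<Rightarrow> ennreal"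
    and \<theta> :: "'h::finite \<Rightarrow> real ^ 'p::{finite,linorder} \<Rightarrow> real ^ 'd"
    and q :: nat
  assumes f_pos: "0 < f (\<phi> z (\<theta> a \<epsilon>)) (\<theta> b \<epsilon>) \<and> f (\<phi> z (\<theta> a \<epsilon>)) (\<theta> b \<epsilon>) < \<infinity>"
    and lik_C_class: "C_class q (lik \<phi> f \<theta> z a b)"
    and lik_cont: "mi_size \<nu> \<le> q \<Longrightarrow> continuous_on UNIV (\<lambda>(z, \<epsilon>). mi_deriv \<nu> (lik \<phi> f \<theta> z a b) \<epsilon>)"
begin

lemma lik_pos: "lik \<phi> f \<theta> z a b \<epsilon> > 0"
  using f_pos[of z a \<epsilon> b] by (simp add: lik_def enn2real_positive_iff)

lemma smooth_lik: "sorted (rev L) \<Longrightarrow> length L \<le> q \<Longrightarrow> smooth_along L (\<lambda>z. lik \<phi> f \<theta> z a b)"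
  by (rule smooth_along_if_C_class[OF lik_C_class lik_cont])

lemma smooth_loglik: "sorted (rev L) \<Longrightarrow> length L \<le> q \<Longrightarrow> smooth_along L (\<lambda>z. loglik \<phi> f \<theta> z a b)"
  unfolding loglik_def[abs_def] by (intro smooth_along_ln smooth_lik lik_pos)

lemma loglik_deriv_continuous:
  assumes "mi_size \<nu> \<le> q"
  shows "partial_derivs_exist (mi_list \<nu>) (loglik \<phi> f \<theta> z a b)"
    "continuous_on UNIV (\<lambda>(z, \<epsilon>). mi_deriv \<nu> (loglik \<phi> f \<theta> z a b) \<epsilon>)"
  using smooth_alongD[OF smooth_loglik[of "rev (mi_list \<nu>)" a b]] assms
  by (simp_all add: mi_list_properties mi_deriv_def)

lemma lik_bounds:
  "\<exists>C\<ge>1. \<forall>z\<in>cball 0 B. \<forall>\<epsilon>\<in>cball 0 R. \<forall>a b. 1 / C \<le> lik \<phi> f \<theta> z a b \<epsilon> \<and> lik \<phi> f \<theta> z a b \<epsilon> \<le> C"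
proof -
  have "\<exists>C. \<forall>p\<in>cball 0 B \<times> cball 0 R. \<bar>(\<lambda>(z, \<epsilon>). loglik \<phi> f \<theta> z a b \<epsilon>) p\<bar> \<le> C" for a b
    using smooth_loglik[of "[]" a b] by (intro compact_bound compact_Times) auto
  then obtain c where c: "\<And>a b p. p \<in> cball 0 B \<times> cball 0 R \<Longrightarrow> \<bar>(\<lambda>(z, \<epsilon>). loglik \<phi> f \<theta> z a b \<epsilon>) p\<bar> \<le> c a b"
    by metis
  define K where "K = (\<Sum>a\<in>UNIV. \<Sum>b\<in>UNIV. \<bar>c a b\<bar>)"
  have "1 / exp K \<le> lik \<phi> f \<theta> z a b \<epsilon> \<and> lik \<phi> f \<theta> z a b \<epsilon> \<le> exp K"
    if "z \<in> cball 0 B" "\<epsilon> \<in> cball 0 R" for z \<epsilon> a b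
  proof -
    have "\<bar>loglik \<phi> f \<theta> z a b \<epsilon>\<bar> \<le> \<bar>c a b\<bar>" using c[of "(z, \<epsilon>)" a b] that by auto
    also have "\<dots> \<le> (\<Sum>b\<in>UNIV. \<bar>c a b\<bar>)" by (rule member_le_sum) auto
    also have "\<dots> \<le> K" unfolding K_def by (rule member_le_sum[of a]) (auto intro: sum_nonneg)
    finally have "- K \<le> loglik \<phi> f \<theta> z a b \<epsilon>" "loglik \<phi> f \<theta> z a b \<epsilon> \<le> K" by auto
    then have "exp (- K) \<le> exp (loglik \<phi> f \<theta> z a b \<epsilon>)" "exp (loglik \<phi> f \<theta> z a b \<epsilon>) \<le> exp K" by auto
    then show ?thesis using lik_pos by (simp add: loglik_def exp_minus field_simps)
  qed
  moreover have "exp K \<ge> 1" unfolding K_def by (simp add: sum_nonneg)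
  ultimately show ?thesis by blast
qed

abbreviation deriv_index :: "real \<Rightarrow> (('p \<Rightarrow> nat) \<times> (real ^ 'p::{finite,linorder}) \<times> 'h \<times> 'h) set" where
  "deriv_index r \<equiv> {(\<nu>, \<epsilon>, a, b). 1 \<le> mi_size \<nu> \<and> mi_size \<nu> \<le> q \<and> norm \<epsilon> \<le> r}"

lemma deriv_sup_eq:
  "q > 0 \<Longrightarrow> loglik_deriv_sup \<phi> f \<theta> q z r =
     (SUP (\<nu>, \<epsilon>, a, b)\<in>deriv_index r. \<bar>mi_deriv \<nu> (loglik \<phi> f \<theta> z a b) \<epsilon>\<bar>)"
proof -
  have "{\<bar>mi_deriv \<nu> (loglik \<phi> f \<theta> z a b) \<epsilon>\<bar> | \<nu> \<epsilon> a b. 1 \<le> mi_size \<nu> \<and> mi_size \<nu> \<le> q \<and> norm \<epsilon> \<le> r} =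
     (\<lambda>(\<nu>, \<epsilon>, a, b). \<bar>mi_deriv \<nu> (loglik \<phi> f \<theta> z a b) \<epsilon>\<bar>) ` deriv_index r"
    by (auto simp: image_def)
  then show "q > 0 \<Longrightarrow> ?thesis" by (simp add: loglik_deriv_sup_def)
qed

lemma deriv_sup_bdd:
  "bdd_above ((\<lambda>(\<nu>, \<epsilon>, a, b). \<bar>mi_deriv \<nu> (loglik \<phi> f \<theta> z a b) \<epsilon>\<bar>) ` deriv_index r)"
proof -
  have "\<exists>C. \<forall>p\<in>{z} \<times> cball 0 r. \<bar>(\<lambda>(z, \<epsilon>). mi_deriv \<nu> (loglik \<phi> f \<theta> z a b) \<epsilon>) p\<bar> \<le> C"
    if "mi_size \<nu> \<le> q" for \<nu> a b
    by (intro compact_bound compact_Times loglik_deriv_continuous that) auto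
  then obtain c where c: "\<And>\<nu> a b p. mi_size \<nu> \<le> q \<Longrightarrow> p \<in> {z} \<times> cball 0 r \<Longrightarrow>
      \<bar>(\<lambda>(z, \<epsilon>). mi_deriv \<nu> (loglik \<phi> f \<theta> z a b) \<epsilon>) p\<bar> \<le> c \<nu> a b"
    by metis
  let ?I = "{\<nu> :: 'p \<Rightarrow> nat. mi_size \<nu> \<le> q} \<times> (UNIV :: 'h set) \<times> (UNIV :: 'h set)"
  have fin: "finite ?I" by (intro finite_cartesian_product finite_mi_size_le finite)
  show ?thesis
  proof (rule bdd_aboveI2)
    fix i assume "i \<in> deriv_index r"
    then obtain \<nu> \<epsilon> a b where i: "i = (\<nu>, \<epsilon>, a, b)" "mi_size \<nu> \<le> q" "norm \<epsilon> \<le> r" by auto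
    have "\<bar>mi_deriv \<nu> (loglik \<phi> f \<theta> z a b) \<epsilon>\<bar> \<le> c \<nu> a b"
      using c[OF i(2), of "(z, \<epsilon>)" a b] i(3) by simp
    also have "\<dots> \<le> (\<Sum>(\<nu>, a, b)\<in>?I. \<bar>c \<nu> a b\<bar>)"
      using member_le_sum[of "(\<nu>, a, b)" ?I "\<lambda>(\<nu>, a, b). \<bar>c \<nu> a b\<bar>"] fin i(2) by auto
    finally show "(case i of (\<nu>, \<epsilon>, a, b) \<Rightarrow> \<bar>mi_deriv \<nu> (loglik \<phi> f \<theta> z a b) \<epsilon>\<bar>) \<le> (\<Sum>(\<nu>, a, b)\<in>?I. \<bar>c \<nu> a b\<bar>)"
      by (simp add: i(1))
  qed
qed

lemma deriv_le_sup:
  assumes "1 \<le> mi_size \<nu>" "mi_size \<nu> \<le> q" "norm \<epsilon> \<le> r"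
  shows "\<bar>mi_deriv \<nu> (loglik \<phi> f \<theta> z a b) \<epsilon>\<bar> \<le> loglik_deriv_sup \<phi> f \<theta> q z r"
proof -
  have "q > 0" using assms by simp
  then show ?thesis unfolding deriv_sup_eq[OF \<open>q > 0\<close>]
    using cSUP_upper[OF _ deriv_sup_bdd[of z r], of "(\<nu>, \<epsilon>, a, b)"] assms by simp
qed

text \<open>
  A supremum of continuous functions is lower semicontinuous, even over an uncountable index set. The tail condition
  on \<open>M\<^sub>q\<close> depends on measurability, because \<open>measure\<close> is 0 on non-measurable sets by convention.
\<close>

lemma deriv_sup_measurable:
  assumes "r > 0"
  shows "(\<lambda>z. loglik_deriv_sup \<phi> f \<theta> q z r) \<in> borel_measurable borel"
proof (cases "q = 0")
  case True
  then show ?thesis by (simp add: loglik_deriv_sup_def)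
next
  case False
  then have q: "q > 0" by simp
  have ne: "deriv_index r \<noteq> {}"
  proof -
    obtain i :: 'p where True by blast
    have "mi_size (\<lambda>j. if j = i then 1 else 0) = 1" by (simp add: mi_size_def)
    then have "((\<lambda>j. if j = i then 1 else 0), 0, undefined, undefined) \<in> deriv_index r"
      using q assms by auto
    then show ?thesis by blast
  qed
  have "open {z. u < loglik_deriv_sup \<phi> f \<theta> q z r}" for u
  proof -
    have "{z. u < loglik_deriv_sup \<phi> f \<theta> q z r} =
       (\<Union>(\<nu>, \<epsilon>, a, b)\<in>deriv_index r. {z. u < \<bar>mi_deriv \<nu> (loglik \<phi> f \<theta> z a b) \<epsilon>\<bar>})"
      unfolding deriv_sup_eq[OF q]
      using less_cSUP_iff[OF ne deriv_sup_bdd] by (auto simp: case_prod_unfold) blast+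
    moreover have "open {z. u < \<bar>mi_deriv \<nu> (loglik \<phi> f \<theta> z a b) \<epsilon>\<bar>}" if "mi_size \<nu> \<le> q" for \<nu> \<epsilon> a b
    proof -
      have "continuous_on UNIV ((\<lambda>(z, \<epsilon>). mi_deriv \<nu> (loglik \<phi> f \<theta> z a b) \<epsilon>) \<circ> (\<lambda>z. (z, \<epsilon>)))"
        by (intro continuous_on_compose continuous_intros)
          (rule continuous_on_subset[OF loglik_deriv_continuous(2)[OF that]], simp)
      then have "continuous_on UNIV (\<lambda>z. \<bar>mi_deriv \<nu> (loglik \<phi> f \<theta> z a b) \<epsilon>\<bar>)"
        by (intro continuous_intros) (simp add: o_def)
      then show ?thesis by (intro open_Collect_less continuous_on_const)
    qed
    ultimately show ?thesis by auto
  qed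
  then show ?thesis by (intro borel_measurable_iff_greater[THEN iffD2]) auto
qed

text \<open>
  The likelihood is the exponential of its logarithm, of which only the derivatives are controlled.
\<close>

lemma jet_bound_lik:
  assumes L: "sorted (rev L)" "length L \<le> q" and x: "norm x \<le> r"
  shows "jet_bound x L (lik \<phi> f \<theta> z a b) (lik \<phi> f \<theta> z a b x)
     (2 ^ q * max 1 (loglik_deriv_sup \<phi> f \<theta> q z r))"
proof -
  let ?m = "max 1 (loglik_deriv_sup \<phi> f \<theta> q z r)"
  have "deriv_bound x L (loglik \<phi> f \<theta> z a b) ?m"
  proof (rule deriv_boundI)
    fix L' assume sub: "subseq L' L"
    define \<nu> where "\<nu> = count (mset (rev L'))"
    have eq: "rev L' = mi_list \<nu>" unfolding \<nu>_def
      by (rule sorted_eq_mi_list[OF sorted_rev_subseq[OF sub L(1)]])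
    have sz: "mi_size \<nu> = length L'" using mi_list_properties(2)[of \<nu>] unfolding eq[symmetric] by simp
    then have \<nu>: "mi_size \<nu> \<le> q" using list_emb_length[OF sub] L(2) by simp
    show "partial_derivs_exist (rev L') (loglik \<phi> f \<theta> z a b)"
      unfolding eq by (rule loglik_deriv_continuous(1)[OF \<nu>])
    assume "L' \<noteq> []"
    then have "1 \<le> mi_size \<nu>" unfolding sz by (cases L') auto
    from deriv_le_sup[OF this \<nu> x, of z a b]
    show "\<bar>partial_derivs (rev L') (loglik \<phi> f \<theta> z a b) x\<bar> \<le> ?m"
      unfolding eq mi_deriv_def[symmetric] by simp
  qed
  moreover have "2 ^ length L * ?m \<le> 2 ^ q * ?m"
    using L(2) by (intro mult_right_mono power_increasing) auto
  ultimately have "jet_bound x L (\<lambda>x. exp (loglik \<phi> f \<theta> z a b x)) (exp (loglik \<phi> f \<theta> z a b x)) (2 ^ q * ?m)"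
    by (intro jet_bound_exp) auto
  moreover have "(\<lambda>x. exp (loglik \<phi> f \<theta> z a b x)) = lik \<phi> f \<theta> z a b"
    by (simp add: fun_eq_iff loglik_def lik_pos)
  ultimately show ?thesis by (simp add: fun_eq_iff)
qed

end

section \<open>Almost sure bounds for independent sequences\<close>

text \<open>
  The number of hits up to time \<open>N\<close>, weighted exponentially, has expectation at most \<open>2\<^sup>N\<close>, whereas more than
  \<open>N/k\<close> hits make the weight at least \<open>4\<^sup>N\<close>. By the Markov inequality this has probability at most \<open>2\<^sup>-\<^sup>N\<close>, and the
  Borel-Cantelli lemma applies.
\<close>

lemma (in prob_space) AE_count_le:
  fixes Z :: "int \<Rightarrow> 'a \<Rightarrow> 'z::topological_space"
  assumes indep: "indep_vars (\<lambda>_. borel) Z UNIV" and B: "B \<in> sets borel"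
    and small: "\<And>s. prob {\<omega> \<in> space M. Z s \<omega> \<in> B} * 4 ^ k \<le> 1"
    and inj: "inj \<iota>"
  shows "AE \<omega> in M. \<exists>n0. \<forall>N\<ge>n0. card ({j. Z (\<iota> j) \<omega> \<in> B} \<inter> {0<..N}) * k \<le> N"
proof -
  have Z[measurable]: "random_variable borel (Z s)" for s
    using indep by (auto simp: indep_vars_def2)
  note B[measurable]
  define A :: real where "A = 4 ^ k"
  have A: "A \<ge> 1" unfolding A_def by simp
  define F where "F s \<omega> = ennreal (if Z s \<omega> \<in> B then A else 1)" for s \<omega>
  have F_meas[measurable]: "F s \<in> borel_measurable M" for s unfolding F_def by measurable
  have F_int: "(\<integral>\<^sup>+\<omega>. F s \<omega> \<partial>M) \<le> 2" for s
  proof -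
    have E: "{\<omega> \<in> space M. Z s \<omega> \<in> B} \<in> events" by measurable
    have "(\<integral>\<^sup>+\<omega>. F s \<omega> \<partial>M) \<le> (\<integral>\<^sup>+\<omega>. 1 + ennreal A * indicator {\<omega> \<in> space M. Z s \<omega> \<in> B} \<omega> \<partial>M)"
      using A by (intro nn_integral_mono) (auto simp: F_def indicator_def)
    also have "\<dots> = 1 + ennreal A * emeasure M {\<omega> \<in> space M. Z s \<omega> \<in> B}"
      using E by (subst nn_integral_add) (auto simp: nn_integral_cmult_indicator emeasure_space_1)
    also have "\<dots> = 1 + ennreal (A * prob {\<omega> \<in> space M. Z s \<omega> \<in> B})"
      using A by (simp add: emeasure_eq_measure ennreal_mult)
    also have "\<dots> \<le> 1 + ennreal 1"
      using small[of s] by (intro add_left_mono ennreal_leI) (simp add: A_def mult.commute)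
    finally show ?thesis by (simp add: one_add_one)
  qed
  define c where "c N \<omega> = card ({j. Z (\<iota> j) \<omega> \<in> B} \<inter> {0<..N})" for N \<omega>
  have prod_eq: "(\<Prod>j\<in>{0<..N}. F (\<iota> j) \<omega>) = ennreal (A ^ c N \<omega>)" for N \<omega>
  proof -
    have "(\<Prod>j\<in>{0<..N}. F (\<iota> j) \<omega>) = ennreal (\<Prod>j\<in>{0<..N}. if Z (\<iota> j) \<omega> \<in> B then A else 1)"
      unfolding F_def using A by (intro prod_ennreal) auto
    also have "(\<Prod>j\<in>{0<..N}. if Z (\<iota> j) \<omega> \<in> B then A else 1) =
        (\<Prod>j\<in>{0<..N} \<inter> {j. Z (\<iota> j) \<omega> \<in> B}. A) * (\<Prod>j\<in>{0<..N} \<inter> - {j. Z (\<iota> j) \<omega> \<in> B}. 1)"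
      by (rule prod.If_cases) simp
    also have "\<dots> = A ^ c N \<omega>"
      unfolding c_def by (simp only: prod_constant power_one mult_1_right Int_commute)
    finally show ?thesis .
  qed
  define E where "E N = {\<omega> \<in> space M. 1 \<le> ennreal (1 / 4 ^ N) * (\<Prod>j\<in>{0<..N}. F (\<iota> j) \<omega>)}" for N
  have E_meas[measurable]: "E N \<in> events" for N unfolding E_def by measurable
  have "emeasure M (E N) \<le> ennreal ((1 / 2) ^ N)" for N
  proof -
    have "indep_vars (\<lambda>_. borel) (\<lambda>s \<omega>. (\<lambda>z. ennreal (if z \<in> B then A else 1)) (Z s \<omega>)) (\<iota> ` {0<..N})"
      by (rule indep_vars_compose2[OF indep_vars_subset[OF indep]]) auto
    then have ind: "indep_vars (\<lambda>_. borel) F (\<iota> ` {0<..N})" unfolding F_def[abs_def] by simp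
    have inj': "inj_on \<iota> {0<..N}" using inj by (rule inj_on_subset) simp
    have "emeasure M (E N) \<le> ennreal (1 / 4 ^ N) * (\<integral>\<^sup>+\<omega>. (\<Prod>j\<in>{0<..N}. F (\<iota> j) \<omega>) * indicator (space M) \<omega> \<partial>M)"
      unfolding E_def by (rule nn_integral_Markov_inequality) auto
    also have "(\<integral>\<^sup>+\<omega>. (\<Prod>j\<in>{0<..N}. F (\<iota> j) \<omega>) * indicator (space M) \<omega> \<partial>M) = (\<integral>\<^sup>+\<omega>. (\<Prod>s\<in>\<iota> ` {0<..N}. F s \<omega>) \<partial>M)"
      by (intro nn_integral_cong) (simp add: prod.reindex[OF inj'])
    also have "\<dots> = (\<Prod>s\<in>\<iota> ` {0<..N}. \<integral>\<^sup>+\<omega>. F s \<omega> \<partial>M)"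
      by (rule indep_vars_nn_integral[OF _ ind]) auto
    also have "\<dots> \<le> 2 ^ card (\<iota> ` {0<..N})"
    proof -
      have "(\<Prod>s\<in>J. \<integral>\<^sup>+\<omega>. F s \<omega> \<partial>M) \<le> 2 ^ card J" if "finite J" for J
        using that by induction (auto intro!: mult_mono F_int)
      then show ?thesis by simp
    qed
    also have "\<dots> = ennreal (2 ^ N)"
      by (simp add: card_image[OF inj'] ennreal_power[symmetric])
    also have "ennreal (1 / 4 ^ N) * ennreal (2 ^ N) = ennreal ((1 / 2) ^ N)"
      by (subst ennreal_mult[symmetric]) (auto simp: power_divide[symmetric] field_simps power_mult_distrib[symmetric])
    finally show ?thesis by (simp add: mult_left_mono)
  qed
  then have "prob (E N) \<le> (1 / 2) ^ N" for N
    by (simp add: emeasure_eq_measure)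
  then have "summable (\<lambda>N. prob (E N))"
    by (intro summable_comparison_test[of "\<lambda>N. prob (E N)" "\<lambda>N. (1 / 2) ^ N"] exI[of _ 0]) auto
  then have "AE \<omega> in M. eventually (\<lambda>N. \<omega> \<in> space M - E N) sequentially"
    by (intro borel_cantelli_AE1) (auto simp: emeasure_eq_measure)
  then show ?thesis
  proof (eventually_elim)
    case (elim \<omega>)
    then obtain n0 where n0: "\<And>N. N \<ge> n0 \<Longrightarrow> \<omega> \<in> space M - E N" by (auto simp: eventually_sequentially)
    have "c N \<omega> * k \<le> N" if "N \<ge> n0" for N
    proof (rule ccontr)
      assume "\<not> c N \<omega> * k \<le> N"
      then have "(4::real) ^ N \<le> 4 ^ (k * c N \<omega>)" by (intro power_increasing) (auto simp: mult.commute)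
      then have "4 ^ N \<le> A ^ c N \<omega>" by (simp add: A_def power_mult)
      then have "1 \<le> 1 / 4 ^ N * A ^ c N \<omega>" by (simp add: field_simps)
      then have "ennreal 1 \<le> ennreal (1 / 4 ^ N * A ^ c N \<omega>)" by (rule ennreal_leI)
      also have "\<dots> = ennreal (1 / 4 ^ N) * ennreal (A ^ c N \<omega>)" using A by (intro ennreal_mult) auto
      finally have "\<omega> \<in> E N" using n0[OF that] unfolding E_def prod_eq by simp
      then show False using n0[OF that] by blast
    qed
    then show ?case unfolding c_def by blast
  qed
qed

text \<open>
  At \<open>u = b\<^sup>j\<close> the tail is of order \<open>j\<^sup>-\<^sup>c\<close>, which is summable.
\<close>

lemma (in prob_space) AE_subexponential:
  fixes m :: "'z::topological_space \<Rightarrow> real"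
  assumes Z: "\<And>s. random_variable borel (Z s)"
    and distr: "\<And>s. distr M borel (Z s) = distr M borel (Z (0 :: int))"
    and m[measurable]: "m \<in> borel_measurable borel"
    and tail: "(\<lambda>u. prob {\<omega> \<in> space M. m (Z 0 \<omega>) \<ge> u}) \<in> O[at_top](\<lambda>u. ln u powr (- c))" "c > 1"
    and b: "b > 1"
  shows "AE \<omega> in M. \<exists>A. \<forall>j :: nat. m (Z (\<iota> j) \<omega>) \<le> A * b ^ j"
proof -
  note Z[measurable]
  define E where "E j = {\<omega> \<in> space M. m (Z (\<iota> j) \<omega>) \<ge> b ^ j}" for j :: nat
  have E_meas[measurable]: "E j \<in> events" for j unfolding E_def by measurable
  have prob_E: "prob (E j) = prob {\<omega> \<in> space M. m (Z 0 \<omega>) \<ge> b ^ j}" for j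
  proof -
    have S: "{z. m z \<ge> b ^ j} \<in> sets borel" by measurable
    have "prob {\<omega> \<in> space M. m (Z s \<omega>) \<ge> b ^ j} = measure (distr M borel (Z s)) {z. m z \<ge> b ^ j}" for s
      using S by (subst measure_distr) (auto simp: vimage_def Int_def conj_commute)
    then show ?thesis unfolding E_def by (metis distr)
  qed
  obtain K where K: "\<forall>\<^sub>F u in at_top. norm (prob {\<omega> \<in> space M. m (Z 0 \<omega>) \<ge> u}) \<le> K * norm (ln u powr (- c))"
    using tail(1) by (auto simp: bigo_def)
  have "filterlim (\<lambda>j. b ^ j) at_top sequentially"
    using b by (intro filterlim_at_infinity_imp_filterlim_at_top filterlim_realpow_sequentially_gt1) auto
  then have ev: "\<forall>\<^sub>F j in sequentially. prob (E j) \<le> K * ln (b ^ j) powr (- c)"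
    using eventually_compose_filterlim[OF K] by (simp add: prob_E)
  have "summable (\<lambda>j. real j powr (- c))" using tail(2) by (simp add: summable_real_powr_iff)
  then have "summable (\<lambda>j. K * ln b powr (- c) * real j powr (- c))" by (rule summable_mult)
  moreover have "K * ln (b ^ j) powr (- c) = K * ln b powr (- c) * real j powr (- c)" for j
    using b by (simp add: ln_realpow powr_mult)
  ultimately have "summable (\<lambda>j. K * ln (b ^ j) powr (- c))" by (simp only:)
  then have "summable (\<lambda>j. prob (E j))"
    by (rule summable_comparison_test_ev[rotated]) (use ev in simp)
  then have "AE \<omega> in M. eventually (\<lambda>j. \<omega> \<in> space M - E j) sequentially"
    by (intro borel_cantelli_AE1) (auto simp: emeasure_eq_measure)
  then show ?thesis
  proof eventually_elim
    case (elim \<omega>)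
    then obtain n0 where n0: "\<And>j. j \<ge> n0 \<Longrightarrow> \<omega> \<in> space M - E j" by (auto simp: eventually_sequentially)
    define A where "A = 1 + (\<Sum>j<n0. \<bar>m (Z (\<iota> j) \<omega>)\<bar>)"
    have A1: "A \<ge> 1" unfolding A_def by (simp add: sum_nonneg)
    have "m (Z (\<iota> j) \<omega>) \<le> A * b ^ j" for j
    proof (cases "j < n0")
      case True
      have "m (Z (\<iota> j) \<omega>) \<le> (\<Sum>j<n0. \<bar>m (Z (\<iota> j) \<omega>)\<bar>)"
        using member_le_sum[of j "{..<n0}" "\<lambda>j. \<bar>m (Z (\<iota> j) \<omega>)\<bar>"] True by simp
      also have "\<dots> \<le> A * 1" by (simp add: A_def)
      also have "\<dots> \<le> A * b ^ j" using A1 b by (intro mult_left_mono) auto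
      finally show ?thesis .
    next
      case False
      then have "m (Z (\<iota> j) \<omega>) < b ^ j" using n0[of j] unfolding E_def by auto
      also have "\<dots> \<le> A * b ^ j" using mult_right_mono[OF A1, of "b ^ j"] b by simp
      finally show ?thesis by simp
    qed
    then show ?case by blast
  qed
qed

lemma (in prob_space) tight:
  fixes Y :: "'a \<Rightarrow> 'z::euclidean_space"
  assumes [measurable]: "random_variable borel Y" and "\<delta> > 0"
  shows "\<exists>B. prob {\<omega> \<in> space M. norm (Y \<omega>) > B} \<le> \<delta>"
proof -
  let ?A = "\<lambda>n :: nat. {\<omega> \<in> space M. norm (Y \<omega>) > real n}"
  have "(\<lambda>n. prob (?A n)) \<longlonglongrightarrow> prob (\<Inter>n. ?A n)"
    by (intro finite_Lim_measure_decseq) (auto simp: decseq_def)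
  moreover have "(\<Inter>n. ?A n) = {}"
  proof -
    have "\<exists>n. \<not> norm (Y \<omega>) > real n" for \<omega> using real_arch_simple[of "norm (Y \<omega>)"] by (auto simp: not_less)
    then show ?thesis by auto
  qed
  ultimately have "(\<lambda>n. prob (?A n)) \<longlonglongrightarrow> 0" by simp
  then have "\<forall>\<^sub>F n in sequentially. prob (?A n) < \<delta>" using assms(2) by (rule order_tendstoD(2))
  then obtain n where "prob (?A n) < \<delta>" by (auto simp: eventually_sequentially)
  then show ?thesis by (intro exI[of _ "real n"]) simp
qed

section \<open>Quotients of sums of products of stable families\<close>

definition tame :: "real ^ 'p::finite \<Rightarrow> 'p list \<Rightarrow> real \<Rightarrow> real \<Rightarrow> (real ^ 'p \<Rightarrow> real) \<Rightarrow> bool" where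
  "tame x L \<rho> D h \<longleftrightarrow> (\<forall>y. h y > 0) \<and> \<rho> \<le> h x \<and> jet_bound x L h D 1"

text \<open>
  Geometric convergence of the jets, expressed without limits, together with bounds away from zero
  and infinity that allow for division.
\<close>

definition stable_family :: "'p::finite list \<Rightarrow> (real ^ 'p) set \<Rightarrow> real \<Rightarrow> (nat \<Rightarrow> 'h \<Rightarrow> real ^ 'p \<Rightarrow> real) \<Rightarrow> bool" where
  "stable_family L X r h \<longleftrightarrow> (\<exists>D N0. \<exists>\<rho>>0. 0 < D \<and> (\<forall>x\<in>X. \<forall>a. \<forall>N\<ge>N0. tame x L \<rho> D (h N a) \<and>
     (\<forall>N'\<ge>N. jet_bound x L (\<lambda>x. h N' a x - h N a x) (D * r ^ N) 1)))"

lemma stable_familyE: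
  assumes "stable_family L X r h"
  obtains D N0 \<rho> where "\<rho> > 0" "0 < D"
    "\<And>x a N. x \<in> X \<Longrightarrow> N \<ge> N0 \<Longrightarrow> tame x L \<rho> D (h N a)"
    "\<And>x a N N'. x \<in> X \<Longrightarrow> N \<ge> N0 \<Longrightarrow> N' \<ge> N \<Longrightarrow> jet_bound x L (\<lambda>x. h N' a x - h N a x) (D * r ^ N) 1"
  using assms unfolding stable_family_def by blast

definition triple_sum :: "'h set \<Rightarrow> ('h \<Rightarrow> 'e \<Rightarrow> real) \<Rightarrow> ('h \<Rightarrow> 'e \<Rightarrow> real) \<Rightarrow> ('h \<Rightarrow> 'e \<Rightarrow> real) \<Rightarrow> 'e \<Rightarrow> real" where
  "triple_sum A w F B x = (\<Sum>a\<in>A. w a x * (F a x * B a x))"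

lemma triple_sum_tame:
  fixes A :: "'h::finite set" and D \<rho> :: real
  assumes "A \<noteq> {}" "\<rho> > 0" and t: "\<And>a. tame x L \<rho> D (w a)" "\<And>a. tame x L \<rho> D (F a)" "\<And>a. tame x L \<rho> D (B a)"
  shows "tame x L (\<rho> ^ 3) (card (UNIV :: 'h set) * D ^ 3 * 3 ^ length L) (triple_sum A w F B)"
proof -
  have pos: "w a y > 0" "F a y > 0" "B a y > 0" for a y using t by (auto simp: tame_def)
  have lo: "\<rho> \<le> w a x" "\<rho> \<le> F a x" "\<rho> \<le> B a x" for a using t by (auto simp: tame_def)
  have j: "jet_bound x L (w a) D 1" "jet_bound x L (F a) D 1" "jet_bound x L (B a) D 1" for a
    using t by (auto simp: tame_def)
  have D: "D > 0"
    using jet_bound_value[OF j(1)[of undefined]] pos(1)[of undefined x] by linarith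
  have "jet_bound x L (triple_sum A w F B) (\<Sum>a\<in>A. D * (D * D)) (1 + (1 + 1))"
    unfolding triple_sum_def[abs_def] by (intro jet_bound_sum jet_bound_mult j) auto
  then have "jet_bound x L (triple_sum A w F B) (card (UNIV :: 'h set) * D ^ 3) (3 * 1)"
  proof (rule jet_bound_mono)
    have "real (card A) \<le> real (card (UNIV :: 'h set))" by (simp add: card_mono)
    then have "real (card A) * D ^ 3 \<le> real (card (UNIV :: 'h set)) * D ^ 3"
      using D by (intro mult_right_mono) auto
    then show "(\<Sum>a\<in>A. D * (D * D)) \<le> card (UNIV :: 'h set) * D ^ 3"
      by (simp add: power3_eq_cube)
  qed auto
  then have "jet_bound x L (triple_sum A w F B) (card (UNIV :: 'h set) * D ^ 3 * 3 ^ length L) 1"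
    by (rule jet_bound_rescale) auto
  moreover have "triple_sum A w F B y > 0" for y
    unfolding triple_sum_def using assms(1) pos by (intro sum_pos) auto
  moreover have "\<rho> ^ 3 \<le> triple_sum A w F B x"
  proof -
    obtain a where a: "a \<in> A" using assms(1) by blast
    have "\<rho> * (\<rho> * \<rho>) \<le> w a x * (F a x * B a x)"
      by (intro mult_mono lo mult_nonneg_nonneg less_imp_le[OF assms(2)] less_imp_le[OF pos(1)] less_imp_le[OF pos(2)])
    also have "\<dots> \<le> triple_sum A w F B x"
      unfolding triple_sum_def
      by (rule member_le_sum[OF a]) (simp_all add: pos less_imp_le)
    finally show ?thesis by (simp add: power3_eq_cube mult.assoc)
  qed
  ultimately show ?thesis by (simp add: tame_def)
qed

text \<open>
  Changing one factor after the other, \<open>F'B' - FB = (F' - F)B' + F(B' - B)\<close>, makes the errors of the two families add up.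
\<close>

lemma triple_sum_diff:
  fixes A :: "'h::finite set" and D e1 e2 :: real
  assumes t: "\<And>a. jet_bound x L (w a) D 1" "\<And>a. jet_bound x L (F a) D 1" "\<And>a. jet_bound x L (B' a) D 1"
    and d: "\<And>a. jet_bound x L (\<lambda>x. F' a x - F a x) (D * e1) 1" "\<And>a. jet_bound x L (\<lambda>x. B' a x - B a x) (D * e2) 1"
    and "D > 0" "e1 \<ge> 0" "e2 \<ge> 0"
  shows "jet_bound x L (\<lambda>x. triple_sum A w F' B' x - triple_sum A w F B x)
    (card (UNIV :: 'h set) * D ^ 3 * 3 ^ length L * (e1 + e2)) 1"
proof -
  have eq: "triple_sum A w F' B' x - triple_sum A w F B x =
      (\<Sum>a\<in>A. w a x * ((F' a x - F a x) * B' a x + F a x * (B' a x - B a x)))" for x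
    unfolding triple_sum_def sum_subtractf[symmetric] by (intro sum.cong refl) (simp add: algebra_simps)
  have "jet_bound x L (\<lambda>x. triple_sum A w F' B' x - triple_sum A w F B x)
      (\<Sum>a\<in>A. D * (D * e1 * D + D * (D * e2))) (1 + (1 + 1))"
    unfolding eq by (intro jet_bound_sum jet_bound_mult jet_bound_add t d) auto
  then have "jet_bound x L (\<lambda>x. triple_sum A w F' B' x - triple_sum A w F B x)
      (card (UNIV :: 'h set) * D ^ 3 * (e1 + e2)) (3 * 1)"
  proof (rule jet_bound_mono)
    have "(\<Sum>a\<in>A. D * (D * e1 * D + D * (D * e2))) = card A * (D ^ 3 * (e1 + e2))"
      by (simp add: power3_eq_cube algebra_simps)
    also have "\<dots> \<le> card (UNIV :: 'h set) * (D ^ 3 * (e1 + e2))"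
      using assms(6-8) by (intro mult_right_mono) (simp_all add: card_mono)
    finally show "(\<Sum>a\<in>A. D * (D * e1 * D + D * (D * e2))) \<le> card (UNIV :: 'h set) * D ^ 3 * (e1 + e2)"
      by (simp add: mult.assoc)
  qed auto
  then have "jet_bound x L (\<lambda>x. triple_sum A w F' B' x - triple_sum A w F B x)
      (card (UNIV :: 'h set) * D ^ 3 * (e1 + e2) * 3 ^ length L) 1"
    by (rule jet_bound_rescale) auto
  then show ?thesis by (simp add: mult_ac)
qed

lemma inverse_jet_bound:
  assumes "tame x L c P h" "c > 0"
  shows "jet_bound x L (\<lambda>x. inverse (h x)) (1 / c * (3 ^ length L * max 1 (P / c)) ^ length L) 1"
proof -
  define K where "K = max 1 (P / c)"
  have h: "c \<le> h x" "jet_bound x L h P 1" "\<And>y. h y > 0" using assms(1) by (auto simp: tame_def)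
  have P: "P > 0" using jet_bound_value[OF h(2)] h(3)[of x] by linarith
  have "jet_bound x L h (h x) (K * 1)"
  proof (rule jet_bound_sharpen[OF h(2)])
    have "P = P / c * c" using assms(2) by simp
    also have "\<dots> \<le> K * h x" unfolding K_def using h(1) assms(2) P by (intro mult_mono) auto
    finally show "P \<le> K * h x" .
  qed (use h(3)[of x] in \<open>auto simp: K_def\<close>)
  then have "jet_bound x L (\<lambda>x. inverse (h x)) (inverse (h x)) (3 ^ length L * (K * 1))"
    by (intro jet_bound_inverse h) (auto simp: K_def)
  then have "jet_bound x L (\<lambda>x. inverse (h x)) (1 / c) ((3 ^ length L * K) * 1)"
    by (rule jet_bound_mono) (use h(1) assms(2) in \<open>auto simp: K_def field_simps\<close>)
  moreover have "1 \<le> 3 ^ length L * K" using mult_mono[of 1 "3 ^ length L" 1 K] by (simp add: K_def)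
  ultimately show ?thesis unfolding K_def[symmetric] by (rule jet_bound_rescale) auto
qed

text \<open>
  The errors of numerator and denominator stay additive in the quotient, since the reciprocals of the
  denominators have bounded jets. The constants depend on the common bounds \<open>\<rho>\<close> and \<open>D\<close> only, not on the point
  or on the functions.
\<close>

lemma ratio_jets:
  fixes H0 H1 :: "'h::finite set" and D \<rho> :: real and L :: "'p::finite list"
  assumes H: "H0 \<noteq> {}" "H1 \<noteq> {}" and \<rho>: "\<rho> > 0" and D: "D > 0"
  shows "\<exists>C>0. \<exists>c>0. \<forall>x w F F' B B' e1 e2.
    (\<forall>a. tame x L \<rho> D (w a) \<and> tame x L \<rho> D (F a) \<and> tame x L \<rho> D (F' a) \<and>
       tame x L \<rho> D (B a) \<and> tame x L \<rho> D (B' a) \<and>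
       jet_bound x L (\<lambda>x. F' a x - F a x) (D * e1) 1 \<and> jet_bound x L (\<lambda>x. B' a x - B a x) (D * e2) 1) \<and>
    e1 \<ge> 0 \<and> e2 \<ge> 0 \<longrightarrow>
    c \<le> triple_sum H1 w F B x / triple_sum H0 w F B x \<and>
    jet_bound x L (\<lambda>x. triple_sum H1 w F' B' x / triple_sum H0 w F' B' x -
       triple_sum H1 w F B x / triple_sum H0 w F B x) (C * (e1 + e2)) 1"
proof -
  define P where "P = card (UNIV :: 'h set) * D ^ 3 * 3 ^ length L"
  have P: "P > 0" unfolding P_def using D by (auto simp: card_gt_0_iff)
  define c0 where "c0 = \<rho> ^ 3"
  have c0: "c0 > 0" using \<rho> by (simp add: c0_def)
  define Q where "Q = 1 / c0 * (3 ^ length L * max 1 (P / c0)) ^ length L"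
  have Q: "Q > 0" unfolding Q_def using c0 by auto
  define C where "C = (P * Q + P * (P * (Q * Q))) * 4 ^ length L"
  have C: "C > 0" unfolding C_def using P Q by (simp add: add_pos_pos)
  have frac: "a / b - c / d = (a - c) * inverse b + c * (((-1) * (b - d)) * (inverse d * inverse b))"
    if "b > 0" "d > 0" for a b c d :: real
    using that by (simp add: field_simps)
  have main: "c0 / P \<le> triple_sum H1 w F B x / triple_sum H0 w F B x \<and>
    jet_bound x L (\<lambda>x. triple_sum H1 w F' B' x / triple_sum H0 w F' B' x -
       triple_sum H1 w F B x / triple_sum H0 w F B x) (C * (e1 + e2)) 1"
    if t: "\<And>a. tame x L \<rho> D (w a)" "\<And>a. tame x L \<rho> D (F a)" "\<And>a. tame x L \<rho> D (F' a)"
       "\<And>a. tame x L \<rho> D (B a)" "\<And>a. tame x L \<rho> D (B' a)"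
      and d: "\<And>a. jet_bound x L (\<lambda>x. F' a x - F a x) (D * e1) 1" "\<And>a. jet_bound x L (\<lambda>x. B' a x - B a x) (D * e2) 1"
      and e: "e1 \<ge> 0" "e2 \<ge> 0" for x w F F' B B' e1 e2
  proof
    let ?W = "\<lambda>A. triple_sum A w F B" and ?W' = "\<lambda>A. triple_sum A w F' B'"
    have T: "tame x L c0 P (?W A)" "tame x L c0 P (?W' A)" if "A \<noteq> {}" for A :: "'h set"
      unfolding c0_def P_def by (intro triple_sum_tame that \<rho> t)+
    have pos: "?W A y > 0" "?W' A y > 0" if "A \<noteq> {}" for A y using T[OF that] by (auto simp: tame_def)
    have jW: "jet_bound x L (?W A) P 1" if "A \<noteq> {}" for A using T[OF that] by (simp add: tame_def)
    have I: "jet_bound x L (\<lambda>x. inverse (?W H0 x)) Q 1" "jet_bound x L (\<lambda>x. inverse (?W' H0 x)) Q 1"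
      unfolding Q_def by (intro inverse_jet_bound T H c0)+
    have jt: "jet_bound x L (w a) D 1" "jet_bound x L (F a) D 1" "jet_bound x L (B' a) D 1" for a
      using t by (auto simp: tame_def)
    have diff: "jet_bound x L (\<lambda>x. ?W' A x - ?W A x) (P * (e1 + e2)) 1" for A
      unfolding P_def by (rule triple_sum_diff) (rule jt d D e)+
    have eq: "?W' H1 x / ?W' H0 x - ?W H1 x / ?W H0 x =
        (?W' H1 x - ?W H1 x) * inverse (?W' H0 x) +
        ?W H1 x * (((-1) * (?W' H0 x - ?W H0 x)) * (inverse (?W H0 x) * inverse (?W' H0 x)))" for x
      by (rule frac) (rule pos[OF H(1)])+
    have "jet_bound x L (\<lambda>x. (?W' H1 x - ?W H1 x) * inverse (?W' H0 x)) (P * (e1 + e2) * Q) (1 + 1)"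
      by (intro jet_bound_mult diff I) auto
    then have 1: "jet_bound x L (\<lambda>x. (?W' H1 x - ?W H1 x) * inverse (?W' H0 x)) (P * (e1 + e2) * Q) 4"
      by (rule jet_bound_mono) auto
    have "jet_bound x L (\<lambda>x. ?W H1 x * (((-1) * (?W' H0 x - ?W H0 x)) * (inverse (?W H0 x) * inverse (?W' H0 x))))
        (P * ((\<bar>- 1\<bar> * (P * (e1 + e2))) * (Q * Q))) (1 + (1 + (1 + 1)))"
      by (intro jet_bound_mult jet_bound_cmult diff I jW H) auto
    then have 2: "jet_bound x L (\<lambda>x. ?W H1 x * (((-1) * (?W' H0 x - ?W H0 x)) * (inverse (?W H0 x) * inverse (?W' H0 x))))
        (P * (P * (e1 + e2) * (Q * Q))) 4"
      by (rule jet_bound_mono) auto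
    have "jet_bound x L (\<lambda>x. ?W' H1 x / ?W' H0 x - ?W H1 x / ?W H0 x)
        (P * (e1 + e2) * Q + P * (P * (e1 + e2) * (Q * Q))) (4 * 1)"
      unfolding eq using jet_bound_add[OF 1 2] by simp
    then have "jet_bound x L (\<lambda>x. ?W' H1 x / ?W' H0 x - ?W H1 x / ?W H0 x)
        ((P * (e1 + e2) * Q + P * (P * (e1 + e2) * (Q * Q))) * 4 ^ length L) 1"
      by (rule jet_bound_rescale) auto
    moreover have "(P * (e1 + e2) * Q + P * (P * (e1 + e2) * (Q * Q))) * 4 ^ length L = C * (e1 + e2)"
      unfolding C_def by (simp add: algebra_simps)
    ultimately show "jet_bound x L (\<lambda>x. ?W' H1 x / ?W' H0 x - ?W H1 x / ?W H0 x) (C * (e1 + e2)) 1"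
      by simp
    have "?W H0 x \<le> P" using jet_bound_value[OF jW[OF H(1)]] by simp
    moreover have "c0 \<le> ?W H1 x" using T(1)[OF H(2)] by (simp add: tame_def)
    ultimately show "c0 / P \<le> ?W H1 x / ?W H0 x"
      using c0 pos(1)[OF H(1), of x] by (intro frac_le) auto
  qed
  show ?thesis
  proof (rule exI[of _ C], rule conjI[OF C], rule exI[of _ "c0 / P"], rule conjI[OF divide_pos_pos[OF c0 P]],
      intro allI impI, elim conjE)
    fix x :: "real ^ 'p" and w F F' B B' :: "'h \<Rightarrow> real ^ 'p \<Rightarrow> real" and e1 e2 :: real
    assume e: "0 \<le> e1" "0 \<le> e2"
      and t: "\<forall>a. tame x L \<rho> D (w a) \<and> tame x L \<rho> D (F a) \<and> tame x L \<rho> D (F' a) \<and>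
       tame x L \<rho> D (B a) \<and> tame x L \<rho> D (B' a) \<and>
       jet_bound x L (\<lambda>x. F' a x - F a x) (D * e1) 1 \<and> jet_bound x L (\<lambda>x. B' a x - B a x) (D * e2) 1"
    show "c0 / P \<le> triple_sum H1 w F B x / triple_sum H0 w F B x \<and>
      jet_bound x L (\<lambda>x. triple_sum H1 w F' B' x / triple_sum H0 w F' B' x -
         triple_sum H1 w F B x / triple_sum H0 w F B x) (C * (e1 + e2)) 1"
      using t by (intro main e) simp_all
  qed
qed

section \<open>Double limits with a geometric rate\<close>

text \<open>
  The diagonal is a Cauchy sequence; its limit is compared with an arbitrary entry along the diagonal beyond it.
\<close>

lemma double_limit:
  fixes a :: "nat \<Rightarrow> nat \<Rightarrow> real"
  assumes r: "0 < r" "r < 1"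
    and cauchy: "\<And>m n m' n'. m \<ge> k \<Longrightarrow> n \<ge> k \<Longrightarrow> m' \<ge> m \<Longrightarrow> n' \<ge> n \<Longrightarrow> \<bar>a m' n' - a m n\<bar> \<le> C * (r ^ m + r ^ n)"
  shows "m \<ge> k \<Longrightarrow> n \<ge> k \<Longrightarrow> \<bar>a m n - lim (\<lambda>j. a j j)\<bar> \<le> C * (r ^ m + r ^ n)"
proof -
  have lim0: "(\<lambda>j. C * (r ^ j + r ^ j)) \<longlonglongrightarrow> C * (0 + 0)"
    using r by (intro tendsto_intros LIMSEQ_realpow_zero) auto
  have "Cauchy (\<lambda>j. a j j)"
  proof (rule CauchyI')
    fix e :: real assume "e > 0"
    then have "\<forall>\<^sub>F j in sequentially. C * (r ^ j + r ^ j) < e"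
      using order_tendstoD(2)[OF lim0, of e] by simp
    then obtain j0 where j0: "\<And>j. j \<ge> j0 \<Longrightarrow> C * (r ^ j + r ^ j) < e" by (auto simp: eventually_sequentially)
    show "\<exists>M. \<forall>m\<ge>M. \<forall>n>m. dist (a m m) (a n n) < e"
    proof (intro exI[of _ "max j0 k"] allI impI)
      fix m n assume "max j0 k \<le> m" "m < n"
      then have "\<bar>a n n - a m m\<bar> \<le> C * (r ^ m + r ^ m)" "C * (r ^ m + r ^ m) < e"
        by (intro cauchy j0; simp)+
      then show "dist (a m m) (a n n) < e" by (simp add: dist_real_def abs_minus_commute)
    qed
  qed
  then have conv: "(\<lambda>j. a j j) \<longlonglongrightarrow> lim (\<lambda>j. a j j)"
    by (simp add: Cauchy_convergent_iff convergent_LIMSEQ_iff)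
  assume mn: "m \<ge> k" "n \<ge> k"
  have "(\<lambda>j. \<bar>a m n - a j j\<bar>) \<longlonglongrightarrow> \<bar>a m n - lim (\<lambda>j. a j j)\<bar>"
    by (intro tendsto_intros conv)
  moreover have "\<bar>a m n - a j j\<bar> \<le> C * (r ^ m + r ^ n)" if "j \<ge> max m n" for j
    using cauchy[OF mn, of j j] that by (simp add: abs_minus_commute)
  ultimately show "\<bar>a m n - lim (\<lambda>j. a j j)\<bar> \<le> C * (r ^ m + r ^ n)"
    by (intro LIMSEQ_le_const2 exI[of _ "max m n"]) auto
qed

lemma pow_sum_le_min:
  fixes r :: real
  assumes "0 < r" "r < 1"
  shows "r ^ m + r ^ n \<le> 2 * r ^ min m n"
proof -
  have "r ^ m \<le> r ^ min m n" "r ^ n \<le> r ^ min m n"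
    using assms by (auto intro!: power_decreasing)
  then show ?thesis by linarith
qed

lemma tendsto_if_double_rate:
  fixes a :: "nat \<Rightarrow> nat \<Rightarrow> real"
  assumes r: "0 < r" "r < 1"
    and bd: "\<And>m n. m \<ge> k \<Longrightarrow> n \<ge> k \<Longrightarrow> \<bar>a m n - g\<bar> \<le> C * (r ^ m + r ^ n)"
  shows "((\<lambda>(m, n). a m n) \<longlongrightarrow> g) (sequentially \<times>\<^sub>F sequentially)"
proof (rule tendstoI)
  fix e :: real assume e: "e > 0"
  have "(\<lambda>j. \<bar>C\<bar> * (2 * r ^ j)) \<longlonglongrightarrow> \<bar>C\<bar> * (2 * 0)"
    using r by (intro tendsto_intros LIMSEQ_realpow_zero) auto
  then have "\<forall>\<^sub>F j in sequentially. \<bar>C\<bar> * (2 * r ^ j) < e"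
    using order_tendstoD(2)[of _ "\<bar>C\<bar> * (2 * 0)" _ e] e by simp
  then obtain j0 where j0: "\<And>j. j \<ge> j0 \<Longrightarrow> \<bar>C\<bar> * (2 * r ^ j) < e" by (auto simp: eventually_sequentially)
  have "dist (a m n) g < e" if "m \<ge> max j0 k" "n \<ge> max j0 k" for m n
  proof -
    have "\<bar>a m n - g\<bar> \<le> C * (r ^ m + r ^ n)" using that by (intro bd) auto
    also have "\<dots> \<le> \<bar>C\<bar> * (2 * r ^ min m n)"
      using pow_sum_le_min[OF r] r by (intro mult_mono) auto
    also have "\<dots> < e" using that by (intro j0) auto
    finally show ?thesis by (simp add: dist_real_def)
  qed
  then show "\<forall>\<^sub>F p in sequentially \<times>\<^sub>F sequentially. dist (case p of (m, n) \<Rightarrow> a m n) g < e"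
    unfolding eventually_prod_sequentially by (intro exI[of _ "max j0 k"]) auto
qed

lemma uniform_rate_smallo:
  fixes a :: "nat \<Rightarrow> nat \<Rightarrow> 'e \<Rightarrow> real"
  assumes r: "0 < r" "r < r'" "r' < 1" and X: "X \<noteq> {}"
    and bd: "\<And>x m n. x \<in> X \<Longrightarrow> m \<ge> k \<Longrightarrow> n \<ge> k \<Longrightarrow> \<bar>a m n x - g x\<bar> \<le> C * (r ^ m + r ^ n)"
  shows "\<forall>\<^sub>F (m, n) in sequentially \<times>\<^sub>F sequentially. bdd_above ((\<lambda>x. \<bar>a m n x - g x\<bar>) ` X)"
    and "(\<lambda>(m, n). SUP x\<in>X. \<bar>a m n x - g x\<bar>) \<in> o[sequentially \<times>\<^sub>F sequentially](\<lambda>(m, n). r' ^ min m n)"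
proof -
  have bdd: "bdd_above ((\<lambda>x. \<bar>a m n x - g x\<bar>) ` X)" if "m \<ge> k" "n \<ge> k" for m n
    using bd that by (intro bdd_aboveI2) auto
  then show "\<forall>\<^sub>F (m, n) in sequentially \<times>\<^sub>F sequentially. bdd_above ((\<lambda>x. \<bar>a m n x - g x\<bar>) ` X)"
    unfolding eventually_prod_sequentially by (intro exI[of _ k]) auto
  show "(\<lambda>(m, n). SUP x\<in>X. \<bar>a m n x - g x\<bar>) \<in> o[sequentially \<times>\<^sub>F sequentially](\<lambda>(m, n). r' ^ min m n)"
  proof (rule landau_o.smallI)
    fix c :: real assume c: "c > 0"
    have "(\<lambda>j. \<bar>C\<bar> * (2 * (r / r') ^ j)) \<longlonglongrightarrow> \<bar>C\<bar> * (2 * 0)"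
      using r by (intro tendsto_intros LIMSEQ_realpow_zero) auto
    then have "\<forall>\<^sub>F j in sequentially. \<bar>C\<bar> * (2 * (r / r') ^ j) < c"
      using order_tendstoD(2)[of _ "\<bar>C\<bar> * (2 * 0)" _ c] c by simp
    then obtain j0 where j0: "\<And>j. j \<ge> j0 \<Longrightarrow> \<bar>C\<bar> * (2 * (r / r') ^ j) < c" by (auto simp: eventually_sequentially)
    have "norm (SUP x\<in>X. \<bar>a m n x - g x\<bar>) \<le> c * norm (r' ^ min m n)"
      if mn: "m \<ge> max j0 k" "n \<ge> max j0 k" for m n
    proof -
      have "\<bar>a m n x - g x\<bar> \<le> c * r' ^ min m n" if "x \<in> X" for x
      proof -
        have "\<bar>a m n x - g x\<bar> \<le> C * (r ^ m + r ^ n)" using that mn by (intro bd) auto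
        also have "\<dots> \<le> \<bar>C\<bar> * (2 * r ^ min m n)"
          using pow_sum_le_min[of r m n] r by (intro mult_mono) auto
        also have "\<dots> = \<bar>C\<bar> * (2 * (r / r') ^ min m n) * r' ^ min m n"
          using r by (simp add: power_divide)
        also have "\<dots> \<le> c * r' ^ min m n"
          using j0[of "min m n"] mn r by (intro mult_right_mono) auto
        finally show ?thesis .
      qed
      then have "(SUP x\<in>X. \<bar>a m n x - g x\<bar>) \<le> c * r' ^ min m n" using X by (intro cSUP_least) auto
      moreover have "0 \<le> (SUP x\<in>X. \<bar>a m n x - g x\<bar>)"
      proof -
        obtain x where "x \<in> X" using X by blast
        then have "\<bar>a m n x - g x\<bar> \<le> (SUP x\<in>X. \<bar>a m n x - g x\<bar>)"
          using mn by (intro cSUP_upper bdd) auto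
        then show ?thesis by linarith
      qed
      ultimately show ?thesis using r by simp
    qed
    then show "\<forall>\<^sub>F p in sequentially \<times>\<^sub>F sequentially.
        norm (case p of (m, n) \<Rightarrow> SUP x\<in>X. \<bar>a m n x - g x\<bar>) \<le> c * norm (case p of (m, n) \<Rightarrow> r' ^ min m n)"
      unfolding eventually_prod_sequentially by (intro exI[of _ "max j0 k"]) auto
  qed
qed

section \<open>The likelihood ratio of the model\<close>

lemma tame_mono: "tame x L \<rho> D h \<Longrightarrow> \<rho>' \<le> \<rho> \<Longrightarrow> D \<le> D' \<Longrightarrow> tame x L \<rho>' D' h"
  unfolding tame_def by (meson jet_bound_mono order_refl order_trans zero_le_one)

lemma path_sum_at_point: "path_sum K g h i N a x = path_sum K (\<lambda>j c _. g j c x) (\<lambda>c _. h c x) i N a y"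
  by (induction N arbitrary: i a) simp_all

lemma transit_shift: "transit K (\<lambda>_ _ _. 1) i N a b x = transit (\<lambda>j. K (i + j)) (\<lambda>_ _ _. 1) 0 N a b x"
proof (induction i arbitrary: K)
  case (Suc i)
  have "transit K (\<lambda>_ _ _. 1) (Suc i) N a b x = transit (\<lambda>j. K (Suc j)) (\<lambda>_ _ _. 1) i N a b x"
    unfolding transit_def by (rule path_sum_shift)
  also have "\<dots> = transit (\<lambda>j. K (Suc (i + j))) (\<lambda>_ _ _. 1) 0 N a b x" by (rule Suc.IH)
  finally show ?case by simp
qed simp

lemma smooth_along_mass:
  assumes "\<And>j c. smooth_along L (\<lambda>_ :: 'z::topological_space. g j c)"
  shows "smooth_along L (\<lambda>_ :: 'z. mass K g i N a)"
proof -
  have "smooth_along L (\<lambda>_ :: 'z. path_sum K g (\<lambda>_ _. 1) i N a)"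
  proof (induction N arbitrary: i a)
    case 0
    have "path_sum K g (\<lambda>_ _. 1) i 0 a = (\<lambda>_. 1)" by (simp add: fun_eq_iff)
    then show ?case by (simp add: smooth_along_const)
  next
    case (Suc N)
    have "path_sum K g (\<lambda>_ _. 1) i (Suc N) a =
      (\<lambda>x. \<Sum>b\<in>UNIV. K i a b * (g (Suc i) b x * path_sum K g (\<lambda>_ _. 1) (Suc i) N b x))"
      by (simp add: fun_eq_iff)
    moreover have "smooth_along L (\<lambda>_ :: 'z. \<lambda>x. \<Sum>b\<in>UNIV. K i a b * (g (Suc i) b x * path_sum K g (\<lambda>_ _. 1) (Suc i) N b x))"
      by (intro smooth_along_sum smooth_along_mult smooth_along_const assms Suc.IH)
    ultimately show ?case by (simp only:)
  qed
  moreover have "mass K g i N a = path_sum K g (\<lambda>_ _. 1) i N a" by (simp add: fun_eq_iff mass_def)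
  ultimately show ?thesis by simp
qed

locale regime_model = smooth_likelihood \<phi> f \<theta> q + positive_markov_chain M \<eta>
  for \<phi> :: "'z::euclidean_space \<Rightarrow> real ^ 'd \<Rightarrow> 'x" and f :: "'x \<Rightarrow> real ^ 'd \<Rightarrow> ennreal"
    and \<theta> :: "'h::finite \<Rightarrow> real ^ 'p::{finite,linorder} \<Rightarrow> real ^ 'd" and q :: nat
    and M :: "'w measure" and \<eta> :: "int \<Rightarrow> 'w \<Rightarrow> 'h" +
  fixes Z :: "int \<Rightarrow> 'w \<Rightarrow> 'z" and H0 H1 :: "'h set" and \<kappa> :: nat and \<phi>s :: real
  assumes Z_indep: "indep_vars (\<lambda>_. borel) Z UNIV"
    and Z_distr: "distr M borel (Z s) = distr M borel (Z t)"
    and classes: "H0 \<noteq> {}" "H1 \<noteq> {}"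
    and \<kappa>_ge: "\<kappa> \<ge> 1" and \<phi>s_pos: "\<phi>s > 0"
    and mix: "\<bar>s - t\<bar> \<ge> int \<kappa> \<Longrightarrow> \<P>(\<omega> in M. \<eta> t \<omega> = b \<bar> \<eta> s \<omega> = a) \<ge> \<phi>s"
    and tail: "r > 0 \<Longrightarrow> \<exists>c>2.
          (\<lambda>u::real. \<P>(\<omega> in M. loglik_deriv_sup \<phi> f \<theta> q (Z 0 \<omega>) r \<ge> u))
            \<in> O[at_top](\<lambda>u. ln u powr (- c))"
begin

lemma Z_rv[measurable]: "random_variable borel (Z s)"
  using Z_indep by (auto simp: indep_vars_def2)

text \<open>
  Time is counted from \<open>t\<close> in direction \<open>e\<close>, so that past and future of \<open>t\<close> are both one-sided weighted chains.
\<close>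

definition obs_lik :: "int \<Rightarrow> int \<Rightarrow> 'w \<Rightarrow> nat \<Rightarrow> 'h \<Rightarrow> real ^ 'p::{finite,linorder} \<Rightarrow> real" where
  "obs_lik e t \<omega> j c = lik \<phi> f \<theta> (Z (t + e * int j) \<omega>) (\<eta> (t + e * int j) \<omega>) c"

lemma weighted_chain_obs:
  assumes "e = 1 \<or> e = - 1"
  shows "weighted_chain (kernel e t) (obs_lik e t \<omega>) \<kappa> \<phi>s"
proof
  fix i a b and x :: "real ^ 'p::{finite,linorder}"
  show "kernel e t i a b \<ge> 0" "(\<Sum>b\<in>UNIV. kernel e t i a b) = 1" by (rule kernel_nonneg kernel_sum)+
  show "obs_lik e t \<omega> i a x > 0" unfolding obs_lik_def by (rule lik_pos)
  show "\<phi>s > 0" "\<kappa> \<ge> 1" by (rule \<phi>s_pos \<kappa>_ge)+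
  have "(\<lambda>j. kernel e t (i + j)) = kernel e (t + e * int i)"
    by (simp add: fun_eq_iff kernel_def algebra_simps)
  then have "transit (kernel e t) (\<lambda>_ _ _. 1) i \<kappa> a b x =
      \<P>(\<omega> in M. \<eta> (t + e * int i + e * int \<kappa>) \<omega> = b \<bar> \<eta> (t + e * int i) \<omega> = a)"
    unfolding transit_shift[of _ i] using kernel_transit[OF assms \<kappa>_ge] by simp
  also have "\<dots> \<ge> \<phi>s" using assms by (intro mix) auto
  finally show "transit (kernel e t) (\<lambda>_ _ _. 1) i \<kappa> a b x \<ge> \<phi>s" .
qed

definition weight :: "int \<Rightarrow> 'w \<Rightarrow> 'h \<Rightarrow> real ^ 'p::{finite,linorder} \<Rightarrow> real" where
  "weight t \<omega> a x = prob {\<omega>' \<in> space M. \<eta> t \<omega>' = a} * obs_lik 1 t \<omega> 0 a x"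

text \<open>
  Masses are normalized by the mass from one reference state, which cancels in the ratio; \<open>undefined\<close> names an
  arbitrary state.
\<close>

definition past :: "int \<Rightarrow> 'w \<Rightarrow> nat \<Rightarrow> 'h \<Rightarrow> real ^ 'p::{finite,linorder} \<Rightarrow> real" where
  "past t \<omega> = weighted_chain.nmass (kernel (- 1) t) (obs_lik (- 1) t \<omega>) undefined"

definition future :: "int \<Rightarrow> 'w \<Rightarrow> nat \<Rightarrow> 'h \<Rightarrow> real ^ 'p::{finite,linorder} \<Rightarrow> real" where
  "future t \<omega> = weighted_chain.nmass (kernel 1 t) (obs_lik 1 t \<omega>) undefined"

lemma class_weight_eq:
  assumes "- int m \<le> t" "t \<le> int n"
  shows "class_weight M \<eta> Z \<phi> f \<theta> A t m n \<omega> x =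
    (\<Sum>a\<in>A. weight t \<omega> a x * (mass (kernel (- 1) t) (obs_lik (- 1) t \<omega>) 0 (nat (t + int m)) a x *
       mass (kernel 1 t) (obs_lik 1 t \<omega>) 0 (nat (int n - t)) a x))"
  unfolding class_weight_def
proof (rule sum.cong[OF refl])
  fix a
  define G where "G s c = lik \<phi> f \<theta> (Z s \<omega>) (\<eta> s \<omega>) c x" for s c
  have psi: "psi \<phi> f \<theta> \<eta> Z s \<omega> x c = G s c" for s c
    by (simp add: psi_def obs_def G_def lik_def)
  have m: "- int m = t - int (nat (t + int m))" and n: "int n = t + int (nat (int n - t))"
    using assms by auto
  have "prob {\<omega>' \<in> space M. \<eta> t \<omega>' = a} * copy_cond_expectation M \<eta> t a
      (\<lambda>\<sigma>. \<Prod>s\<in>{- int m..int n}. psi \<phi> f \<theta> \<eta> Z s \<omega> x (\<sigma> s)) =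
      path_mean (- int m) (int n) (G(t := \<lambda>c. of_bool (c = a) * G t c))"
    unfolding psi using assms by (intro copy_expectation_eq) auto
  also have "\<dots> = prob {\<omega> \<in> space M. \<eta> t \<omega> = a} * G t a
       * path_sum (kernel (- 1) t) (\<lambda>j c x. G (t - int j) c) (\<lambda>_ _. 1) 0 (nat (t + int m)) a ()
       * path_sum (kernel 1 t) (\<lambda>j c x. G (t + int j) c) (\<lambda>_ _. 1) 0 (nat (int n - t)) a ()"
    by (rule path_mean_split[OF m n])
  also have "path_sum (kernel (- 1) t) (\<lambda>j c x. G (t - int j) c) (\<lambda>_ _. 1) 0 (nat (t + int m)) a () =
      mass (kernel (- 1) t) (obs_lik (- 1) t \<omega>) 0 (nat (t + int m)) a x"
    unfolding mass_def by (subst path_sum_at_point[where y = "()"]) (simp add: obs_lik_def G_def)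
  also have "path_sum (kernel 1 t) (\<lambda>j c x. G (t + int j) c) (\<lambda>_ _. 1) 0 (nat (int n - t)) a () =
      mass (kernel 1 t) (obs_lik 1 t \<omega>) 0 (nat (int n - t)) a x"
    unfolding mass_def by (subst path_sum_at_point[where y = "()"]) (simp add: obs_lik_def G_def)
  also have "prob {\<omega> \<in> space M. \<eta> t \<omega> = a} * G t a = weight t \<omega> a x"
    by (simp add: weight_def obs_lik_def G_def)
  finally show "prob {\<omega>' \<in> space M. \<eta> t \<omega>' = a} * copy_cond_expectation M \<eta> t a
      (\<lambda>\<sigma>. \<Prod>s\<in>{- int m..int n}. psi \<phi> f \<theta> \<eta> Z s \<omega> x (\<sigma> s)) =
      weight t \<omega> a x * (mass (kernel (- 1) t) (obs_lik (- 1) t \<omega>) 0 (nat (t + int m)) a x *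
       mass (kernel 1 t) (obs_lik 1 t \<omega>) 0 (nat (int n - t)) a x)"
    by (simp add: mult.assoc)
qed

lemma weight_pos: "weight t \<omega> a x > 0"
  unfolding weight_def obs_lik_def by (intro mult_pos_pos state_pos lik_pos)

lemma smooth_obs_lik:
  "sorted (rev L) \<Longrightarrow> length L \<le> q \<Longrightarrow> smooth_along L (\<lambda>_ :: real. obs_lik e t \<omega> j c)"
  unfolding obs_lik_def by (intro smooth_along_slice smooth_lik)

lemma smooth_class_weight:
  assumes "sorted (rev L)" "length L \<le> q" "- int m \<le> t" "t \<le> int n"
  shows "smooth_along L (\<lambda>_ :: real. class_weight M \<eta> Z \<phi> f \<theta> A t m n \<omega>)"
  unfolding class_weight_eq[OF assms(3,4), abs_def] weight_def
  by (intro smooth_along_sum smooth_along_mult smooth_along_const smooth_along_mass smooth_obs_lik assms)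

lemma class_weight_pos:
  assumes "A \<noteq> {}" "- int m \<le> t" "t \<le> int n"
  shows "class_weight M \<eta> Z \<phi> f \<theta> A t m n \<omega> x > 0"
  unfolding class_weight_eq[OF assms(2,3)]
  by (intro sum_pos assms mult_pos_pos weight_pos
      weighted_chain.mass_pos[OF weighted_chain_obs]) auto

abbreviation ratio :: "int \<Rightarrow> nat \<Rightarrow> nat \<Rightarrow> 'w \<Rightarrow> real ^ 'p::{finite,linorder} \<Rightarrow> real" where
  "ratio \<equiv> lratio M \<eta> Z \<phi> f \<theta> H0 H1"

lemma smooth_ratio:
  assumes "sorted (rev L)" "length L \<le> q" "- int m \<le> t" "t \<le> int n"
  shows "smooth_along L (\<lambda>_ :: real. ratio t m n \<omega>)"
proof -
  have "class_weight M \<eta> Z \<phi> f \<theta> H0 t m n \<omega> x \<noteq> 0" for x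
    using class_weight_pos[OF classes(1) assms(3,4), of \<omega> x] by simp
  then have "smooth_along L (\<lambda>_ :: real. \<lambda>x. class_weight M \<eta> Z \<phi> f \<theta> H1 t m n \<omega> x *
      inverse (class_weight M \<eta> Z \<phi> f \<theta> H0 t m n \<omega> x))"
    by (intro smooth_along_mult smooth_along_inverse smooth_class_weight assms)
  then show ?thesis by (simp add: lratio_def[abs_def] divide_inverse)
qed

lemma ratio_C_class:
  assumes "- int m \<le> t" "t \<le> int n"
  shows "C_class q (ratio t m n \<omega>)"
  by (intro C_class_if_smooth_along smooth_ratio assms)

text \<open>
  The normalizing constants of past and future cancel in the quotient.
\<close>

lemma ratio_eq:
  assumes "- int m \<le> t" "t \<le> int n"
  shows "ratio t m n \<omega> x =
    triple_sum H1 (weight t \<omega>) (past t \<omega> (nat (t + int m))) (future t \<omega> (nat (int n - t))) x /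
    triple_sum H0 (weight t \<omega>) (past t \<omega> (nat (t + int m))) (future t \<omega> (nat (int n - t))) x"
proof -
  interpret P: weighted_chain "kernel (- 1) t" "obs_lik (- 1) t \<omega>" \<kappa> \<phi>s by (rule weighted_chain_obs) simp
  interpret F: weighted_chain "kernel 1 t" "obs_lik 1 t \<omega>" \<kappa> \<phi>s by (rule weighted_chain_obs) simp
  define p where "p = mass (kernel (- 1) t) (obs_lik (- 1) t \<omega>) 0 (nat (t + int m)) undefined x"
  define u where "u = mass (kernel 1 t) (obs_lik 1 t \<omega>) 0 (nat (int n - t)) undefined x"
  have pu: "p > 0" "u > 0" unfolding p_def u_def by (rule P.mass_pos F.mass_pos)+
  have "class_weight M \<eta> Z \<phi> f \<theta> A t m n \<omega> x = p * u *
     triple_sum A (weight t \<omega>) (past t \<omega> (nat (t + int m))) (future t \<omega> (nat (int n - t))) x" for A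
    unfolding class_weight_eq[OF assms] triple_sum_def past_def future_def P.nmass_def F.nmass_def
      sum_distrib_left p_def[symmetric] u_def[symmetric]
    using pu by (intro sum.cong refl) (simp add: field_simps)
  then show ?thesis using pu by (simp add: lratio_def)
qed

lemma weight_tame:
  assumes "sorted (rev L)" "length L \<le> q"
  shows "\<exists>\<rho>>0. \<exists>D. \<forall>x\<in>cball 0 R. \<forall>a. tame x L \<rho> D (weight t \<omega> a)"
proof -
  obtain C where C: "C \<ge> 1" "\<And>z \<epsilon> a b. z \<in> cball 0 (norm (Z t \<omega>)) \<Longrightarrow> \<epsilon> \<in> cball 0 R \<Longrightarrow>
      1 / C \<le> lik \<phi> f \<theta> z a b \<epsilon> \<and> lik \<phi> f \<theta> z a b \<epsilon> \<le> C"
    using lik_bounds by metis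
  define p where "p a = prob {\<omega>' \<in> space M. \<eta> t \<omega>' = a}" for a
  define S where "S = 2 ^ q * max 1 (loglik_deriv_sup \<phi> f \<theta> q (Z t \<omega>) R)"
  have S: "S \<ge> 1" unfolding S_def using mult_mono[of 1 "2 ^ q" 1 "max 1 (loglik_deriv_sup \<phi> f \<theta> q (Z t \<omega>) R)"] by simp
  define \<rho> where "\<rho> = Min (range p) * (1 / C)"
  have pa: "p a > 0" for a by (simp add: p_def state_pos)
  have "Min (range p) \<in> range p" by (intro Min_in) auto
  then have mp: "Min (range p) > 0" using pa by auto
  have "tame x L \<rho> (C * S ^ length L) (weight t \<omega> a)" if x: "x \<in> cball 0 R" for x a
    unfolding tame_def
  proof (intro conjI allI weight_pos)
    have l: "1 / C \<le> obs_lik 1 t \<omega> 0 a x" "obs_lik 1 t \<omega> 0 a x \<le> C"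
      using C(2)[OF _ x, of "Z t \<omega>" "\<eta> t \<omega>" a] by (auto simp: obs_lik_def)
    have "Min (range p) \<le> p a" by (intro Min_le) auto
    then show "\<rho> \<le> weight t \<omega> a x" unfolding \<rho>_def weight_def p_def[symmetric]
      using l C(1) mp less_imp_le[OF pa] by (intro mult_mono) auto
    have "jet_bound x L (obs_lik 1 t \<omega> 0 a) (obs_lik 1 t \<omega> 0 a x) (S * 1)"
      unfolding S_def obs_lik_def using jet_bound_lik[OF assms, of x R "Z t \<omega>" "\<eta> t \<omega>" a] x by simp
    then have "jet_bound x L (obs_lik 1 t \<omega> 0 a) (obs_lik 1 t \<omega> 0 a x * S ^ length L) 1"
      using S by (intro jet_bound_rescale) auto
    then have "jet_bound x L (\<lambda>x. p a * obs_lik 1 t \<omega> 0 a x) (\<bar>p a\<bar> * (obs_lik 1 t \<omega> 0 a x * S ^ length L)) 1"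
      by (intro jet_bound_cmult) auto
    then have "jet_bound x L (weight t \<omega> a) (p a * (obs_lik 1 t \<omega> 0 a x * S ^ length L)) 1"
      by (simp add: weight_def[abs_def] p_def)
    moreover have "p a * (obs_lik 1 t \<omega> 0 a x * S ^ length L) \<le> 1 * (C * S ^ length L)"
      using l S C(1) by (intro mult_mono mult_right_mono) (auto simp: p_def obs_lik_def lik_pos less_imp_le)
    ultimately have "jet_bound x L (weight t \<omega> a) (1 * (C * S ^ length L)) 1"
      by (rule jet_bound_mono) auto
    then show "jet_bound x L (weight t \<omega> a) (C * S ^ length L) 1" by simp
  qed
  moreover have "\<rho> > 0" unfolding \<rho>_def using mp C(1) by simp
  ultimately show ?thesis by blast
qed

text \<open>
  The deterministic constants are chosen in this order: the radius \<open>B\<close> so large that times with \<open>|Z\<^sub>s| > B\<close> are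
  rare compared with the block length, the bound \<open>C\<close> for the likelihoods on that compact set, the contraction factor \<open>lam\<close>,
  and \<open>\<mu> = lam\<^bsup>1/(2\<kappa>)\<^esup>\<close>, the decay per step. The growth rate \<open>b\<close> allowed to \<open>M\<^sub>q(Z\<^sub>s)\<close> is so close to 1
  that \<open>b\<^sup>q \<mu> \<le> \<mu>\<^bsup>1/2\<^esup> = r\<close>. In particular \<open>r\<close> is deterministic and depends neither on \<open>t\<close> nor on the direction.
\<close>

lemma one_sided_limit:
  assumes R: "R > 0"
  shows "\<exists>r. 0 < r \<and> r < 1 \<and> (\<forall>e t. (e = 1 \<or> e = - 1) \<longrightarrow> (AE \<omega> in M. \<forall>L. sorted (rev L) \<and> length L \<le> q \<longrightarrow>
    stable_family L (cball 0 R) r (weighted_chain.nmass (kernel e t) (obs_lik e t \<omega>) undefined)))"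
proof -
  define k where "k = 2 * \<kappa>"
  have "\<exists>B. prob {\<omega> \<in> space M. norm (Z 0 \<omega>) > B} \<le> 1 / 4 ^ k"
    by (rule tight) auto
  then obtain B where B: "prob {\<omega> \<in> space M. norm (Z 0 \<omega>) > B} \<le> 1 / 4 ^ k" by blast
  have B_all: "prob {\<omega> \<in> space M. Z s \<omega> \<in> {z. norm z > B}} * 4 ^ k \<le> 1" for s
  proof -
    have "prob {\<omega> \<in> space M. Z s \<omega> \<in> {z. norm z > B}} = measure (distr M borel (Z s)) {z. norm z > B}" for s
      by (subst measure_distr) (auto simp: vimage_def Int_def conj_commute)
    then have "prob {\<omega> \<in> space M. Z s \<omega> \<in> {z. norm z > B}} = prob {\<omega> \<in> space M. Z 0 \<omega> \<in> {z. norm z > B}}"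
      using Z_distr by metis
    then show ?thesis using B by (simp add: field_simps)
  qed
  obtain C where C: "C \<ge> 1" "\<And>z \<epsilon> a b. z \<in> cball 0 B \<Longrightarrow> \<epsilon> \<in> cball 0 R \<Longrightarrow>
      1 / C \<le> lik \<phi> f \<theta> z a b \<epsilon> \<and> lik \<phi> f \<theta> z a b \<epsilon> \<le> C"
    using lik_bounds by metis
  define lam where "lam = 1 - \<phi>s\<^sup>2 / (2 * C ^ (4 * \<kappa>))"
  have \<phi>s_le: "\<phi>s \<le> 1"
    by (rule weighted_chain.\<phi>_le[OF weighted_chain_obs[of 1 0 undefined]]) simp
  have C4: "C ^ (4 * \<kappa>) \<ge> 1" using C(1) by simp
  have "\<phi>s\<^sup>2 \<le> 1" using \<phi>s_le \<phi>s_pos by (simp add: power_le_one)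
  then have lam: "0 < lam" "lam < 1" unfolding lam_def using C4 \<phi>s_pos by (auto simp: field_simps)
  define \<mu> where "\<mu> = lam powr (1 / (2 * \<kappa>))"
  have \<mu>: "0 < \<mu>" "\<mu> < 1" unfolding \<mu>_def using lam \<kappa>_ge by (simp_all add: powr01_less_one)
  define b where "b = \<mu> powr (- 1 / (2 * (q + 1)))"
  have "\<mu> powr (1 / (2 * (q + 1))) < 1" using \<mu> by (simp add: powr01_less_one)
  moreover have "b = inverse (\<mu> powr (1 / (2 * (q + 1))))" unfolding b_def by (simp add: powr_minus[symmetric])
  ultimately have b: "b > 1" using \<mu> by (simp add: one_less_inverse)
  define r where "r = \<mu> powr (1 / 2)"
  have r: "0 < r" "r < 1" unfolding r_def using \<mu> by (simp_all add: powr01_less_one)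
  have br: "b ^ q * \<mu> \<le> r"
  proof -
    have "b ^ q = \<mu> powr (- 1 / (2 * (q + 1)) * real q)"
      unfolding b_def using \<mu> by (subst powr_power) auto
    then have "b ^ q * \<mu> = \<mu> powr (- 1 / (2 * (q + 1)) * real q + 1)"
      using \<mu> by (simp only: powr_add powr_one less_imp_le)
    also have "\<dots> \<le> \<mu> powr (1 / 2)"
      using \<mu> by (intro powr_mono') (auto simp: field_simps)
    finally show ?thesis by (simp add: r_def)
  qed
  let ?m = "\<lambda>z. loglik_deriv_sup \<phi> f \<theta> q z R"
  obtain c where c: "c > 2" "(\<lambda>u::real. \<P>(\<omega> in M. ?m (Z 0 \<omega>) \<ge> u)) \<in> O[at_top](\<lambda>u. ln u powr (- c))"
    using tail[OF R] by blast
  show ?thesis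
  proof (rule exI[of _ r], intro conjI r allI impI)
    fix e t :: int assume e: "e = 1 \<or> e = - 1"
    define \<iota> where "\<iota> j = t + e * int j" for j
    have inj: "inj \<iota>" using e unfolding \<iota>_def inj_def by auto
    have "AE \<omega> in M. \<exists>n0. \<forall>N\<ge>n0. card ({j. Z (\<iota> j) \<omega> \<in> {z. norm z > B}} \<inter> {0<..N}) * k \<le> N"
      by (rule AE_count_le[OF Z_indep _ B_all inj]) auto
    moreover have "AE \<omega> in M. \<exists>A. \<forall>j. ?m (Z (\<iota> j) \<omega>) \<le> A * b ^ j"
    proof (rule AE_subexponential[OF Z_rv])
      show "distr M borel (Z s) = distr M borel (Z 0)" for s by (rule Z_distr)
      show "c > 1" using c(1) by simp
    qed (rule deriv_sup_measurable[OF R] c(2) b)+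
    ultimately show "AE \<omega> in M. \<forall>L. sorted (rev L) \<and> length L \<le> q \<longrightarrow>
      stable_family L (cball 0 R) r (weighted_chain.nmass (kernel e t) (obs_lik e t \<omega>) undefined)"
    proof eventually_elim
      case (elim \<omega>)
      interpret W: weighted_chain "kernel e t" "obs_lik e t \<omega>" \<kappa> \<phi>s by (rule weighted_chain_obs[OF e])
      obtain n0 where n0: "\<And>N. N \<ge> n0 \<Longrightarrow> card ({j. Z (\<iota> j) \<omega> \<in> {z. norm z > B}} \<inter> {0<..N}) * k \<le> N"
        using elim(1) by blast
      obtain A where A: "\<And>j. ?m (Z (\<iota> j) \<omega>) \<le> A * b ^ j" using elim(2) by blast
      define s where "s j = 2 ^ q * max 1 (?m (Z (\<iota> j) \<omega>))" for j
      have s1: "s j \<ge> 1" for j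
        unfolding s_def using mult_mono[of 1 "2 ^ q" 1 "max 1 (?m (Z (\<iota> j) \<omega>))"] by simp
      have s2: "s j \<le> 2 ^ q * max 1 A * b ^ j" for j
      proof -
        have bj: "1 \<le> b ^ j" using b by simp
        have "max 1 (?m (Z (\<iota> j) \<omega>)) \<le> max 1 A * b ^ j"
        proof (rule max.boundedI)
          show "1 \<le> max 1 A * b ^ j" using mult_mono[of 1 "max 1 A" 1 "b ^ j"] bj by simp
          have "?m (Z (\<iota> j) \<omega>) \<le> A * b ^ j" by (rule A)
          also have "\<dots> \<le> max 1 A * b ^ j" using bj by (intro mult_right_mono) auto
          finally show "?m (Z (\<iota> j) \<omega>) \<le> max 1 A * b ^ j" .
        qed
        then show ?thesis unfolding s_def mult.assoc by (intro mult_left_mono) auto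
      qed
      define B' where "B' = (\<Sum>j\<in>{0<..\<kappa>}. norm (Z (\<iota> j) \<omega>))"
      obtain C0 where C0: "C0 \<ge> 1" "\<And>z \<epsilon> a b. z \<in> cball 0 B' \<Longrightarrow> \<epsilon> \<in> cball 0 R \<Longrightarrow>
          1 / C0 \<le> lik \<phi> f \<theta> z a b \<epsilon> \<and> lik \<phi> f \<theta> z a b \<epsilon> \<le> C0"
        using lik_bounds by metis
      show ?case
      proof (intro allI impI, elim conjE)
        fix L :: "'p list" assume L: "sorted (rev L)" "length L \<le> q"
        have "\<exists>D N0. \<exists>\<rho>>0. 0 < D \<and> (\<forall>x\<in>cball 0 R. \<forall>a. \<forall>N\<ge>N0.
           \<rho> \<le> W.nmass undefined N a x \<and> jet_bound x L (W.nmass undefined N a) D 1 \<and>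
           (\<forall>N'\<ge>N. jet_bound x L (\<lambda>x. W.nmass undefined N' a x - W.nmass undefined N a x) (D * r ^ N) 1))"
        proof (rule W.nmass_limit[where s = s and A = "2 ^ q * max 1 A" and b = b and C = C and lam = lam
              and Bad = "{j. Z (\<iota> j) \<omega> \<in> {z. norm z > B}}" and ?n0.0 = n0 and ?C0.0 = C0 and q = q])
          fix x j and d :: 'h assume x: "x \<in> cball (0 :: real ^ 'p::{finite,linorder}) R"
          show "jet_bound x L (obs_lik e t \<omega> j d) (obs_lik e t \<omega> j d x) (s j)"
            unfolding obs_lik_def s_def \<iota>_def using x by (intro jet_bound_lik L) simp
          show "1 / C \<le> obs_lik e t \<omega> j d x \<and> obs_lik e t \<omega> j d x \<le> C"
            if "j \<notin> {j. Z (\<iota> j) \<omega> \<in> {z. norm z > B}}"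
            unfolding obs_lik_def using that x by (intro C(2)) (auto simp: \<iota>_def)
          show "1 / C0 \<le> obs_lik e t \<omega> j d x \<and> obs_lik e t \<omega> j d x \<le> C0" if j: "j \<in> {0<..\<kappa>}"
          proof -
            have "norm (Z (\<iota> j) \<omega>) \<le> B'" unfolding B'_def by (rule member_le_sum[OF j]) auto
            then show ?thesis unfolding obs_lik_def using x by (intro C0(2)) (auto simp: \<iota>_def)
          qed
        next
          show "card ({j. Z (\<iota> j) \<omega> \<in> {z. norm z > B}} \<inter> {0<..N}) * (2 * \<kappa>) \<le> N" if "N \<ge> n0" for N
            using n0[OF that] by (simp add: k_def)
          show "b ^ q * lam powr (1 / (2 * \<kappa>)) \<le> r" using br by (simp add: \<mu>_def)
        qed (fact s1 s2 C(1) lam_def C0(1) L(2) b r(2))+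
        then show "stable_family L (cball 0 R) r (W.nmass undefined)"
          unfolding stable_family_def tame_def using W.nmass_pos by simp
      qed
    qed
  qed
qed


definition cauchy_ratio :: "real \<Rightarrow> real \<Rightarrow> int \<Rightarrow> 'p::{finite,linorder} list \<Rightarrow> 'w \<Rightarrow> bool" where
  "cauchy_ratio R r t L \<omega> \<longleftrightarrow>
     (\<exists>C k. \<exists>c>0. \<forall>x\<in>cball 0 R. \<forall>m\<ge>k. \<forall>n\<ge>k. c \<le> ratio t m n \<omega> x \<and>
        (\<forall>m'\<ge>m. \<forall>n'\<ge>n. jet_bound x L (\<lambda>x. ratio t m' n' \<omega> x - ratio t m n \<omega> x) (C * (r ^ m + r ^ n)) 1))"

text \<open>
  The index of the past is \<open>t + m\<close> and that of the future is \<open>n - t\<close>; replacing them by \<open>m\<close> and \<open>n\<close> in the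
  rate costs the factor \<open>1 / r\<^bsup>|t|\<^esup>\<close>.
\<close>

lemma ratio_jets_cauchy:
  assumes R: "R > 0"
  shows "\<exists>r. 0 < r \<and> r < 1 \<and> (\<forall>t. AE \<omega> in M. \<forall>L. sorted (rev L) \<and> length L \<le> q \<longrightarrow> cauchy_ratio R r t L \<omega>)"
proof -
  obtain r where r: "0 < r" "r < 1" and one: "\<forall>e t. e = 1 \<or> e = - 1 \<longrightarrow>
    (AE \<omega> in M. \<forall>L. sorted (rev L) \<and> length L \<le> q \<longrightarrow>
      stable_family L (cball 0 R) r (weighted_chain.nmass (kernel e t) (obs_lik e t \<omega>) undefined))"
    using one_sided_limit[OF R] by (elim exE conjE) (rule that)
  show ?thesis
  proof (rule exI[of _ r], intro conjI r allI)
    fix t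
    have "AE \<omega> in M. \<forall>L. sorted (rev L) \<and> length L \<le> q \<longrightarrow> stable_family L (cball 0 R) r (past t \<omega>)"
      unfolding past_def by (rule one[THEN spec, THEN spec, THEN mp]) simp
    moreover have "AE \<omega> in M. \<forall>L. sorted (rev L) \<and> length L \<le> q \<longrightarrow> stable_family L (cball 0 R) r (future t \<omega>)"
      unfolding future_def by (rule one[THEN spec, THEN spec, THEN mp]) simp
    ultimately show "AE \<omega> in M. \<forall>L. sorted (rev L) \<and> length L \<le> q \<longrightarrow> cauchy_ratio R r t L \<omega>"
    proof eventually_elim
      case (elim \<omega>)
      show ?case
      proof (intro allI impI)
        fix L :: "'p list" assume L: "sorted (rev L) \<and> length L \<le> q"
        obtain D1 N1 \<rho>1 where p: "\<rho>1 > 0" "D1 > 0"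
          and past: "\<And>x a N. x \<in> cball 0 R \<Longrightarrow> N \<ge> N1 \<Longrightarrow> tame x L \<rho>1 D1 (past t \<omega> N a)"
          "\<And>x a N N'. x \<in> cball 0 R \<Longrightarrow> N \<ge> N1 \<Longrightarrow> N' \<ge> N \<Longrightarrow>
             jet_bound x L (\<lambda>x. past t \<omega> N' a x - past t \<omega> N a x) (D1 * r ^ N) 1"
          using elim(1)[THEN spec, THEN mp, OF L] by (rule stable_familyE) (rule that)
        obtain D2 N2 \<rho>2 where u: "\<rho>2 > 0" "D2 > 0"
          and future: "\<And>x a N. x \<in> cball 0 R \<Longrightarrow> N \<ge> N2 \<Longrightarrow> tame x L \<rho>2 D2 (future t \<omega> N a)"
          "\<And>x a N N'. x \<in> cball 0 R \<Longrightarrow> N \<ge> N2 \<Longrightarrow> N' \<ge> N \<Longrightarrow>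
             jet_bound x L (\<lambda>x. future t \<omega> N' a x - future t \<omega> N a x) (D2 * r ^ N) 1"
          using elim(2)[THEN spec, THEN mp, OF L] by (rule stable_familyE) (rule that)
        obtain D3 \<rho>3 where w: "\<rho>3 > 0" "\<And>x a. x \<in> cball 0 R \<Longrightarrow> tame x L \<rho>3 D3 (weight t \<omega> a)"
          using weight_tame[of L R t \<omega>] L by blast
        define \<rho> where "\<rho> = min \<rho>1 (min \<rho>2 \<rho>3)"
        define D where "D = max D1 (max D2 D3)"
        have \<rho>: "\<rho> > 0" "\<rho> \<le> \<rho>1" "\<rho> \<le> \<rho>2" "\<rho> \<le> \<rho>3" using p u w by (auto simp: \<rho>_def)
        have D: "D > 0" "D1 \<le> D" "D2 \<le> D" "D3 \<le> D" using p(2) by (auto simp: D_def)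
        obtain C c where C: "C > 0" and c: "c > 0" and rj: "\<forall>x w F F' B B' e1 e2.
          (\<forall>a. tame x L \<rho> D (w a) \<and> tame x L \<rho> D (F a) \<and> tame x L \<rho> D (F' a) \<and>
             tame x L \<rho> D (B a) \<and> tame x L \<rho> D (B' a) \<and>
             jet_bound x L (\<lambda>x. F' a x - F a x) (D * e1) 1 \<and> jet_bound x L (\<lambda>x. B' a x - B a x) (D * e2) 1) \<and>
          e1 \<ge> 0 \<and> e2 \<ge> 0 \<longrightarrow>
          c \<le> triple_sum H1 w F B x / triple_sum H0 w F B x \<and>
          jet_bound x L (\<lambda>x. triple_sum H1 w F' B' x / triple_sum H0 w F' B' x -
             triple_sum H1 w F B x / triple_sum H0 w F B x) (C * (e1 + e2)) 1"
          using ratio_jets[OF classes \<rho>(1) D(1), of L] by (elim exE conjE) (rule that)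
        define T where "T = nat \<bar>t\<bar>"
        define k where "k = max N1 N2 + T"
        have main: "c \<le> ratio t m n \<omega> x \<and>
            jet_bound x L (\<lambda>x. ratio t m' n' \<omega> x - ratio t m n \<omega> x) (C / r ^ T * (r ^ m + r ^ n)) 1"
          if x: "x \<in> cball 0 R" and mn: "m \<ge> k" "n \<ge> k" "m' \<ge> m" "n' \<ge> n" for x m n m' n'
        proof -
          define a where "a = nat (t + int m)"
          define a' where "a' = nat (t + int m')"
          define b where "b = nat (int n - t)"
          define b' where "b' = nat (int n' - t)"
          have ab: "a \<ge> N1" "a' \<ge> a" "b \<ge> N2" "b' \<ge> b" "m \<le> a + T" "n \<le> b + T"
            using mn unfolding a_def a'_def b_def b'_def k_def T_def by auto
          have range: "- int m \<le> t" "t \<le> int n" "- int m' \<le> t" "t \<le> int n'"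
            using mn unfolding k_def T_def by auto
          have "c \<le> triple_sum H1 (weight t \<omega>) (past t \<omega> a) (future t \<omega> b) x /
                triple_sum H0 (weight t \<omega>) (past t \<omega> a) (future t \<omega> b) x \<and>
              jet_bound x L (\<lambda>x. triple_sum H1 (weight t \<omega>) (past t \<omega> a') (future t \<omega> b') x /
                triple_sum H0 (weight t \<omega>) (past t \<omega> a') (future t \<omega> b') x -
                triple_sum H1 (weight t \<omega>) (past t \<omega> a) (future t \<omega> b) x /
                triple_sum H0 (weight t \<omega>) (past t \<omega> a) (future t \<omega> b) x) (C * (r ^ a + r ^ b)) 1"
          proof (rule rj[rule_format], intro conjI allI)
            fix d
            show "tame x L \<rho> D (weight t \<omega> d)" by (rule tame_mono[OF w(2)[OF x] \<rho>(4) D(4)])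
            show "tame x L \<rho> D (past t \<omega> a d)" "tame x L \<rho> D (past t \<omega> a' d)"
              using ab by (auto intro!: tame_mono[OF past(1)[OF x] \<rho>(2) D(2)])
            show "tame x L \<rho> D (future t \<omega> b d)" "tame x L \<rho> D (future t \<omega> b' d)"
              using ab by (auto intro!: tame_mono[OF future(1)[OF x] \<rho>(3) D(3)])
            show "jet_bound x L (\<lambda>x. past t \<omega> a' d x - past t \<omega> a d x) (D * r ^ a) 1"
              by (rule jet_bound_mono[OF past(2)[OF x ab(1,2)]]) (use D r in auto)
            show "jet_bound x L (\<lambda>x. future t \<omega> b' d x - future t \<omega> b d x) (D * r ^ b) 1"
              by (rule jet_bound_mono[OF future(2)[OF x ab(3,4)]]) (use D r in auto)
          qed (use r in auto)
          then have res: "c \<le> ratio t m n \<omega> x \<and>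
              jet_bound x L (\<lambda>x. ratio t m' n' \<omega> x - ratio t m n \<omega> x) (C * (r ^ a + r ^ b)) 1"
            unfolding ratio_eq[OF range(1,2)] ratio_eq[OF range(3,4)] a_def a'_def b_def b'_def .
          have "r ^ a * r ^ T \<le> r ^ m" "r ^ b * r ^ T \<le> r ^ n"
            unfolding power_add[symmetric] using r ab by (auto intro!: power_decreasing)
          then have "r ^ a + r ^ b \<le> (r ^ m + r ^ n) / r ^ T" using r by (simp add: field_simps)
          then have "C * (r ^ a + r ^ b) \<le> C * ((r ^ m + r ^ n) / r ^ T)"
            using C by (intro mult_left_mono) auto
          then have "C * (r ^ a + r ^ b) \<le> C / r ^ T * (r ^ m + r ^ n)" by simp
          from jet_bound_mono[OF conjunct2[OF res] this] conjunct1[OF res] show ?thesis by simp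
        qed
        show "cauchy_ratio R r t L \<omega>" unfolding cauchy_ratio_def
        proof (rule exI[of _ "C / r ^ T"], rule exI[of _ k], rule exI[of _ c], intro conjI c ballI allI impI)
          fix x :: "real ^ 'p::{finite,linorder}" and m n assume *: "x \<in> cball 0 R" "k \<le> m" "k \<le> n"
          show "c \<le> ratio t m n \<omega> x" by (rule main[OF * order.refl order.refl, THEN conjunct1])
          fix m' n' assume "m \<le> m'" "n \<le> n'"
          then show "jet_bound x L (\<lambda>x. ratio t m' n' \<omega> x - ratio t m n \<omega> x) (C / r ^ T * (r ^ m + r ^ n)) 1"
            by (rule main[OF *, THEN conjunct2])
        qed
      qed
    qed
  qed
qed

text \<open>
  The diagonal limit does not depend on the ball, so the same function serves for all radii.
\<close>

definition limit_deriv :: "('p \<Rightarrow> nat) \<Rightarrow> int \<Rightarrow> 'w \<Rightarrow> real ^ 'p::{finite,linorder} \<Rightarrow> real" where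
  "limit_deriv \<nu> t \<omega> x = lim (\<lambda>j. mi_deriv \<nu> (ratio t j j \<omega>) x)"

definition geometric_limit :: "real \<Rightarrow> real \<Rightarrow> int \<Rightarrow> ('p \<Rightarrow> nat) \<Rightarrow> 'w \<Rightarrow> bool" where
  "geometric_limit R r t \<nu> \<omega> \<longleftrightarrow>
     (\<exists>C k. \<exists>c>0. \<forall>x\<in>cball 0 R. \<forall>m\<ge>k. \<forall>n\<ge>k. c \<le> ratio t m n \<omega> x \<and>
        \<bar>mi_deriv \<nu> (ratio t m n \<omega>) x - limit_deriv \<nu> t \<omega> x\<bar> \<le> C * (r ^ m + r ^ n))"

lemma ratio_deriv_limit:
  assumes R: "R > 0"
  shows "\<exists>r. 0 < r \<and> r < 1 \<and> (\<forall>t. AE \<omega> in M. \<forall>\<nu>. mi_size \<nu> \<le> q \<longrightarrow> geometric_limit R r t \<nu> \<omega>)"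
proof -
  obtain r where r: "0 < r" "r < 1" and lim: "\<forall>t. AE \<omega> in M. \<forall>L. sorted (rev L) \<and> length L \<le> q \<longrightarrow> cauchy_ratio R r t L \<omega>"
    using ratio_jets_cauchy[OF R] by (elim exE conjE) (rule that)
  show ?thesis
  proof (rule exI[of _ r], intro conjI r allI)
    fix t
    show "AE \<omega> in M. \<forall>\<nu>. mi_size \<nu> \<le> q \<longrightarrow> geometric_limit R r t \<nu> \<omega>"
      using lim[THEN spec, of t]
    proof eventually_elim
      case (elim \<omega>)
      show ?case
      proof (intro allI impI)
        fix \<nu> :: "'p \<Rightarrow> nat" assume \<nu>: "mi_size \<nu> \<le> q"
        define L where "L = rev (mi_list \<nu>)"
        have L: "sorted (rev L) \<and> length L \<le> q" using \<nu> by (simp add: L_def mi_list_properties)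
        obtain C k c where c: "c > 0" and all: "\<forall>x\<in>cball 0 R. \<forall>m\<ge>k. \<forall>n\<ge>k. c \<le> ratio t m n \<omega> x \<and>
          (\<forall>m'\<ge>m. \<forall>n'\<ge>n. jet_bound x L (\<lambda>x. ratio t m' n' \<omega> x - ratio t m n \<omega> x) (C * (r ^ m + r ^ n)) 1)"
          using elim[THEN spec, THEN mp, OF L] unfolding cauchy_ratio_def by (elim exE conjE) (rule that)
        have lower: "c \<le> ratio t m n \<omega> x" if "x \<in> cball 0 R" "m \<ge> k" "n \<ge> k" for x m n
          using all that by blast
        have C: "jet_bound x L (\<lambda>x. ratio t m' n' \<omega> x - ratio t m n \<omega> x) (C * (r ^ m + r ^ n)) 1"
          if "x \<in> cball 0 R" "m \<ge> k" "n \<ge> k" "m' \<ge> m" "n' \<ge> n" for x m n m' n'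
          using all that by blast
        define k' where "k' = max k (nat \<bar>t\<bar>)"
        have close: "\<bar>mi_deriv \<nu> (ratio t m' n' \<omega>) x - mi_deriv \<nu> (ratio t m n \<omega>) x\<bar> \<le> C * (r ^ m + r ^ n)"
          if x: "x \<in> cball 0 R" and mn: "m \<ge> k'" "n \<ge> k'" "m' \<ge> m" "n' \<ge> n" for x m n m' n'
        proof -
          have range: "- int m \<le> t" "t \<le> int n" "- int m' \<le> t" "t \<le> int n'"
            using mn unfolding k'_def by auto
          have "partial_derivs_exist (mi_list \<nu>) (ratio t m n \<omega>)" "partial_derivs_exist (mi_list \<nu>) (ratio t m' n' \<omega>)"
            using smooth_alongD(1)[OF smooth_ratio[OF conjunct1[OF L] conjunct2[OF L] range(1,2)]]
              smooth_alongD(1)[OF smooth_ratio[OF conjunct1[OF L] conjunct2[OF L] range(3,4)]]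
            by (auto simp: L_def)
          then have "mi_deriv \<nu> (ratio t m' n' \<omega>) x - mi_deriv \<nu> (ratio t m n \<omega>) x =
              partial_derivs (rev L) (\<lambda>x. ratio t m' n' \<omega> x - ratio t m n \<omega> x) x"
            by (simp add: mi_deriv_def L_def partial_derivs_diff)
          then show ?thesis
            using jet_boundD(1)[OF C[OF x _ _ mn(3,4)]] mn unfolding k'_def by simp
        qed
        show "geometric_limit R r t \<nu> \<omega>" unfolding geometric_limit_def
        proof (rule exI[of _ C], rule exI[of _ k'], rule exI[of _ c], intro conjI c ballI allI impI)
          fix x :: "real ^ 'p::{finite,linorder}" and m n assume *: "x \<in> cball 0 R" "k' \<le> m" "k' \<le> n"
          show "c \<le> ratio t m n \<omega> x" using * by (intro lower) (auto simp: k'_def)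
          show "\<bar>mi_deriv \<nu> (ratio t m n \<omega>) x - limit_deriv \<nu> t \<omega> x\<bar> \<le> C * (r ^ m + r ^ n)"
            unfolding limit_deriv_def
            by (rule double_limit[where a = "\<lambda>m n. mi_deriv \<nu> (ratio t m n \<omega>) x" and k = k', OF r _ *(2,3)])
              (rule close[OF *(1)])
        qed
      qed
    qed
  qed
qed

lemma mi_deriv_zero:
  fixes h :: "real ^ 'p::{finite,linorder} \<Rightarrow> real"
  shows "mi_deriv (\<lambda>_. 0) h = h"
  using mi_list_properties(2)[of "\<lambda>_ :: 'p. 0"] by (simp add: mi_deriv_def mi_size_def)

lemma geometric_limit_tendsto:
  assumes "\<And>N. geometric_limit (real (Suc N)) (r N) t \<nu> \<omega>" "\<And>N. 0 < r N" "\<And>N. r N < 1"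
  shows "((\<lambda>(m, n). mi_deriv \<nu> (ratio t m n \<omega>) x) \<longlongrightarrow> limit_deriv \<nu> t \<omega> x) (sequentially \<times>\<^sub>F sequentially)"
    and "\<exists>c>0. \<forall>\<^sub>F (m, n) in sequentially \<times>\<^sub>F sequentially. c \<le> ratio t m n \<omega> x"
proof -
  define N where "N = nat \<lceil>norm x\<rceil>"
  have x: "x \<in> cball 0 (real (Suc N))" unfolding N_def by simp linarith
  obtain C k c where c: "c > 0" and all: "\<forall>x\<in>cball 0 (real (Suc N)). \<forall>m\<ge>k. \<forall>n\<ge>k. c \<le> ratio t m n \<omega> x \<and>
      \<bar>mi_deriv \<nu> (ratio t m n \<omega>) x - limit_deriv \<nu> t \<omega> x\<bar> \<le> C * (r N ^ m + r N ^ n)"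
    using assms(1)[of N] unfolding geometric_limit_def by (elim exE conjE) (rule that)
  show "((\<lambda>(m, n). mi_deriv \<nu> (ratio t m n \<omega>) x) \<longlongrightarrow> limit_deriv \<nu> t \<omega> x) (sequentially \<times>\<^sub>F sequentially)"
    using all x by (intro tendsto_if_double_rate[OF assms(2,3)[of N], where k = k and C = C]) auto
  show "\<exists>c>0. \<forall>\<^sub>F (m, n) in sequentially \<times>\<^sub>F sequentially. c \<le> ratio t m n \<omega> x"
    unfolding eventually_prod_sequentially using all x c by (intro exI[of _ c] conjI exI[of _ k]) auto
qed

end

section \<open>Smoothness and convergence of the likelihood ratio\<close>

theorem theorem2p1:
  fixes M :: "'w measure"
    and H0 H1 :: "'h::finite set"
    and \<eta> :: "int \<Rightarrow> 'w \<Rightarrow> 'h"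
    and Z :: "int \<Rightarrow> 'w \<Rightarrow> 'z::euclidean_space"
    and \<Theta> :: "(real ^ 'd) set"
    and \<phi> :: "'z \<Rightarrow> real ^ 'd \<Rightarrow> 'x::euclidean_space"
    and \<theta> :: "'h \<Rightarrow> real ^ 'p::{finite,linorder} \<Rightarrow> real ^ 'd"
    and f :: "'x \<Rightarrow> real ^ 'd \<Rightarrow> ennreal"
    and \<kappa> q :: nat
    and \<phi>s :: real
  assumes prob: "prob_space M"
    and partition: "H0 \<noteq> {}" "H1 \<noteq> {}" "H0 \<inter> H1 = {}" "H0 \<union> H1 = UNIV"
    and eta_rv: "\<And>t. \<eta> t \<in> measurable M (count_space UNIV)"
    and Z_rv: "\<And>t. Z t \<in> borel_measurable M"
    and Theta: "open \<Theta>" "\<And>a \<epsilon>. \<theta> a \<epsilon> \<in> \<Theta>"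
    and A1_indep: "indep_elements M
          (PiM UNIV (\<lambda>_. borel)) (\<lambda>\<omega> t. Z t \<omega>)
          (PiM UNIV (\<lambda>_. count_space UNIV)) (\<lambda>\<omega> t. \<eta> t \<omega>)"
    and A1_iid: "prob_space.indep_vars M (\<lambda>_. borel) Z UNIV"
          "\<And>s t. distr M borel (Z s) = distr M borel (Z t)"
    and A1_density: "\<And>v t. v \<in> \<Theta> \<Longrightarrow> distributed M lborel (\<lambda>\<omega>. \<phi> (Z t \<omega>) v) (\<lambda>x. f x v)"
    and A2_markov: "markov_chain M \<eta>"
    and A2_mixing: "\<kappa> \<ge> 1" "\<phi>s > 0"
          "\<And>a b s t. \<bar>s - t\<bar> \<ge> int \<kappa> \<Longrightarrow> \<P>(\<omega> in M. \<eta> t \<omega> = b \<bar> \<eta> s \<omega> = a) \<ge> \<phi>s"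
    and A3_pos: "\<And>z a b \<epsilon>. 0 < f (\<phi> z (\<theta> a \<epsilon>)) (\<theta> b \<epsilon>) \<and> f (\<phi> z (\<theta> a \<epsilon>)) (\<theta> b \<epsilon>) < \<infinity>"
    and A3_cont: "\<And>z a b. continuous_on UNIV (\<lambda>\<epsilon>. f (\<phi> z (\<theta> a \<epsilon>)) (\<theta> b \<epsilon>))"
    and A4_Cq: "\<And>z a b. C_class q (lik \<phi> f \<theta> z a b)"
    and A4_cont: "\<And>a b \<nu>. mi_size \<nu> \<le> q \<Longrightarrow>
          continuous_on UNIV (\<lambda>(z, \<epsilon>). mi_deriv \<nu> (lik \<phi> f \<theta> z a b) \<epsilon>)"
    and A4_tail: "\<And>r. r > 0 \<Longrightarrow> \<exists>c>2.
          (\<lambda>u::real. \<P>(\<omega> in M. loglik_deriv_sup \<phi> f \<theta> q (Z 0 \<omega>) r \<ge> u))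
            \<in> O[at_top](\<lambda>u. ln u powr (- c))"
  shows
    "(AE \<omega> in M. \<forall>m n t. - int m + int \<kappa> \<le> t \<and> t \<le> int n - int \<kappa> \<longrightarrow>
        C_class q (lratio M \<eta> Z \<phi> f \<theta> H0 H1 t m n \<omega>))
     \<and>
     (AE \<omega> in M. \<forall>t \<epsilon>. \<exists>L>0.
        ((\<lambda>(m, n). lratio M \<eta> Z \<phi> f \<theta> H0 H1 t m n \<omega> \<epsilon>) \<longlongrightarrow> L)
          (sequentially \<times>\<^sub>F sequentially))
     \<and>
     (\<exists>r :: int \<Rightarrow> ('p \<Rightarrow> nat) \<Rightarrow> real \<Rightarrow> real.
        (\<forall>t \<nu> \<epsilon>0. mi_size \<nu> \<le> q \<and> \<epsilon>0 > 0 \<longrightarrow> 0 < r t \<nu> \<epsilon>0 \<and> r t \<nu> \<epsilon>0 < 1) \<and>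
        (AE \<omega> in M. \<forall>t \<nu>. mi_size \<nu> \<le> q \<longrightarrow>
           (\<exists>g :: real ^ 'p::{finite,linorder} \<Rightarrow> real.
              (\<forall>\<epsilon>. ((\<lambda>(m, n). mi_deriv \<nu> (lratio M \<eta> Z \<phi> f \<theta> H0 H1 t m n \<omega>) \<epsilon>) \<longlongrightarrow> g \<epsilon>)
                 (sequentially \<times>\<^sub>F sequentially)) \<and>
              (\<forall>\<epsilon>0>0.
                 (\<forall>\<^sub>F (m, n) in sequentially \<times>\<^sub>F sequentially.
                    bdd_above ((\<lambda>\<epsilon>. \<bar>mi_deriv \<nu> (lratio M \<eta> Z \<phi> f \<theta> H0 H1 t m n \<omega>) \<epsilon> - g \<epsilon>\<bar>)
                      ` {\<epsilon>. norm \<epsilon> \<le> \<epsilon>0})) \<and>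
                 (\<lambda>(m, n). SUP \<epsilon>\<in>{\<epsilon>. norm \<epsilon> \<le> \<epsilon>0}.
                      \<bar>mi_deriv \<nu> (lratio M \<eta> Z \<phi> f \<theta> H0 H1 t m n \<omega>) \<epsilon> - g \<epsilon>\<bar>)
                   \<in> o[sequentially \<times>\<^sub>F sequentially](\<lambda>(m, n). r t \<nu> \<epsilon>0 ^ min m n)))))"
proof -
  interpret prob_space M by (rule prob)
  \<comment> \<open>A conditional probability given a null event is 0 by convention, so mixing makes every state possible.\<close>
  have state_pos: "prob {\<omega> \<in> space M. \<eta> t \<omega> = a} > 0" for t a
  proof -
    have "0 < \<P>(\<omega> in M. \<eta> (t + int \<kappa>) \<omega> = a \<bar> \<eta> t \<omega> = a)"
      using A2_mixing(3)[of t "t + int \<kappa>" a a] A2_mixing(2) by simp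
    then have "prob {\<omega> \<in> space M. \<eta> t \<omega> = a} \<noteq> 0" by (auto simp: cond_prob_def)
    then show ?thesis using zero_less_measure_iff by blast
  qed
  interpret regime_model \<phi> f \<theta> q M \<eta> Z H0 H1 \<kappa> \<phi>s
  proof unfold_locales
    show "0 < f (\<phi> z (\<theta> a \<epsilon>)) (\<theta> b \<epsilon>) \<and> f (\<phi> z (\<theta> a \<epsilon>)) (\<theta> b \<epsilon>) < \<infinity>" for z a b \<epsilon> by (rule A3_pos)
    show "C_class q (lik \<phi> f \<theta> z a b)" for z a b by (rule A4_Cq)
    show "continuous_on UNIV (\<lambda>(z, \<epsilon>). mi_deriv \<nu> (lik \<phi> f \<theta> z a b) \<epsilon>)" if "mi_size \<nu> \<le> q" for \<nu> a b
      using that by (rule A4_cont)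
    show "\<phi>s \<le> \<P>(\<omega> in M. \<eta> t \<omega> = b \<bar> \<eta> s \<omega> = a)" if "int \<kappa> \<le> \<bar>s - t\<bar>" for s t a b
      using that by (rule A2_mixing(3))
    show "\<exists>c>2. (\<lambda>u::real. \<P>(\<omega> in M. loglik_deriv_sup \<phi> f \<theta> q (Z 0 \<omega>) r \<ge> u)) \<in> O[at_top](\<lambda>u. ln u powr (- c))"
      if "r > 0" for r using that by (rule A4_tail)
    show "distr M borel (Z s) = distr M borel (Z t)" for s t by (rule A1_iid(2))
  qed (fact A2_markov state_pos A1_iid(1) partition A2_mixing)+
  \<comment> \<open>Balls of integer radius exhaust the space, so that countably many null sets are discarded.\<close>
  have "\<forall>N :: nat. \<exists>r. 0 < r \<and> r < 1 \<and>
      (\<forall>t. AE \<omega> in M. \<forall>\<nu>. mi_size \<nu> \<le> q \<longrightarrow> geometric_limit (real (Suc N)) r t \<nu> \<omega>)"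
    by (intro allI ratio_deriv_limit) simp
  then obtain r :: "nat \<Rightarrow> real" where r_all: "\<forall>N. 0 < r N \<and> r N < 1 \<and>
      (\<forall>t. AE \<omega> in M. \<forall>\<nu>. mi_size \<nu> \<le> q \<longrightarrow> geometric_limit (real (Suc N)) (r N) t \<nu> \<omega>)"
    by (rule choice[THEN exE])
  have r: "0 < r N" "r N < 1" for N using r_all by auto
  have AE_limit: "AE \<omega> in M. \<forall>N t \<nu>. mi_size \<nu> \<le> q \<longrightarrow> geometric_limit (real (Suc N)) (r N) t \<nu> \<omega>"
    by (subst AE_all_countable, rule allI, subst AE_all_countable, rule allI)
      (rule r_all[THEN spec, THEN conjunct2, THEN conjunct2, THEN spec])
  have part1: "AE \<omega> in M. \<forall>m n t. - int m + int \<kappa> \<le> t \<and> t \<le> int n - int \<kappa> \<longrightarrow> C_class q (ratio t m n \<omega>)"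
    by (intro AE_I2 allI impI ratio_C_class) auto
  have part2: "AE \<omega> in M. \<forall>t \<epsilon>. \<exists>L>0. ((\<lambda>(m, n). ratio t m n \<omega> \<epsilon>) \<longlongrightarrow> L) (sequentially \<times>\<^sub>F sequentially)"
    using AE_limit
  proof eventually_elim
    case (elim \<omega>)
    show ?case
    proof (intro allI)
      fix t and \<epsilon> :: "real ^ 'p::{finite,linorder}"
      let ?g = "limit_deriv (\<lambda>_. 0) t \<omega> \<epsilon>"
      have "geometric_limit (real (Suc N)) (r N) t (\<lambda>_. 0) \<omega>" for N
        using elim by (simp add: mi_size_def)
      note lim = geometric_limit_tendsto[OF this r, where x = \<epsilon>, unfolded mi_deriv_zero]
      obtain c where c: "c > 0" "\<forall>\<^sub>F (m, n) in sequentially \<times>\<^sub>F sequentially. c \<le> ratio t m n \<omega> \<epsilon>"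
        using lim(2) by blast
      have "c \<le> ?g"
        by (rule tendsto_lowerbound[OF lim(1)]) (use c(2) in \<open>simp_all add: case_prod_unfold prod_filter_eq_bot\<close>)
      then show "\<exists>L>0. ((\<lambda>(m, n). ratio t m n \<omega> \<epsilon>) \<longlongrightarrow> L) (sequentially \<times>\<^sub>F sequentially)"
        using lim(1) c(1) by (intro exI[of _ ?g]) auto
    qed
  qed
  \<comment> \<open>Any number strictly between the rate of the enclosing integer ball and 1 turns \<open>O\<close> into \<open>o\<close>.\<close>
  define rate where "rate (t :: int) (\<nu> :: 'p \<Rightarrow> nat) (\<epsilon>0 :: real) = (1 + r (nat \<lceil>\<epsilon>0\<rceil>)) / 2" for t \<nu> \<epsilon>0
  have rate: "r (nat \<lceil>\<epsilon>0\<rceil>) < rate t \<nu> \<epsilon>0" "0 < rate t \<nu> \<epsilon>0" "rate t \<nu> \<epsilon>0 < 1" for t \<nu> \<epsilon>0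
    using r[of "nat \<lceil>\<epsilon>0\<rceil>"] by (auto simp: rate_def)
  have part3: "AE \<omega> in M. \<forall>t \<nu>. mi_size \<nu> \<le> q \<longrightarrow>
           (\<exists>g :: real ^ 'p::{finite,linorder} \<Rightarrow> real.
              (\<forall>\<epsilon>. ((\<lambda>(m, n). mi_deriv \<nu> (ratio t m n \<omega>) \<epsilon>) \<longlongrightarrow> g \<epsilon>)
                 (sequentially \<times>\<^sub>F sequentially)) \<and>
              (\<forall>\<epsilon>0>0.
                 (\<forall>\<^sub>F (m, n) in sequentially \<times>\<^sub>F sequentially.
                    bdd_above ((\<lambda>\<epsilon>. \<bar>mi_deriv \<nu> (ratio t m n \<omega>) \<epsilon> - g \<epsilon>\<bar>)
                      ` {\<epsilon>. norm \<epsilon> \<le> \<epsilon>0})) \<and>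
                 (\<lambda>(m, n). SUP \<epsilon>\<in>{\<epsilon>. norm \<epsilon> \<le> \<epsilon>0}. \<bar>mi_deriv \<nu> (ratio t m n \<omega>) \<epsilon> - g \<epsilon>\<bar>)
                   \<in> o[sequentially \<times>\<^sub>F sequentially](\<lambda>(m, n). rate t \<nu> \<epsilon>0 ^ min m n)))"
    (is "AE \<omega> in M. \<forall>t \<nu>. mi_size \<nu> \<le> q \<longrightarrow> Ex (?P \<omega> t \<nu>)")
    using AE_limit
  proof eventually_elim
    case (elim \<omega>)
    show ?case
    proof (intro allI impI)
      fix t and \<nu> :: "'p \<Rightarrow> nat" assume "mi_size \<nu> \<le> q"
      then have lim: "geometric_limit (real (Suc N)) (r N) t \<nu> \<omega>" for N
        using elim by blast
      let ?X = "\<lambda>\<epsilon>0. {\<epsilon> :: real ^ 'p::{finite,linorder}. norm \<epsilon> \<le> \<epsilon>0}"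
      have bound: "\<exists>C k. \<forall>x\<in>?X \<epsilon>0. \<forall>m\<ge>k. \<forall>n\<ge>k. \<bar>mi_deriv \<nu> (ratio t m n \<omega>) x - limit_deriv \<nu> t \<omega> x\<bar>
          \<le> C * (r (nat \<lceil>\<epsilon>0\<rceil>) ^ m + r (nat \<lceil>\<epsilon>0\<rceil>) ^ n)" for \<epsilon>0
      proof -
        have "?X \<epsilon>0 \<subseteq> cball 0 (real (Suc (nat \<lceil>\<epsilon>0\<rceil>)))" by (intro subsetI) (simp, linarith)
        then show ?thesis using lim[of "nat \<lceil>\<epsilon>0\<rceil>"] unfolding geometric_limit_def by blast
      qed
      note small = uniform_rate_smallo[where g = "limit_deriv \<nu> t \<omega>" and a = "\<lambda>m n. mi_deriv \<nu> (ratio t m n \<omega>)",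
          OF r(1) rate(1,3)]
      show "Ex (?P \<omega> t \<nu>)"
      proof (intro exI[of _ "limit_deriv \<nu> t \<omega>"] conjI allI impI geometric_limit_tendsto(1)[OF lim r])
        fix \<epsilon>0 :: real assume "\<epsilon>0 > 0"
        then have ne: "?X \<epsilon>0 \<noteq> {}" by (auto intro!: exI[of _ 0])
        obtain C k where all: "\<forall>x\<in>?X \<epsilon>0. \<forall>m\<ge>k. \<forall>n\<ge>k. \<bar>mi_deriv \<nu> (ratio t m n \<omega>) x - limit_deriv \<nu> t \<omega> x\<bar>
          \<le> C * (r (nat \<lceil>\<epsilon>0\<rceil>) ^ m + r (nat \<lceil>\<epsilon>0\<rceil>) ^ n)"
          using bound[of \<epsilon>0] by blast
        show "\<forall>\<^sub>F (m, n) in sequentially \<times>\<^sub>F sequentially.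
            bdd_above ((\<lambda>\<epsilon>. \<bar>mi_deriv \<nu> (ratio t m n \<omega>) \<epsilon> - limit_deriv \<nu> t \<omega> \<epsilon>\<bar>) ` ?X \<epsilon>0)"
          by (rule small(1)[OF ne, of k C]) (use all in blast)
        show "(\<lambda>(m, n). SUP \<epsilon>\<in>?X \<epsilon>0. \<bar>mi_deriv \<nu> (ratio t m n \<omega>) \<epsilon> - limit_deriv \<nu> t \<omega> \<epsilon>\<bar>)
            \<in> o[sequentially \<times>\<^sub>F sequentially](\<lambda>(m, n). rate t \<nu> \<epsilon>0 ^ min m n)"
          by (rule small(2)[OF ne, of k C]) (use all in blast)
      qed
    qed
  qed
  show ?thesis
    by (intro conjI part1 part2 exI[of _ rate] part3 allI impI rate)
qed

end
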